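(* For $v\in\mathbb R$ let $\phi(v):=\mathbb P_v(\tau_0^-=\infty)$ and $\widehat\phi(v):=\mathbb P_v(\widehat\tau_0^-=\infty)$. Then for every $u\ge 0$, $$\widehat\phi(u)=\mathbb E\,\phi(u+U)\qquad\text{and}\qquad \phi(u)=\mathbb E\,\widehat\phi(u+D).$$
   Context: $X=(X_t)_{t\ge 0}$ is a real-valued (càdlàg) Lévy process; $\mathbb P_v$, $\mathbb E_v$ denote probability and expectation when $X$ is started at $v$, and $\mathbb P=\mathbb P_0$, $\mathbb E=\mathbb E_0$. $0<T_1<T_2<\dots$ are the epochs of a homogeneous Poisson process of fixed intensity $\lambda>0$ independent of $X$, and $T_0=0$. $\mathbb N_0=\{0,1,2,\dots\}$; the infimum or minimum of an empty set is $\infty$. First passage times: $\tau_0^-=\inf\{t\ge 0: X_t<0\}$ (continuous observation) and $\widehat\tau_0^-=\min\{T_i, i\in\mathbb N_0: X_{T_i}<0\}$ (Poisson observation). $\underline X_t=\inf\{X_s:s\in[0,t]\}$ and $\overline X_t=\sup\{X_s:s\in[0,t]\}$. $D$ and $U$ are random variables, independent of each other and of everything else, where $D$ has the law of $\underline X_{T_1}$ under $\mathbb P$ and $U$ has the law of $\overline X_{T_1}$ under $\mathbb P$. *)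

theory Defs
  imports "HOL-Probability.Probability"
begin

definition cadlag :: "(real \<Rightarrow> real) \<Rightarrow> bool" where
  "cadlag x \<longleftrightarrow>
     (\<forall>t\<ge>0. continuous (at_right t) x) \<and>
     (\<forall>t>0. \<exists>l. (x \<longlongrightarrow> l) (at_left t))"

text \<open>Processes are indexed by type \<^typ>\<open>real\<close>, but only times \<open>t \<ge> 0\<close> are constrained or used.
  Paths are cadlag for every outcome, so that the events below are measurable.
  Stochastic continuity follows from the other conditions.\<close>

locale levy_process = prob_space M for M :: "'a measure" +
  fixes X :: "real \<Rightarrow> 'a \<Rightarrow> real"
  assumes measurable_process: "\<And>t. 0 \<le> t \<Longrightarrow> random_variable borel (X t)"
    and starts_at_0: "AE \<omega> in M. X 0 \<omega> = 0"
    and independent_increments: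
      "\<And>t n. 0 \<le> t 0 \<Longrightarrow> (\<And>i. i < n \<Longrightarrow> t i < t (Suc i)) \<Longrightarrow>
         indep_vars (\<lambda>_. borel) (\<lambda>i \<omega>. X (t (Suc i)) \<omega> - X (t i) \<omega>) {..<n::nat}"
    and stationary_increments:
      "\<And>s t. 0 \<le> s \<Longrightarrow> 0 \<le> t \<Longrightarrow>
         distr M borel (\<lambda>\<omega>. X (s + t) \<omega> - X s \<omega>) = distr M borel (X t)"
    and cadlag_paths: "\<And>\<omega>. \<omega> \<in> space M \<Longrightarrow> cadlag (\<lambda>t. X t \<omega>)"

text \<open>Epochs of a homogeneous Poisson process of intensity \<open>l\<close>, defined by its independent
  exponential inter-arrival times, with the convention that epoch number 0 is time 0.\<close>

locale poisson_epochs = prob_space M for M :: "'a measure" +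
  fixes l :: real and T :: "nat \<Rightarrow> 'a \<Rightarrow> real"
  assumes intensity_pos: "0 < l"
    and measurable_epoch: "\<And>n. random_variable borel (T n)"
    and epoch_0: "\<And>\<omega>. \<omega> \<in> space M \<Longrightarrow> T 0 \<omega> = 0"
    and epochs_increasing: "\<And>\<omega> n. \<omega> \<in> space M \<Longrightarrow> T n \<omega> < T (Suc n) \<omega>"
    and interarrival_indep:
      "indep_vars (\<lambda>_. borel) (\<lambda>n \<omega>. T (Suc n) \<omega> - T n \<omega>) UNIV"
    and interarrival_exponential:
      "\<And>n. distributed M lborel (\<lambda>\<omega>. T (Suc n) \<omega> - T n \<omega>) (exponential_density l)"

definition passage_time :: "(real \<Rightarrow> real) \<Rightarrow> ereal" where
  "passage_time x = Inf {ereal t | t. 0 \<le> t \<and> x t < 0}"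

text \<open>For strictly increasing epochs the infimum below is a minimum whenever the set is
  nonempty; the infimum of the empty set in \<^typ>\<open>ereal\<close> is \<open>\<infinity>\<close>.\<close>

definition passage_time_obs :: "(nat \<Rightarrow> real) \<Rightarrow> (real \<Rightarrow> real) \<Rightarrow> ereal" where
  "passage_time_obs \<tau> x = Inf {ereal (\<tau> i) | i. x (\<tau> i) < 0}"

text \<open>For a process \<open>X\<close> started at 0, the process started at \<open>v\<close> is \<open>v + X\<close>.\<close>

definition survival :: "'a measure \<Rightarrow> (real \<Rightarrow> 'a \<Rightarrow> real) \<Rightarrow> real \<Rightarrow> real" where
  "survival M X v = measure M {\<omega> \<in> space M. passage_time (\<lambda>t. v + X t \<omega>) = \<infinity>}"

definition survival_obs ::
  "'a measure \<Rightarrow> (nat \<Rightarrow> 'a \<Rightarrow> real) \<Rightarrow> (real \<Rightarrow> 'a \<Rightarrow> real) \<Rightarrow> real \<Rightarrow> real" where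
  "survival_obs M T X v =
     measure M {\<omega> \<in> space M. passage_time_obs (\<lambda>n. T n \<omega>) (\<lambda>t. v + X t \<omega>) = \<infinity>}"

text \<open>Real-valued, since a cadlag path is bounded on the compact interval \<open>[0, t]\<close>.\<close>

definition running_inf :: "(real \<Rightarrow> 'a \<Rightarrow> real) \<Rightarrow> real \<Rightarrow> 'a \<Rightarrow> real" where
  "running_inf X t \<omega> = (INF s\<in>{0..t}. X s \<omega>)"

definition running_sup :: "(real \<Rightarrow> 'a \<Rightarrow> real) \<Rightarrow> real \<Rightarrow> 'a \<Rightarrow> real" where
  "running_sup X t \<omega> = (SUP s\<in>{0..t}. X s \<omega>)"

definition generated :: "'a measure \<Rightarrow> 'b measure \<Rightarrow> ('a \<Rightarrow> 'b) \<Rightarrow> 'a set set" where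
  "generated M N f = sets (vimage_algebra (space M) f N)"

definition sigma_process :: "'a measure \<Rightarrow> (real \<Rightarrow> 'a \<Rightarrow> real) \<Rightarrow> 'a set set" where
  "sigma_process M X = generated M (PiM {0..} (\<lambda>_. borel)) (\<lambda>\<omega>. \<lambda>t\<in>{0..}. X t \<omega>)"

definition sigma_epochs :: "'a measure \<Rightarrow> (nat \<Rightarrow> 'a \<Rightarrow> real) \<Rightarrow> 'a set set" where
  "sigma_epochs M T = generated M (PiM UNIV (\<lambda>_. borel)) (\<lambda>\<omega> n. T n \<omega>)"

end

theory Submission
  imports Defs
begin

text \<open>
  Both survival events are events of one random walk with alternating downward and upward moves.
  Between two consecutive epochs the path contributes a pair: how far it dips below its starting
  level, and its total increment. These pairs are independent and identically
  distributed (\<open>epoch_blocks_independent\<close>, \<open>epoch_block_law\<close>), and by the Wiener-Hopf factorization at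
  an exponential time each of them has the law of \<open>(D, D + U)\<close> with \<open>D\<close> and \<open>U\<close> independent
  (\<open>first_block_factorization\<close>). In law, the process thus alternately moves down by a copy of \<open>D\<close> and
  up by a copy of \<open>U\<close>; continuous observation sees the level after each downward move, Poisson
  observation sees the level after each upward move. Starting continuous observation one upward
  move late gives Poisson observation, and starting Poisson observation one downward move late
  gives continuous observation.

  This is made precise by operators on bounded measurable functions. Let \<open>P f v = E f (v + D)\<close>,
  \<open>R f v = E f (v + U)\<close>, and let \<open>K\<close> be multiplication by the indicator of \<open>v \<ge> 0\<close>. Surviving \<open>n\<close>
  inter-epoch periods has probability \<open>(P K R)^n 1\<close> under continuous observation and, from a
  nonnegative level, \<open>(R P K)^n 1\<close> under Poisson observation. Since \<open>R 1 = 1\<close>, one has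
  \<open>R (P K R)^n 1 = (R P K)^n 1\<close> and \<open>(P K R)^(n + 1) 1 = P K (R P K)^n 1\<close>. The two identities follow
  in the limit \<open>n \<rightarrow> \<infinity>\<close>, because the epochs are almost surely unbounded.

  The factorization is obtained by discretization. For a random walk stopped at an independent
  geometric time, splitting at the first time of the minimum gives a product of two generating
  functions (\<open>geometric_factorization\<close>), and reversing time turns the excess over the minimum into
  the maximum. A Levy process on the mesh \<open>1 / m\<close> is such a walk, and the number of mesh cells
  before an exponential time is geometric. As the mesh is refined, right continuity of the paths
  makes minima over the mesh converge to infima (\<open>Min_grid_tendsto_INF\<close>), which yields
  \<open>exponential_wiener_hopf\<close>. Independence and stationarity of path segments over deterministic
  intervals pass to the limit in the same way, and conditioning on the epochs extends them to
  random intervals.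
\<close>

section \<open>Extrema of cadlag paths along fine grids\<close>

lemma right_continuous_less:
  fixes x :: "real \<Rightarrow> real"
  assumes "continuous (at_right t) x" "c < x t"
  shows "\<exists>d>0. \<forall>s\<in>{t..<t + d}. c < x s"
proof -
  have "(x \<longlongrightarrow> x t) (at_right t)"
    using assms(1) by (simp add: continuous_within)
  then have "eventually (\<lambda>s. c < x s) (at_right t)"
    using assms(2) by (rule order_tendstoD)
  then obtain b where "t < b" "\<And>s. t < s \<Longrightarrow> s < b \<Longrightarrow> c < x s"
    by (auto simp: eventually_at_right_field)
  with assms(2) have "c < x s" if "t \<le> s" "s < b" for s
    using that by (cases "s = t") auto
  with \<open>t < b\<close> show ?thesis
    by (intro exI[of _ "b - t"]) auto
qed

text \<open>
  The grids may overshoot the right end point \<open>b\<close> by \<open>e m\<close>: right continuity at \<open>b\<close> keeps the path there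
  close to its value at \<open>b\<close>. Conversely, right continuity at an almost minimal point keeps the path
  low on a short interval to its right, and this interval contains a grid point. Allowing the overshoot
  avoids any discussion of jumps at the end point.
\<close>
lemma Min_grid_tendsto_INF:
  fixes x :: "real \<Rightarrow> real" and G :: "nat \<Rightarrow> real set"
  assumes ab: "a \<le> b"
    and rc: "\<And>t. t \<in> {a..b} \<Longrightarrow> continuous (at_right t) x"
    and bdd: "bdd_below (x ` {a..b})"
    and fin: "\<And>m. finite (G m)"
    and G: "\<And>m. G m \<subseteq> {a..b + e m}"
    and e: "e \<longlonglongrightarrow> 0"
    and dense: "\<And>m q. q \<in> {a..b} \<Longrightarrow> \<exists>g\<in>G m. q \<le> g \<and> g \<le> q + e m"
  shows "(\<lambda>m. Min (x ` G m)) \<longlonglongrightarrow> (INF q\<in>{a..b}. x q)"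
proof (rule order_tendstoI)
  have ne: "G m \<noteq> {}" for m
    using dense[of a m] ab by auto
  {
    fix c assume c: "c < (INF q\<in>{a..b}. x q)"
    have ge: "c < x q" if "q \<in> {a..b}" for q
      using c cINF_lower[OF bdd that] by linarith
    obtain d where d: "d > 0" "\<forall>s\<in>{b..<b + d}. c < x s"
      using right_continuous_less[of b x c] rc[of b] ge[of b] ab by auto
    have "eventually (\<lambda>m. e m < d) sequentially"
      using e d(1) by (rule order_tendstoD)
    then show "eventually (\<lambda>m. c < Min (x ` G m)) sequentially"
    proof eventually_elim
      case (elim m)
      have "c < x g" if "g \<in> G m" for g
      proof (cases "g \<le> b")
        case True
        then show ?thesis using G[of m] that by (intro ge) auto
      next
        case False
        then show ?thesis using G[of m] that elim by (intro d(2)[rule_format]) auto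
      qed
      then show ?case
        using fin[of m] ne[of m] by auto
    qed
  next
    fix c assume c: "(INF q\<in>{a..b}. x q) < c"
    then obtain q where q: "q \<in> {a..b}" "x q < c"
      using cINF_less_iff[OF _ bdd, of c] ab by auto
    obtain d where d: "d > 0" "\<forall>s\<in>{q..<q + d}. - c < - x s"
      using right_continuous_less[of q "\<lambda>t. - x t" "- c"] rc[OF q(1)] q(2)
      by (auto intro: continuous_minus)
    have "eventually (\<lambda>m. e m < d) sequentially"
      using e d(1) by (rule order_tendstoD)
    then show "eventually (\<lambda>m. Min (x ` G m) < c) sequentially"
    proof eventually_elim
      case (elim m)
      obtain g where "g \<in> G m" "q \<le> g" "g \<le> q + e m"
        using dense[OF q(1)] by blast
      then show ?case
        using d(2)[rule_format, of g] elim fin[of m] ne[of m] by (subst Min_less_iff) auto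
    qed
  }
qed

text \<open>
  Each point has a neighbourhood on which the path is bounded, by its one-sided limits; bisection
  transfers this to compact intervals.
\<close>
lemma cadlag_bounded:
  assumes x: "cadlag x" and a: "0 \<le> a"
  shows "bounded (x ` {a..b})"
proof (cases "a \<le> b")
  case True
  from True have "bounded (x ` {max 0 a..b})"
  \<comment> \<open>The truncation at 0 is needed since nothing is known about the path at negative times.\<close>
  proof (induct a b rule: Bolzano)
    case (trans a b c)
    have "{max 0 a..c} \<subseteq> {max 0 a..b} \<union> {max 0 b..c}" by auto
    then have "x ` {max 0 a..c} \<subseteq> x ` {max 0 a..b} \<union> x ` {max 0 b..c}" by blast
    then show ?case
      using trans by (meson bounded_Un bounded_subset)
  next
    case (local t)
    with a have t: "0 \<le> t" by simp
    have "(x \<longlongrightarrow> x t) (at_right t)"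
      using x t by (simp add: cadlag_def continuous_within)
    then have "eventually (\<lambda>s. dist (x s) (x t) < 1) (at_right t)"
      by (rule tendstoD) simp
    then obtain r where r: "t < r" "\<And>s. t < s \<Longrightarrow> s < r \<Longrightarrow> dist (x s) (x t) < 1"
      by (auto simp: eventually_at_right_field)
    have "\<exists>l y. l < t \<and> (\<forall>s. 0 \<le> s \<and> l < s \<and> s < t \<longrightarrow> dist (x s) y < 1)"
    proof (cases "t = 0")
      case True
      then show ?thesis by (intro exI[of _ "-1"]) auto
    next
      case False
      then obtain y where "(x \<longlongrightarrow> y) (at_left t)"
        using x t by (metis cadlag_def less_le)
      then have "eventually (\<lambda>s. dist (x s) y < 1) (at_left t)"
        by (rule tendstoD) simp
      then show ?thesis
        by (auto simp: eventually_at_left_field)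
    qed
    then obtain l y where l: "l < t" "\<And>s. 0 \<le> s \<Longrightarrow> l < s \<Longrightarrow> s < t \<Longrightarrow> dist (x s) y < 1"
      by blast
    have "bounded (x ` {max 0 a..b})" if "a \<le> t" "t \<le> b" "b - a < min (t - l) (r - t)" for a b
    proof -
      have "x ` {max 0 a..b} \<subseteq> ball (x t) 1 \<union> ball y 1"
      proof (rule image_subsetI)
        fix s assume s: "s \<in> {max 0 a..b}"
        consider "s < t" | "s = t" | "t < s" by linarith
        then show "x s \<in> ball (x t) 1 \<union> ball y 1"
          using l(2)[of s] r(2)[of s] s that
          by cases (auto simp: dist_commute)
      qed
      then show ?thesis
        by (meson bounded_Un bounded_ball bounded_subset)
    qed
    then show ?case
      using l(1) r(1) by (intro exI[of _ "min (t - l) (r - t)"]) auto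
  qed
  then show ?thesis using a by (simp add: max_def)
qed auto

lemma cadlag_bdd:
  assumes "cadlag x" "0 \<le> a"
  shows "bdd_below (x ` {a..b})" "bdd_above (x ` {a..b})"
  using cadlag_bounded[OF assms] by (auto intro: bounded_imp_bdd_below bounded_imp_bdd_above)

lemma cadlag_uminus:
  assumes x: "cadlag x"
  shows "cadlag (\<lambda>t. - x t)"
  unfolding cadlag_def
proof (intro conjI allI impI)
  show "continuous (at_right t) (\<lambda>t. - x t)" if "0 \<le> t" for t
    using x that by (auto simp: cadlag_def intro: continuous_minus)
  show "\<exists>l. ((\<lambda>t. - x t) \<longlongrightarrow> l) (at_left t)" if t: "0 < t" for t
  proof -
    obtain l where "(x \<longlongrightarrow> l) (at_left t)"
      using x t by (auto simp: cadlag_def)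
    then have "((\<lambda>t. - x t) \<longlongrightarrow> - l) (at_left t)" by (rule tendsto_minus)
    then show ?thesis by blast
  qed
qed

lemma SUP_eq_minus_INF: "(SUP q\<in>A. x q) = - (INF q\<in>A. - x q :: real)"
  by (simp add: Inf_real_def image_image)

text \<open>
  The number of the first point of the mesh with cells of length \<open>1 / (m + 1)\<close> that lies strictly
  after \<open>t\<close>. Approximating from the right makes right continuity sufficient.
\<close>
definition mesh_index :: "nat \<Rightarrow> real \<Rightarrow> nat" where
  "mesh_index m t = Suc (nat \<lfloor>t * real (Suc m)\<rfloor>)"

lemma mesh_index_bounds:
  assumes "0 \<le> t"
  shows "t < real (mesh_index m t) / real (Suc m)"
    and "real (mesh_index m t) / real (Suc m) \<le> t + 1 / real (Suc m)"
proof -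
  have "0 \<le> t * real (Suc m)" using assms by simp
  then have *: "real (nat \<lfloor>t * real (Suc m)\<rfloor>) = of_int \<lfloor>t * real (Suc m)\<rfloor>" by simp
  have **: "real (mesh_index m t) = real (nat \<lfloor>t * real (Suc m)\<rfloor>) + 1"
    unfolding mesh_index_def by simp
  have "t * real (Suc m) < real (mesh_index m t)"
    unfolding ** * by linarith
  then show "t < real (mesh_index m t) / real (Suc m)"
    by (simp add: less_divide_eq del: of_nat_Suc)
  have "real (mesh_index m t) \<le> t * real (Suc m) + 1"
    unfolding ** * by linarith
  then have "real (mesh_index m t) / real (Suc m) \<le> (t * real (Suc m) + 1) / real (Suc m)"
    by (intro divide_right_mono) auto
  then show "real (mesh_index m t) / real (Suc m) \<le> t + 1 / real (Suc m)"
    by (simp add: add_divide_distrib del: of_nat_Suc)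
qed

lemma mesh_index_mono: "s \<le> t \<Longrightarrow> mesh_index m s \<le> mesh_index m t"
  unfolding mesh_index_def by (intro Suc_le_mono[THEN iffD2] nat_mono floor_mono mult_right_mono) auto

lemma mesh_tendsto_0: "(\<lambda>m. c / real (Suc m)) \<longlonglongrightarrow> 0"
  using LIMSEQ_Suc[OF lim_const_over_n[of c]] .

lemma mesh_tendsto_at_right:
  assumes x: "cadlag x" and t: "0 \<le> t"
  shows "(\<lambda>m. x (real (mesh_index m t) / real (Suc m))) \<longlonglongrightarrow> x t"
proof -
  have "(x \<longlongrightarrow> x t) (at_right t)"
    using x t by (simp add: cadlag_def continuous_within)
  moreover have "filterlim (\<lambda>m. real (mesh_index m t) / real (Suc m)) (at_right t) sequentially"
    unfolding filterlim_at
  proof (intro conjI always_eventually allI)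
    show "(\<lambda>m. real (mesh_index m t) / real (Suc m)) \<longlonglongrightarrow> t"
    proof (rule tendsto_sandwich[OF always_eventually always_eventually tendsto_const])
      show "(\<lambda>m. t + 1 / real (Suc m)) \<longlonglongrightarrow> t"
        using tendsto_add[OF tendsto_const mesh_tendsto_0, of t 1] by simp
    qed (use mesh_index_bounds[OF t] in \<open>auto intro: less_imp_le\<close>)
    show "real (mesh_index m t) / real (Suc m) \<in> {t<..}" for m
      using mesh_index_bounds(1)[OF t] unfolding greaterThan_iff .
    show "real (mesh_index m t) / real (Suc m) \<noteq> t" for m
      using mesh_index_bounds(1)[OF t, of m] by linarith
  qed
  ultimately show ?thesis by (rule filterlim_compose)
qed

text \<open>
  The lower index \<open>J m\<close> may be any mesh point of \<open>[a, b]\<close> up to the first one after \<open>a\<close>. This covers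
  both segments that begin at the approximation of \<open>a\<close> and segments that begin exactly at 0.
\<close>
lemma Min_mesh_tendsto_INF:
  assumes x: "cadlag x" and ab: "0 \<le> a" "a \<le> b"
    and J: "\<And>m. J m \<le> mesh_index m a" "\<And>m. a \<le> real (J m) / real (Suc m)"
  shows "(\<lambda>m. Min ((\<lambda>j. x (real j / real (Suc m))) ` {J m..mesh_index m b}))
    \<longlonglongrightarrow> (INF q\<in>{a..b}. x q)"
proof -
  let ?G = "\<lambda>m. (\<lambda>j. real j / real (Suc m)) ` {J m..mesh_index m b}"
  have "(\<lambda>m. Min (x ` ?G m)) \<longlonglongrightarrow> (INF q\<in>{a..b}. x q)"
  proof (rule Min_grid_tendsto_INF[OF ab(2) _ cadlag_bdd(1)[OF x ab(1)] _ _ mesh_tendsto_0[of 1]])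
    show "continuous (at_right t) x" if "t \<in> {a..b}" for t
      using x ab that by (auto simp: cadlag_def)
    show "?G m \<subseteq> {a..b + 1 / real (Suc m)}" for m
    proof (rule image_subsetI)
      fix j assume j: "j \<in> {J m..mesh_index m b}"
      have "real (J m) / real (Suc m) \<le> real j / real (Suc m)"
        "real j / real (Suc m) \<le> real (mesh_index m b) / real (Suc m)"
        using j by (auto intro!: divide_right_mono)
      then show "real j / real (Suc m) \<in> {a..b + 1 / real (Suc m)}"
        using J(2)[of m] mesh_index_bounds(2)[of b m] ab by auto
    qed
    show "\<exists>g\<in>?G m. q \<le> g \<and> g \<le> q + 1 / real (Suc m)" if "q \<in> {a..b}" for m q
    proof (rule bexI[of _ "real (mesh_index m q) / real (Suc m)"])
      show "q \<le> real (mesh_index m q) / real (Suc m) \<and>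
          real (mesh_index m q) / real (Suc m) \<le> q + 1 / real (Suc m)"
        using mesh_index_bounds[of q m] that ab by auto
      show "real (mesh_index m q) / real (Suc m) \<in> ?G m"
        using that J(1)[of m] mesh_index_mono[of a q m] mesh_index_mono[of q b m]
        by (intro imageI) auto
    qed
  qed auto
  then show ?thesis by (simp add: image_image)
qed

text \<open>
  A mesh adapted to the interval makes the increments along it depend on the length of the
  interval only, which is what stationarity and measurability in the end points require.
\<close>
lemma Min_subdivision_tendsto_INF:
  assumes x: "cadlag x" and a: "0 \<le> a" and s: "0 \<le> s"
  shows "(\<lambda>m. Min ((\<lambda>j. x (a + real j * s / real (Suc m))) ` {..Suc m}))
    \<longlonglongrightarrow> (INF q\<in>{a..a + s}. x q)"
proof (cases "s = 0")
  case True
  have "(\<lambda>j. x a) ` {..n} = {x a}" for n :: nat by auto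
  with True show ?thesis by simp
next
  case False
  with s have s: "0 < s" by simp
  let ?G = "\<lambda>m. (\<lambda>j. a + real j * s / real (Suc m)) ` {..Suc m}"
  have "(\<lambda>m. Min (x ` ?G m)) \<longlonglongrightarrow> (INF q\<in>{a..a + s}. x q)"
  proof (rule Min_grid_tendsto_INF[OF _ _ cadlag_bdd(1)[OF x a] _ _ mesh_tendsto_0[of s]])
    show "continuous (at_right t) x" if "t \<in> {a..a + s}" for t
      using x a that by (auto simp: cadlag_def)
    show "?G m \<subseteq> {a..a + s + s / real (Suc m)}" for m
    proof (rule image_subsetI)
      fix j assume "j \<in> {..Suc m}"
      then have "real j * s \<le> real (Suc m) * s" using s by (intro mult_right_mono) auto
      then have "real j * s / real (Suc m) \<le> s" by (simp add: divide_le_eq mult.commute)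
      moreover have "0 \<le> real j * s / real (Suc m)" "0 \<le> s / real (Suc m)" using s by auto
      ultimately show "a + real j * s / real (Suc m) \<in> {a..a + s + s / real (Suc m)}"
        unfolding atLeastAtMost_iff by linarith
    qed
    show "\<exists>g\<in>?G m. q \<le> g \<and> g \<le> q + s / real (Suc m)" if q: "q \<in> {a..a + s}" for m q
    proof -
      define j where "j = nat \<lceil>(q - a) * real (Suc m) / s\<rceil>"
      have "0 \<le> (q - a) * real (Suc m) / s" using q s by auto
      then have j: "(q - a) * real (Suc m) / s \<le> real j" "real j \<le> (q - a) * real (Suc m) / s + 1"
        unfolding j_def by (auto simp: of_nat_nat)
      have "(q - a) * real (Suc m) / s \<le> real (Suc m)"
        using q s by (simp add: divide_le_eq mult.commute mult_left_mono)
      then have "\<lceil>(q - a) * real (Suc m) / s\<rceil> \<le> int (Suc m)"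
        by (simp add: ceiling_le_iff)
      then have "j \<le> Suc m" unfolding j_def by linarith
      moreover have "q - a \<le> real j * s / real (Suc m)" "real j * s / real (Suc m) \<le> q - a + s / real (Suc m)"
        using j s by (auto simp: field_simps simp del: of_nat_Suc)
      ultimately show ?thesis
        by (intro bexI[of _ "a + real j * s / real (Suc m)"]) auto
    qed
  qed (use s in auto)
  then show ?thesis by (simp add: image_image)
qed

section \<open>Laws and independence from continuous test functions\<close>

text \<open>
  Continuous functions that decrease to the indicator of a closed set. The empty set is treated
  separately because the distance to it is 0 by convention.
\<close>
definition closed_approx :: "'a::metric_space set \<Rightarrow> nat \<Rightarrow> 'a \<Rightarrow> real" where
  "closed_approx C n x = (if C = {} then 0 else max 0 (1 - real n * infdist x C))"

lemma closed_approx_bounds: "0 \<le> closed_approx C n x" "closed_approx C n x \<le> 1"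
  by (auto simp: closed_approx_def infdist_nonneg)

lemma continuous_closed_approx: "continuous_on UNIV (closed_approx C n)"
proof (cases "C = {}")
  case True
  then have "closed_approx C n = (\<lambda>_. 0)" by (auto simp: closed_approx_def)
  then show ?thesis by simp
next
  case False
  then have "closed_approx C n = (\<lambda>x. max 0 (1 - real n * infdist x C))"
    by (auto simp: closed_approx_def)
  then show ?thesis by (auto intro!: continuous_intros)
qed

lemma measurable_closed_approx [measurable]: "closed_approx C n \<in> borel_measurable borel"
  by (intro borel_measurable_continuous_onI continuous_closed_approx)

lemma closed_approx_tendsto:
  assumes "closed C"
  shows "(\<lambda>n. closed_approx C n x) \<longlonglongrightarrow> indicator C x"
proof (cases "C = {} \<or> x \<in> C")
  case True
  then have "closed_approx C n x = indicator C x" for n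
    by (auto simp: closed_approx_def)
  then show ?thesis by simp
next
  case False
  then have pos: "infdist x C > 0"
    using assms in_closed_iff_infdist_zero[of C x] infdist_nonneg[of x C] by auto
  have "eventually (\<lambda>n. 1 / infdist x C < real n) sequentially"
    using filterlim_real_sequentially by (simp add: filterlim_at_top_dense)
  then have "eventually (\<lambda>n. closed_approx C n x = indicator C x) sequentially"
    by eventually_elim (use False pos in \<open>auto simp: closed_approx_def field_simps\<close>)
  then show ?thesis by (rule tendsto_eventually)
qed

lemma sets_borel_eq_closed:
  "sets (borel :: 'a::topological_space measure) = sigma_sets (space borel) (Collect closed)"
  by (subst borel_eq_closed) simp

text \<open>
  Products of continuous functions approximate indicators of closed rectangles, and these form a
  generator that is stable under intersection.
\<close>
lemma measure_eqI_continuous_products: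
  fixes P Q :: "('a::{metric_space, second_countable_topology}
    \<times> 'b::{metric_space, second_countable_topology}) measure"
  assumes P: "finite_measure P" "sets P = sets (borel \<Otimes>\<^sub>M borel)"
    and Q: "finite_measure Q" "sets Q = sets (borel \<Otimes>\<^sub>M borel)"
    and eq: "\<And>f g. continuous_on UNIV f \<Longrightarrow> continuous_on UNIV g \<Longrightarrow>
      (\<And>x. 0 \<le> f x \<and> f x \<le> 1) \<Longrightarrow> (\<And>x. 0 \<le> g x \<and> g x \<le> 1) \<Longrightarrow>
      (\<integral>z. f (fst z) * g (snd z) \<partial>P) = (\<integral>z. f (fst z) * g (snd z) \<partial>(Q :: _ measure) :: real)"
  shows "P = Q"
proof -
  let ?E = "{A \<times> B | A B. A \<in> Collect closed \<and> B \<in> Collect closed} :: ('a \<times> 'b) set set"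
  have sets: "sets (borel \<Otimes>\<^sub>M borel :: ('a \<times> 'b) measure) = sigma_sets UNIV ?E"
  proof -
    have "sets (borel \<Otimes>\<^sub>M borel :: ('a \<times> 'b) measure)
        = sets (sigma (space (borel :: 'a measure) \<times> space (borel :: 'b measure)) ?E)"
      by (rule sets_pair_eq[where Ca = "{UNIV}" and Cb = "{UNIV}", OF _ sets_borel_eq_closed _ _ _ _
          sets_borel_eq_closed]) auto
    then show ?thesis by simp
  qed
  have lim: "(\<lambda>n. \<integral>z. closed_approx A n (fst z) * closed_approx B n (snd z) \<partial>R)
      \<longlonglongrightarrow> measure R (A \<times> B)"
    if R: "finite_measure R" "sets R = sets (borel \<Otimes>\<^sub>M borel)" and AB: "closed A" "closed B"
    for R :: "('a \<times> 'b) measure" and A B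
  proof -
    interpret finite_measure R by fact
    note [measurable_cong] = R(2)
    have [measurable]: "A \<in> sets borel" "B \<in> sets borel" using AB by auto
    have "(\<lambda>n. \<integral>z. closed_approx A n (fst z) * closed_approx B n (snd z) \<partial>R)
      \<longlonglongrightarrow> (\<integral>z. indicator A (fst z) * indicator B (snd z) \<partial>R)"
    proof (rule integral_dominated_convergence[where w = "\<lambda>_. 1"])
      show "AE z in R. (\<lambda>n. closed_approx A n (fst z) * closed_approx B n (snd z))
          \<longlonglongrightarrow> indicator A (fst z) * indicator B (snd z)"
        by (intro AE_I2 tendsto_mult closed_approx_tendsto AB)
      show "AE z in R. norm (closed_approx A n (fst z) * closed_approx B n (snd z)) \<le> 1" for n
        by (intro AE_I2) (auto simp: abs_mult closed_approx_bounds intro!: mult_le_one)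
    qed auto
    also have "(\<integral>z. indicator A (fst z) * indicator B (snd z) \<partial>R) = (\<integral>z. indicator (A \<times> B) z \<partial>R :: real)"
      by (intro Bochner_Integration.integral_cong) (auto simp: indicator_def)
    also have "\<dots> = measure R (A \<times> B)"
      using sets_eq_imp_space_eq[OF R(2)] by (simp add: space_pair_measure)
    finally show ?thesis .
  qed
  show ?thesis
  proof (rule measure_eqI_generator_eq[of ?E UNIV P Q "\<lambda>_. UNIV"])
    show "Int_stable ?E"
    proof (rule Int_stableI)
      fix a b assume "a \<in> ?E" "b \<in> ?E"
      then obtain A B C D where "a = A \<times> B" "b = C \<times> D" "closed A" "closed B" "closed C" "closed D"
        by auto
      then show "a \<inter> b \<in> ?E"
        by (auto simp: Times_Int_Times intro!: exI[of _ "A \<inter> C"] exI[of _ "B \<inter> D"])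
    qed
    show "sets P = sigma_sets UNIV ?E" "sets Q = sigma_sets UNIV ?E"
      using P(2) Q(2) sets by simp_all
    show "emeasure P UNIV \<noteq> \<infinity>" for i :: nat
      using finite_measure.emeasure_finite[OF P(1)] by auto
    show "range (\<lambda>_::nat. UNIV) \<subseteq> ?E"
      by (auto intro!: exI[of _ UNIV])
    fix X assume "X \<in> ?E"
    then obtain A B where X: "X = A \<times> B" "closed A" "closed B" by auto
    have "measure P X = measure Q X"
      unfolding X(1)
    proof (rule LIMSEQ_unique[OF lim[OF P X(2,3)]])
      show "(\<lambda>n. \<integral>z. closed_approx A n (fst z) * closed_approx B n (snd z) \<partial>P) \<longlonglongrightarrow> measure Q (A \<times> B)"
        using lim[OF Q X(2,3)]
        by (subst eq) (auto simp: continuous_closed_approx closed_approx_bounds)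
    qed
    then show "emeasure P X = emeasure Q X"
      using P(1) Q(1) by (simp add: finite_measure.emeasure_eq_measure)
  qed auto
qed

context prob_space
begin

lemma prob_eq_expectation_indicator:
  assumes "Y \<in> M \<rightarrow>\<^sub>M N" "C \<in> sets N"
  shows "prob (Y -` C \<inter> space M) = (\<integral>\<omega>. indicator C (Y \<omega>) \<partial>M)"
proof -
  have "(\<integral>\<omega>. indicator C (Y \<omega>) \<partial>M) = (\<integral>\<omega>. indicator (Y -` C \<inter> space M) \<omega> \<partial>M :: real)"
    by (intro Bochner_Integration.integral_cong refl) (auto simp: indicator_def)
  then show ?thesis by simp
qed

lemma indep_vars_finite_subsets:
  assumes rv: "\<And>i. i \<in> I \<Longrightarrow> random_variable (N i) (X i)"
    and J: "\<And>J. J \<subseteq> I \<Longrightarrow> finite J \<Longrightarrow> J \<noteq> {} \<Longrightarrow> indep_vars N X J"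
  shows "indep_vars N X I"
proof -
  have "indep_sets (\<lambda>i. {X i -` A \<inter> space M |A. A \<in> sets (N i)}) J"
    if "J \<subseteq> I" "J \<noteq> {}" "finite J" for J
    using J[OF that(1,3,2)] unfolding indep_vars_def2 by (rule conjunct2)
  then have "indep_sets (\<lambda>i. {X i -` A \<inter> space M |A. A \<in> sets (N i)}) I"
    by (subst indep_sets_finite_index_sets) blast
  then show ?thesis
    unfolding indep_vars_def2 using rv by blast
qed

text \<open>
  By dominated convergence the product formula for continuous functions passes to the limit, and
  then from continuous functions to indicators of closed sets.
\<close>
lemma indep_vars_tendsto:
  fixes Z :: "nat \<Rightarrow> 'i \<Rightarrow> 'a \<Rightarrow> 'b::{metric_space, second_countable_topology}"
  assumes indep: "\<And>m. indep_vars (\<lambda>_. borel) (Z m) I"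
    and lim: "\<And>i \<omega>. i \<in> I \<Longrightarrow> \<omega> \<in> space M \<Longrightarrow> (\<lambda>m. Z m i \<omega>) \<longlonglongrightarrow> Y i \<omega>"
  shows "indep_vars (\<lambda>_. borel) Y I"
proof (rule indep_vars_finite_subsets)
  have Z: "random_variable borel (Z m i)" if "i \<in> I" for m i
    using indep[of m] that by (auto simp: indep_vars_def)
  show Y: "random_variable borel (Y i)" if "i \<in> I" for i
    using Z[OF that] lim[OF that] by (rule borel_measurable_LIMSEQ_metric)
  fix J assume J: "J \<subseteq> I" "finite J" "J \<noteq> {}"
  note [measurable] = Z[OF subsetD[OF J(1)]] Y[OF subsetD[OF J(1)]]
  let ?c = closed_approx
  have approx: "(\<integral>\<omega>. (\<Prod>j\<in>J. ?c (A j) n (Y j \<omega>)) \<partial>M) = (\<Prod>j\<in>J. \<integral>\<omega>. ?c (A j) n (Y j \<omega>) \<partial>M)" for A n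
  proof -
    have 1: "(\<lambda>m. \<integral>\<omega>. (\<Prod>j\<in>J. ?c (A j) n (Z m j \<omega>)) \<partial>M) \<longlonglongrightarrow> (\<integral>\<omega>. (\<Prod>j\<in>J. ?c (A j) n (Y j \<omega>)) \<partial>M)"
    proof (rule integral_dominated_convergence[where w = "\<lambda>_. 1"])
      show "AE \<omega> in M. (\<lambda>m. \<Prod>j\<in>J. ?c (A j) n (Z m j \<omega>)) \<longlonglongrightarrow> (\<Prod>j\<in>J. ?c (A j) n (Y j \<omega>))"
        using J(1) by (intro AE_I2 tendsto_prod continuous_on_tendsto_compose[OF continuous_closed_approx]
            lim) auto
    qed (auto simp: abs_prod closed_approx_bounds intro!: prod_le_1)
    have 2: "(\<integral>\<omega>. (\<Prod>j\<in>J. ?c (A j) n (Z m j \<omega>)) \<partial>M) = (\<Prod>j\<in>J. \<integral>\<omega>. ?c (A j) n (Z m j \<omega>) \<partial>M)" for m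
    proof (rule indep_vars_lebesgue_integral[OF J(2)])
      show "indep_vars (\<lambda>_. borel) (\<lambda>j \<omega>. ?c (A j) n (Z m j \<omega>)) J"
        by (rule indep_vars_compose2[OF indep_vars_subset[OF indep J(1)]]) auto
      show "integrable M (\<lambda>\<omega>. ?c (A j) n (Z m j \<omega>))" if "j \<in> J" for j
        using that by (intro integrable_const_bound[where B = 1]) (auto simp: closed_approx_bounds)
    qed
    have 3: "(\<lambda>m. \<Prod>j\<in>J. \<integral>\<omega>. ?c (A j) n (Z m j \<omega>) \<partial>M) \<longlonglongrightarrow> (\<Prod>j\<in>J. \<integral>\<omega>. ?c (A j) n (Y j \<omega>) \<partial>M)"
    proof (intro tendsto_prod integral_dominated_convergence[where w = "\<lambda>_. 1"])
      show "AE \<omega> in M. (\<lambda>m. ?c (A j) n (Z m j \<omega>)) \<longlonglongrightarrow> ?c (A j) n (Y j \<omega>)" if "j \<in> J" for j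
        using J(1) that by (intro AE_I2 continuous_on_tendsto_compose[OF continuous_closed_approx]
            lim) auto
    qed (auto simp: closed_approx_bounds)
    show ?thesis
      using LIMSEQ_unique[OF 1] 3 unfolding 2 by blast
  qed
  show "indep_vars (\<lambda>_. borel) Y J"
  proof (subst indep_vars_finite[where E = "\<lambda>_. Collect closed"])
    show "sets borel = sigma_sets (space borel) (Collect closed :: 'b set set)"
      by (rule sets_borel_eq_closed)
    show "Int_stable (Collect closed :: 'b set set)"
      by (intro Int_stableI) auto
    show "\<forall>A\<in>J \<rightarrow> Collect closed. prob (\<Inter>j\<in>J. Y j -` A j \<inter> space M)
        = (\<Prod>j\<in>J. prob (Y j -` A j \<inter> space M))"
    proof
      fix A :: "'i \<Rightarrow> 'b set" assume A: "A \<in> J \<rightarrow> Collect closed"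
      have [measurable]: "A j \<in> sets borel" if "j \<in> J" for j
        using A that by (auto intro: borel_closed)
      have "(\<lambda>n. \<integral>\<omega>. (\<Prod>j\<in>J. ?c (A j) n (Y j \<omega>)) \<partial>M) \<longlonglongrightarrow> (\<integral>\<omega>. (\<Prod>j\<in>J. indicator (A j) (Y j \<omega>)) \<partial>M)"
      proof (rule integral_dominated_convergence[where w = "\<lambda>_. 1"])
        show "AE \<omega> in M. (\<lambda>n. \<Prod>j\<in>J. ?c (A j) n (Y j \<omega>)) \<longlonglongrightarrow> (\<Prod>j\<in>J. indicator (A j) (Y j \<omega>))"
          using A by (intro AE_I2 tendsto_prod closed_approx_tendsto) auto
      qed (auto simp: abs_prod closed_approx_bounds intro!: prod_le_1)
      moreover have "(\<lambda>n. \<Prod>j\<in>J. \<integral>\<omega>. ?c (A j) n (Y j \<omega>) \<partial>M) \<longlonglongrightarrow> (\<Prod>j\<in>J. \<integral>\<omega>. indicator (A j) (Y j \<omega>) \<partial>M)"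
      proof (intro tendsto_prod integral_dominated_convergence[where w = "\<lambda>_. 1"])
        show "AE \<omega> in M. (\<lambda>n. ?c (A j) n (Y j \<omega>)) \<longlonglongrightarrow> indicator (A j) (Y j \<omega>)" if "j \<in> J" for j
          using A that by (intro AE_I2 closed_approx_tendsto) auto
      qed (auto simp: closed_approx_bounds)
      ultimately have *: "(\<integral>\<omega>. (\<Prod>j\<in>J. indicator (A j) (Y j \<omega>)) \<partial>M) = (\<Prod>j\<in>J. \<integral>\<omega>. indicator (A j) (Y j \<omega>) \<partial>M :: real)"
        unfolding approx by (rule LIMSEQ_unique)
      have "(\<integral>\<omega>. (\<Prod>j\<in>J. indicator (A j) (Y j \<omega>)) \<partial>M) = (\<integral>\<omega>. indicator (\<Inter>j\<in>J. Y j -` A j \<inter> space M) \<omega> \<partial>M :: real)"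
        using J by (intro Bochner_Integration.integral_cong refl) (auto simp: indicator_def)
      moreover have "(\<integral>\<omega>. indicator (A j) (Y j \<omega>) \<partial>M) = (\<integral>\<omega>. indicator (Y j -` A j \<inter> space M) \<omega> \<partial>M :: real)" for j
        by (intro Bochner_Integration.integral_cong refl) (auto simp: indicator_def)
      moreover have "(\<Inter>j\<in>J. Y j -` A j \<inter> space M) \<subseteq> space M"
        using J(3) by auto
      ultimately show "prob (\<Inter>j\<in>J. Y j -` A j \<inter> space M) = (\<Prod>j\<in>J. prob (Y j -` A j \<inter> space M))"
        using * by (simp add: Int_absorb2)
    qed
  qed (use J Y in auto)
qed

text \<open>
  Conditioning on one of two independent random elements. The hypothesis is stated with events
  because the two elements may take values in different types.
\<close>
lemma independent_expectation:
  fixes H :: "_ \<Rightarrow> real"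
  assumes X [measurable]: "X \<in> M \<rightarrow>\<^sub>M S" and Y [measurable]: "Y \<in> M \<rightarrow>\<^sub>M T"
    and indep: "\<And>A C. A \<in> sets S \<Longrightarrow> C \<in> sets T \<Longrightarrow>
      prob ((X -` A \<inter> space M) \<inter> (Y -` C \<inter> space M)) = prob (X -` A \<inter> space M) * prob (Y -` C \<inter> space M)"
    and H: "H \<in> borel_measurable (S \<Otimes>\<^sub>M T)" and bound: "\<And>z. \<bar>H z\<bar> \<le> B"
  shows "(\<integral>\<omega>. H (X \<omega>, Y \<omega>) \<partial>M) = (\<integral>\<omega>. \<integral>y. H (X \<omega>, y) \<partial>distr M T Y \<partial>M)"
    and "(\<integral>\<omega>. H (X \<omega>, Y \<omega>) \<partial>M) = (\<integral>\<omega>. \<integral>\<omega>'. H (X \<omega>', Y \<omega>) \<partial>M \<partial>M)"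
proof -
  note H[measurable]
  interpret DX: prob_space "distr M S X" by (rule prob_space_distr) fact
  interpret DY: prob_space "distr M T Y" by (rule prob_space_distr) fact
  interpret P: pair_prob_space "distr M S X" "distr M T Y" ..
  have eq: "distr M S X \<Otimes>\<^sub>M distr M T Y = distr M (S \<Otimes>\<^sub>M T) (\<lambda>\<omega>. (X \<omega>, Y \<omega>))"
  proof (rule pair_measure_eqI)
    fix A C assume "A \<in> sets (distr M S X)" "C \<in> sets (distr M T Y)"
    then have AC: "A \<in> sets S" "C \<in> sets T" by simp_all
    moreover have "(\<lambda>\<omega>. (X \<omega>, Y \<omega>)) -` (A \<times> C) \<inter> space M = (X -` A \<inter> space M) \<inter> (Y -` C \<inter> space M)"
      by auto
    ultimately show "emeasure (distr M S X) A * emeasure (distr M T Y) C =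
        emeasure (distr M (S \<Otimes>\<^sub>M T) (\<lambda>\<omega>. (X \<omega>, Y \<omega>))) (A \<times> C)"
      using indep[OF AC] by (simp add: emeasure_distr emeasure_eq_measure ennreal_mult'')
  qed (auto intro: DX.sigma_finite_measure_axioms DY.sigma_finite_measure_axioms)
  have int: "integrable (distr M S X \<Otimes>\<^sub>M distr M T Y) H"
    using bound by (intro P.integrable_const_bound[where B = B]) auto
  have joint: "(\<integral>\<omega>. H (X \<omega>, Y \<omega>) \<partial>M) = integral\<^sup>L (distr M S X \<Otimes>\<^sub>M distr M T Y) H"
    unfolding eq by (subst integral_distr) auto
  also have "\<dots> = (\<integral>x. \<integral>y. H (x, y) \<partial>distr M T Y \<partial>distr M S X)"
    using P.integral_fst'[of H] int by simp
  also have "\<dots> = (\<integral>\<omega>. \<integral>y. H (X \<omega>, y) \<partial>distr M T Y \<partial>M)"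
    by (subst integral_distr) auto
  finally show "(\<integral>\<omega>. H (X \<omega>, Y \<omega>) \<partial>M) = (\<integral>\<omega>. \<integral>y. H (X \<omega>, y) \<partial>distr M T Y \<partial>M)" .
  have "integral\<^sup>L (distr M S X \<Otimes>\<^sub>M distr M T Y) H = (\<integral>y. \<integral>x. H (x, y) \<partial>distr M S X \<partial>distr M T Y)"
    using P.integral_snd[of "\<lambda>x y. H (x, y)"] int by (simp add: split_beta)
  also have "\<dots> = (\<integral>\<omega>. \<integral>x. H (x, Y \<omega>) \<partial>distr M S X \<partial>M)"
    by (subst integral_distr) auto
  also have "\<dots> = (\<integral>\<omega>. \<integral>\<omega>'. H (X \<omega>', Y \<omega>) \<partial>M \<partial>M)"
    using measurable_space[OF Y]
    by (intro Bochner_Integration.integral_cong refl) (subst integral_distr, auto)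
  finally show "(\<integral>\<omega>. H (X \<omega>, Y \<omega>) \<partial>M) = (\<integral>\<omega>. \<integral>\<omega>'. H (X \<omega>', Y \<omega>) \<partial>M \<partial>M)"
    using joint by simp
qed

end

section \<open>Wiener-Hopf factorization of a random walk at a geometric time\<close>

definition walk_min :: "(nat \<Rightarrow> real) \<Rightarrow> nat \<Rightarrow> real" where
  "walk_min x n = Min ((\<lambda>k. \<Sum>i<k. x i) ` {..n})"

definition walk_max :: "(nat \<Rightarrow> real) \<Rightarrow> nat \<Rightarrow> real" where
  "walk_max x n = Max ((\<lambda>k. \<Sum>i<k. x i) ` {..n})"

lemma Min_minus_const:
  fixes f :: "'i \<Rightarrow> real"
  assumes "finite A" "A \<noteq> {}"
  shows "Min ((\<lambda>j. f j - c) ` A) = Min (f ` A) - c"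
  using Min_add_commute[OF assms, of f "- c"] by simp

lemma walk_min_increments: "walk_min (\<lambda>i. y (Suc i) - y i) n = Min (y ` {..n}) - y 0"
proof -
  have "walk_min (\<lambda>i. y (Suc i) - y i) n = Min ((\<lambda>k. y k - y 0) ` {..n})"
    unfolding walk_min_def sum_lessThan_telescope ..
  then show ?thesis by (simp add: Min_minus_const)
qed

lemma walk_max_increments: "walk_max (\<lambda>i. y (Suc i) - y i) n = - Min ((\<lambda>j. - y j) ` {..n}) - y 0"
proof -
  have "walk_max (\<lambda>i. y (Suc i) - y i) n = Max ((\<lambda>k. y k - y 0) ` {..n})"
    unfolding walk_max_def sum_lessThan_telescope ..
  also have "\<dots> = Max (y ` {..n}) - y 0"
    using Max_add_commute[of "{..n}" y "- y 0"] by simp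
  also have "Max (y ` {..n}) = - Min (uminus ` y ` {..n})"
    by (simp add: image_image)
  finally show ?thesis by (simp add: image_image)
qed

text \<open>
  The first minimizer \<open>K\<close> is the only index that is a strict minimum of the past and a weak minimum of
  the future. Strictness towards the past singles it out among several minimizers.
\<close>
lemma first_argmin:
  fixes S :: "nat \<Rightarrow> real"
  obtains K where "K \<le> n" "S K = Min (S ` {..n})"
    "\<And>k. k \<le> n \<Longrightarrow> (\<forall>j\<in>{..<k}. S k < S j) \<and> (\<forall>j\<in>{k..n}. S k \<le> S j) \<longleftrightarrow> k = K"
proof -
  let ?m = "Min (S ` {..n})"
  have "?m \<in> S ` {..n}"
    by (rule Min_in) auto
  then obtain k0 where "?m = S k0" "k0 \<in> {..n}"
    by (rule imageE)
  then have ex: "\<exists>k. k \<le> n \<and> S k = ?m"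
    by (intro exI[of _ k0]) auto
  define K where "K = (LEAST k. k \<le> n \<and> S k = ?m)"
  have K: "K \<le> n" "S K = ?m"
    using LeastI_ex[OF ex] unfolding K_def by auto
  have min: "S K \<le> S j" if "j \<le> n" for j
    using that K by auto
  have before: "S K < S j" if "j < K" for j
    using not_less_Least[of j "\<lambda>k. k \<le> n \<and> S k = ?m"] that K min[of j]
    by (auto simp flip: K_def simp: less_le)
  show thesis
  proof (rule that[OF K])
    fix k assume k: "k \<le> n"
    show "(\<forall>j\<in>{..<k}. S k < S j) \<and> (\<forall>j\<in>{k..n}. S k \<le> S j) \<longleftrightarrow> k = K"
    proof
      assume *: "(\<forall>j\<in>{..<k}. S k < S j) \<and> (\<forall>j\<in>{k..n}. S k \<le> S j)"
      show "k = K"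
      proof (rule linorder_cases[of k K])
        assume "k < K"
        then have "S k \<le> S K" using * K(1) by auto
        with before[OF \<open>k < K\<close>] show ?thesis by simp
      next
        assume "K < k"
        then have "S k < S K" using * by auto
        with min[OF k] show ?thesis by simp
      qed
    qed (use before min in auto)
  qed
qed

text \<open>
  The sum has a single nonzero term, at the first minimizer. Each term is a function of the first
  \<open>k\<close> steps times a function of the remaining ones, which makes independence applicable.
\<close>
lemma walk_min_split:
  fixes f g :: "real \<Rightarrow> real" and x :: "nat \<Rightarrow> real"
  shows "f (walk_min x n) * g ((\<Sum>i<n. x i) - walk_min x n) =
    (\<Sum>k\<le>n. (f (\<Sum>i<k. x i) * of_bool (\<forall>j\<in>{..<k}. (\<Sum>i<k. x i) < (\<Sum>i<j. x i))) *
      (g (\<Sum>i<n - k. x (k + i)) * of_bool (\<forall>j\<in>{..n - k}. 0 \<le> (\<Sum>i<j. x (k + i)))))"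
proof -
  define S where "S k = (\<Sum>i<k. x i)" for k
  obtain K where K: "K \<le> n" "S K = Min (S ` {..n})"
    "\<And>k. k \<le> n \<Longrightarrow> (\<forall>j\<in>{..<k}. S k < S j) \<and> (\<forall>j\<in>{k..n}. S k \<le> S j) \<longleftrightarrow> k = K"
    by (rule first_argmin[of n S], rule that)
  have shift: "(\<Sum>i<j. x (k + i)) = S (k + j) - S k" for k j
    unfolding S_def by (induction j) auto
  have "(f (S k) * of_bool (\<forall>j\<in>{..<k}. S k < S j)) *
      (g (\<Sum>i<n - k. x (k + i)) * of_bool (\<forall>j\<in>{..n - k}. 0 \<le> (\<Sum>i<j. x (k + i))))
    = (if k = K then f (S K) * g (S n - S K) else 0)" if "k \<in> {..n}" for k
  proof -
    have "(\<forall>j\<in>{..n - k}. 0 \<le> (\<Sum>i<j. x (k + i))) \<longleftrightarrow> (\<forall>j\<in>{k..n}. S k \<le> S j)"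
    proof -
      have "{k..n} = (+) k ` {..n - k}"
        using that image_add_atLeastAtMost[of k 0 "n - k"] by (simp add: atMost_atLeast0)
      then show ?thesis by (simp add: shift)
    qed
    then show ?thesis
      using that K(3)[of k] by (auto simp: shift)
  qed
  then have "(\<Sum>k\<le>n. (f (S k) * of_bool (\<forall>j\<in>{..<k}. S k < S j)) *
      (g (\<Sum>i<n - k. x (k + i)) * of_bool (\<forall>j\<in>{..n - k}. 0 \<le> (\<Sum>i<j. x (k + i)))))
    = (\<Sum>k\<le>n. if k = K then f (S K) * g (S n - S K) else 0)"
    by (rule sum.cong[OF refl])
  also have "\<dots> = f (S K) * g (S n - S K)"
    using K(1) by simp
  also have "S K = walk_min x n"
    using K(2) by (simp add: walk_min_def S_def[abs_def])
  finally show ?thesis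
    unfolding S_def by simp
qed

locale iid_steps = prob_space M for M :: "'a measure" +
  fixes \<xi> :: "nat \<Rightarrow> 'a \<Rightarrow> real"
  assumes indep: "indep_vars (\<lambda>_. borel) \<xi> UNIV"
    and identical: "\<And>i. distr M borel (\<xi> i) = distr M borel (\<xi> 0)"
begin

lemma measurable_step [measurable]: "random_variable borel (\<xi> i)"
  using indep by (auto simp: indep_vars_def)

text \<open>
  The law of a vector of distinct steps depends on its length only. This gives both the shift
  used for the part after the minimum and the time reversal.
\<close>
lemma expectation_reindex:
  fixes F :: "(nat \<Rightarrow> real) \<Rightarrow> real"
  assumes inj: "inj_on \<pi> {..<n}" and F: "F \<in> borel_measurable (PiM {..<n} (\<lambda>_. borel))"
  shows "(\<integral>\<omega>. F (\<lambda>i\<in>{..<n}. \<xi> (\<pi> i) \<omega>) \<partial>M) = (\<integral>\<omega>. F (\<lambda>i\<in>{..<n}. \<xi> i \<omega>) \<partial>M)"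
proof (cases "n = 0")
  case False
  have law: "distr M (PiM {..<n} (\<lambda>_. borel)) (\<lambda>\<omega>. \<lambda>i\<in>{..<n}. \<xi> (\<pi> i) \<omega>)
      = PiM {..<n} (\<lambda>_. distr M borel (\<xi> 0))" if "inj_on \<pi> {..<n}" for \<pi>
  proof -
    have "indep_vars (\<lambda>_. borel) (\<lambda>i. \<xi> (\<pi> i)) {..<n}"
    proof -
      have "indep_vars (\<lambda>j. PiM {\<pi> j} (\<lambda>_. borel)) (\<lambda>j \<omega>. restrict (\<lambda>i. \<xi> i \<omega>) {\<pi> j}) {..<n}"
        using that by (intro indep_vars_restrict[OF indep]) (auto simp: disjoint_family_on_def inj_on_def)
      then have "indep_vars (\<lambda>_. borel) (\<lambda>j \<omega>. restrict (\<lambda>i. \<xi> i \<omega>) {\<pi> j} (\<pi> j)) {..<n}"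
        by (rule indep_vars_compose2) (auto intro: measurable_component_singleton)
      then show ?thesis by simp
    qed
    then have "distr M (PiM {..<n} (\<lambda>_. borel)) (\<lambda>\<omega>. \<lambda>i\<in>{..<n}. \<xi> (\<pi> i) \<omega>)
      = PiM {..<n} (\<lambda>i. distr M borel (\<xi> (\<pi> i)))"
      using False by (subst (asm) indep_vars_iff_distr_eq_PiM') auto
    then show ?thesis
      by (simp add: identical[of "\<pi> _"])
  qed
  have "(\<integral>\<omega>. F (\<lambda>i\<in>{..<n}. \<xi> (\<pi> i) \<omega>) \<partial>M) = (\<integral>x. F x \<partial>PiM {..<n} (\<lambda>_. distr M borel (\<xi> 0)))"
    if "inj_on \<pi> {..<n}" for \<pi>
    unfolding law[OF that, symmetric]
    by (rule integral_distr[symmetric]) (intro measurable_restrict measurable_step, rule F)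
  from this[OF inj] this[of "\<lambda>i. i"] show ?thesis by simp
qed (simp add: restrict_def)

text \<open>
  The part of the walk after the minimum restarts from the minimum as an independent copy of the walk,
  by independence and by the shift of \<open>expectation_reindex\<close>.
\<close>
lemma expectation_split:
  assumes [measurable]: "f \<in> borel_measurable borel" "g \<in> borel_measurable borel"
    and f: "\<And>x. 0 \<le> f x \<and> f x \<le> 1" and g: "\<And>x. 0 \<le> g x \<and> g x \<le> (1::real)"
  shows "(\<integral>\<omega>. f (walk_min (\<lambda>i. \<xi> i \<omega>) n) * g ((\<Sum>i<n. \<xi> i \<omega>) - walk_min (\<lambda>i. \<xi> i \<omega>) n) \<partial>M) =
    (\<Sum>k\<le>n. (\<integral>\<omega>. f (\<Sum>i<k. \<xi> i \<omega>) * of_bool (\<forall>j\<in>{..<k}. (\<Sum>i<k. \<xi> i \<omega>) < (\<Sum>i<j. \<xi> i \<omega>)) \<partial>M) *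
      (\<integral>\<omega>. g (\<Sum>i<n - k. \<xi> i \<omega>) * of_bool (\<forall>j\<in>{..n - k}. 0 \<le> (\<Sum>i<j. \<xi> i \<omega>)) \<partial>M))"
proof -
  define F where "F k x = f (\<Sum>i<k. x i) * of_bool (\<forall>j\<in>{..<k}. (\<Sum>i<k. x i) < (\<Sum>i<j. x i))"
    for k and x :: "nat \<Rightarrow> real"
  define H where "H l x = g (\<Sum>i<l. x i) * of_bool (\<forall>j\<in>{..l}. 0 \<le> (\<Sum>i<j. x i))"
    for l and x :: "nat \<Rightarrow> real"
  have F_bound: "\<bar>F k x\<bar> \<le> 1" for k x using f by (auto simp: F_def)
  have H_bound: "\<bar>H k x\<bar> \<le> 1" for k x using g by (auto simp: H_def)
  have partial[measurable]: "(\<lambda>x. \<Sum>i<j. x (c + i)) \<in> borel_measurable (PiM I (\<lambda>_. borel :: real measure))"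
    if "\<And>i. i < j \<Longrightarrow> c + i \<in> I" for c j :: nat and I
    using that by (intro borel_measurable_sum measurable_component_singleton) auto
  have partial0: "(\<lambda>x. \<Sum>i<j. x i) \<in> borel_measurable (PiM I (\<lambda>_. borel :: real measure))"
    if "\<And>i. i < j \<Longrightarrow> i \<in> I" for j :: nat and I
    using partial[of j 0 I] that by simp
  have F_meas: "F k \<in> borel_measurable (PiM {..<k} (\<lambda>_. borel))" for k
    unfolding F_def of_bool_def
    by (intro borel_measurable_times measurable_If pred_intros_finite borel_measurable_less
        measurable_compose[OF _ assms(1)] partial0) auto
  have H_meas: "(\<lambda>x. H l (\<lambda>i. x (c + i))) \<in> borel_measurable (PiM {c..<c + l} (\<lambda>_. borel))" for c l
    unfolding H_def of_bool_def
    by (intro borel_measurable_times measurable_If pred_intros_finite borel_measurable_le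
        measurable_compose[OF _ assms(2)] partial) auto
  have F_restrict: "F k (\<lambda>i\<in>{..<k}. x i) = F k x" for k x
    by (simp add: F_def)
  have H_restrict: "H l (\<lambda>i. restrict x {c..<c + l} (c + i)) = H l (\<lambda>i. x (c + i))" for l c x
    by (simp add: H_def)
  have H_restrict0: "H l (\<lambda>i\<in>{..<l}. x i) = H l x" for l x
    by (simp add: H_def)
  have [measurable]: "random_variable borel (\<lambda>\<omega>. F k (\<lambda>i. \<xi> i \<omega>))" for k
    using measurable_compose[OF measurable_restrict[of "{..<k}" \<xi> M "\<lambda>_. borel"] F_meas]
    unfolding F_restrict by simp
  have [measurable]: "random_variable borel (\<lambda>\<omega>. H l (\<lambda>i. \<xi> (c + i) \<omega>))" for l c
    using measurable_compose[OF measurable_restrict[of "{c..<c + l}" \<xi> M "\<lambda>_. borel"] H_meas[of l c]]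
    unfolding H_restrict by simp
  have F_int: "integrable M (\<lambda>\<omega>. F k (\<lambda>i. \<xi> i \<omega>))" for k
    using F_bound by (intro integrable_const_bound[where B = 1]) auto
  have H_int: "integrable M (\<lambda>\<omega>. H l (\<lambda>i. \<xi> (c + i) \<omega>))" for l c
    using H_bound by (intro integrable_const_bound[where B = 1]) auto
  have prod: "(\<integral>\<omega>. F k (\<lambda>i. \<xi> i \<omega>) * H (n - k) (\<lambda>i. \<xi> (k + i) \<omega>) \<partial>M)
      = (\<integral>\<omega>. F k (\<lambda>i. \<xi> i \<omega>) \<partial>M) * (\<integral>\<omega>. H (n - k) (\<lambda>i. \<xi> i \<omega>) \<partial>M)"
    and int: "integrable M (\<lambda>\<omega>. F k (\<lambda>i. \<xi> i \<omega>) * H (n - k) (\<lambda>i. \<xi> (k + i) \<omega>))"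
    if "k \<in> {..n}" for k
  proof -
    let ?X = "\<lambda>\<omega>. \<lambda>i\<in>{..<k}. \<xi> i \<omega>" and ?Y = "\<lambda>\<omega>. \<lambda>i\<in>{k..<k + (n - k)}. \<xi> i \<omega>"
    have "indep_var (PiM {..<k} (\<lambda>_. borel)) ?X (PiM {k..<k + (n - k)} (\<lambda>_. borel)) ?Y"
      by (rule indep_var_restrict[OF indep]) auto
    from indep_var_compose[OF this F_meas H_meas]
    have iv: "indep_var borel (\<lambda>\<omega>. F k (\<lambda>i. \<xi> i \<omega>)) borel (\<lambda>\<omega>. H (n - k) (\<lambda>i. \<xi> (k + i) \<omega>))"
      unfolding comp_def F_restrict H_restrict .
    show "integrable M (\<lambda>\<omega>. F k (\<lambda>i. \<xi> i \<omega>) * H (n - k) (\<lambda>i. \<xi> (k + i) \<omega>))"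
      by (rule indep_var_integrable[OF iv F_int H_int])
    have "(\<integral>\<omega>. H (n - k) (\<lambda>i. \<xi> (k + i) \<omega>) \<partial>M) = (\<integral>\<omega>. H (n - k) (\<lambda>i. \<xi> i \<omega>) \<partial>M)"
    proof -
      have "H (n - k) \<in> borel_measurable (PiM {..<n - k} (\<lambda>_. borel))"
        using H_meas[of "n - k" 0] by (simp add: lessThan_atLeast0)
      from expectation_reindex[OF _ this, of "\<lambda>i. k + i"] show ?thesis
        unfolding H_restrict0 by simp
    qed
    then show "(\<integral>\<omega>. F k (\<lambda>i. \<xi> i \<omega>) * H (n - k) (\<lambda>i. \<xi> (k + i) \<omega>) \<partial>M)
      = (\<integral>\<omega>. F k (\<lambda>i. \<xi> i \<omega>) \<partial>M) * (\<integral>\<omega>. H (n - k) (\<lambda>i. \<xi> i \<omega>) \<partial>M)"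
      using indep_var_lebesgue_integral[OF iv F_int H_int] by simp
  qed
  have "(\<integral>\<omega>. f (walk_min (\<lambda>i. \<xi> i \<omega>) n) * g ((\<Sum>i<n. \<xi> i \<omega>) - walk_min (\<lambda>i. \<xi> i \<omega>) n) \<partial>M)
      = (\<integral>\<omega>. (\<Sum>k\<le>n. F k (\<lambda>i. \<xi> i \<omega>) * H (n - k) (\<lambda>i. \<xi> (k + i) \<omega>)) \<partial>M)"
    unfolding walk_min_split F_def H_def ..
  also have "\<dots> = (\<Sum>k\<le>n. (\<integral>\<omega>. F k (\<lambda>i. \<xi> i \<omega>) * H (n - k) (\<lambda>i. \<xi> (k + i) \<omega>) \<partial>M))"
    by (rule Bochner_Integration.integral_sum) (rule int)
  also have "\<dots> = (\<Sum>k\<le>n. (\<integral>\<omega>. F k (\<lambda>i. \<xi> i \<omega>) \<partial>M) * (\<integral>\<omega>. H (n - k) (\<lambda>i. \<xi> i \<omega>) \<partial>M))"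
    by (rule sum.cong[OF refl]) (rule prod)
  finally show ?thesis
    unfolding F_def H_def .
qed

text \<open>
  Reversing the order of the steps turns the final excess of the walk over its minimum into its maximum.
\<close>
lemma duality:
  assumes [measurable]: "g \<in> borel_measurable borel"
  shows "(\<integral>\<omega>. g ((\<Sum>i<n. \<xi> i \<omega>) - walk_min (\<lambda>i. \<xi> i \<omega>) n) \<partial>M) =
    (\<integral>\<omega>. g (walk_max (\<lambda>i. \<xi> i \<omega>) n) \<partial>M :: real)"
proof -
  have reverse: "(\<Sum>i<n. x i) - walk_min x n = walk_max (\<lambda>i. x (n - Suc i)) n" for x
  proof -
    let ?S = "\<lambda>k. \<Sum>i<k. x i"
    have S: "(\<Sum>i<k. x (n - Suc i)) = ?S n - ?S (n - k)" if "k \<le> n" for k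
      using that
    proof (induction k)
      case (Suc k)
      then have "n - k = Suc (n - Suc k)" by simp
      then have "?S (n - k) = ?S (n - Suc k) + x (n - Suc k)" by (metis sum.lessThan_Suc)
      then show ?case using Suc by simp
    qed simp
    have "(\<lambda>k. \<Sum>i<k. x (n - Suc i)) ` {..n} = (\<lambda>k. ?S n - ?S (n - k)) ` {..n}"
      using S by (intro image_cong) auto
    also have "\<dots> = (\<lambda>y. ?S n - y) ` ?S ` (\<lambda>k. n - k) ` {..n}"
      by (simp add: image_image)
    also have "(\<lambda>k. n - k) ` {..n} = {..n}"
    proof -
      have "k \<in> (\<lambda>k. n - k) ` {..n}" if "k \<le> n" for k
        using that by (intro image_eqI[of _ _ "n - k"]) auto
      then show ?thesis by auto
    qed
    finally have "walk_max (\<lambda>i. x (n - Suc i)) n = Max ((\<lambda>y. ?S n - y) ` ?S ` {..n})"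
      by (simp add: walk_max_def)
    also have "\<dots> = ?S n - Min (?S ` {..n})"
    proof (rule Max_eqI)
      show "?S n - Min (?S ` {..n}) \<in> (\<lambda>y. ?S n - y) ` ?S ` {..n}"
        using Min_in[of "?S ` {..n}"] by blast
    qed auto
    finally show ?thesis by (simp add: walk_min_def)
  qed
  have meas: "(\<lambda>x. g (walk_max x n)) \<in> borel_measurable (PiM {..<n} (\<lambda>_. borel))"
    unfolding walk_max_def
    by (intro measurable_compose[OF _ assms] borel_measurable_Max borel_measurable_sum
        measurable_component_singleton) auto
  have restrict: "walk_max (\<lambda>i\<in>{..<n}. x i) n = walk_max x n" for x
    unfolding walk_max_def by (intro arg_cong[where f = Max] image_cong sum.cong) auto
  have "inj_on (\<lambda>i. n - Suc i) {..<n}"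
    by (rule inj_onI) auto
  from expectation_reindex[OF this meas] show ?thesis
    unfolding restrict reverse .
qed

text \<open>
  By \<open>expectation_split\<close> the expectations at fixed times are convolutions \<open>a * b\<close>, where \<open>a\<close> depends on \<open>f\<close>
  and \<open>b\<close> on \<open>g\<close>; weighting with \<open>p ^ n\<close> turns them into products \<open>A f * B g\<close> of generating functions. The
  normalization \<open>(1 - p) * A 1 * B 1 = 1\<close> identifies the factors with the two marginal expectations.
\<close>
lemma geometric_factorization:
  assumes f: "f \<in> borel_measurable borel" "\<And>x. 0 \<le> f x \<and> f x \<le> (1::real)"
    and g: "g \<in> borel_measurable borel" "\<And>x. 0 \<le> g x \<and> g x \<le> (1::real)"
    and p: "0 \<le> p" "p < 1"
  shows "(\<Sum>n. (1 - p) * p ^ n *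
      (\<integral>\<omega>. f (walk_min (\<lambda>i. \<xi> i \<omega>) n) * g ((\<Sum>i<n. \<xi> i \<omega>) - walk_min (\<lambda>i. \<xi> i \<omega>) n) \<partial>M)) =
    (\<Sum>n. (1 - p) * p ^ n * (\<integral>\<omega>. f (walk_min (\<lambda>i. \<xi> i \<omega>) n) \<partial>M)) *
    (\<Sum>n. (1 - p) * p ^ n * (\<integral>\<omega>. g (walk_max (\<lambda>i. \<xi> i \<omega>) n) \<partial>M))"
proof -
  define a where "a f k = (\<integral>\<omega>. f (\<Sum>i<k. \<xi> i \<omega>) *
      of_bool (\<forall>j\<in>{..<k}. (\<Sum>i<k. \<xi> i \<omega>) < (\<Sum>i<j. \<xi> i \<omega>)) \<partial>M)" for k and f :: "real \<Rightarrow> real"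
  define b where "b g k = (\<integral>\<omega>. g (\<Sum>i<k. \<xi> i \<omega>) *
      of_bool (\<forall>j\<in>{..k}. 0 \<le> (\<Sum>i<j. \<xi> i \<omega>)) \<partial>M)" for k and g :: "real \<Rightarrow> real"
  define A where "A f = (\<Sum>k. p ^ k * a f k)" for f
  define B where "B g = (\<Sum>k. p ^ k * b g k)" for g
  define E where "E f g n = (\<integral>\<omega>. f (walk_min (\<lambda>i. \<xi> i \<omega>) n) *
      g ((\<Sum>i<n. \<xi> i \<omega>) - walk_min (\<lambda>i. \<xi> i \<omega>) n) \<partial>M)" for f g :: "real \<Rightarrow> real" and n
  have bound: "\<bar>\<integral>\<omega>. h \<omega> \<partial>M\<bar> \<le> 1" if "\<And>\<omega>. 0 \<le> h \<omega> \<and> h \<omega> \<le> 1" for h :: "'a \<Rightarrow> real"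
  proof (cases "integrable M h")
    case True
    then have "(\<integral>\<omega>. h \<omega> \<partial>M) \<le> (\<integral>\<omega>. 1 \<partial>M)"
      using that by (intro integral_mono) auto
    moreover have "0 \<le> (\<integral>\<omega>. h \<omega> \<partial>M)"
      using that by (intro integral_nonneg_AE) auto
    ultimately show ?thesis by (simp add: prob_space)
  qed (simp add: not_integrable_integral_eq)
  have summable: "summable (\<lambda>k. norm (p ^ k * c k))" if "\<And>k. \<bar>c k\<bar> \<le> 1" for c :: "nat \<Rightarrow> real"
  proof (rule summable_comparison_test')
    show "summable (\<lambda>k. p ^ k)" using p by simp
    show "norm (norm (p ^ k * c k)) \<le> p ^ k" for k
      using p(1) mult_left_le[OF that[of k], of "p ^ k"] by (simp add: abs_mult)
  qed
  have main: "(\<Sum>n. (1 - p) * p ^ n * E f g n) = (1 - p) * (A f * B g)"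
    if f: "f \<in> borel_measurable borel" "\<And>x. 0 \<le> f x \<and> f x \<le> 1"
      and g: "g \<in> borel_measurable borel" "\<And>x. 0 \<le> g x \<and> g x \<le> 1" for f g
  proof -
    have "\<bar>a f k\<bar> \<le> 1" for k unfolding a_def using f(2) by (intro bound) auto
    moreover have "\<bar>b g k\<bar> \<le> 1" for k unfolding b_def using g(2) by (intro bound) auto
    ultimately have "(\<lambda>n. \<Sum>k\<le>n. (p ^ k * a f k) * (p ^ (n - k) * b g (n - k))) sums (A f * B g)"
      unfolding A_def B_def by (intro Cauchy_product_sums summable) auto
    moreover have "(\<Sum>k\<le>n. (p ^ k * a f k) * (p ^ (n - k) * b g (n - k))) = p ^ n * E f g n" for n
    proof -
      have "(\<Sum>k\<le>n. (p ^ k * a f k) * (p ^ (n - k) * b g (n - k))) = (\<Sum>k\<le>n. p ^ n * (a f k * b g (n - k)))"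
      proof (rule sum.cong[OF refl])
        fix k assume "k \<in> {..n}"
        then have "p ^ n = p ^ k * p ^ (n - k)" by (simp flip: power_add)
        then show "(p ^ k * a f k) * (p ^ (n - k) * b g (n - k)) = p ^ n * (a f k * b g (n - k))"
          by (simp only: ac_simps)
      qed
      also have "\<dots> = p ^ n * E f g n"
        using expectation_split[OF f(1) g(1) f(2) g(2), of n]
        by (simp add: sum_distrib_left a_def b_def E_def)
      finally show ?thesis .
    qed
    ultimately have "(\<lambda>n. p ^ n * E f g n) sums (A f * B g)" by simp
    from sums_mult[OF this, of "1 - p"] show ?thesis
      by (simp add: sums_iff mult.assoc)
  qed
  let ?one = "\<lambda>_::real. 1::real"
  have "E ?one ?one n = 1" for n by (simp add: E_def prob_space)
  \<comment> \<open>The case \<open>f = g = 1\<close> says that the geometric weights sum to 1.\<close>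
  then have one: "(1 - p) * (A ?one * B ?one) = 1"
    using main[of ?one ?one] sums_mult[OF geometric_sums[of p], of "1 - p"] p
    by (simp add: sums_iff)
  have "(\<Sum>n. (1 - p) * p ^ n * E f g n) = (1 - p) * (A f * B g) * ((1 - p) * (A ?one * B ?one))"
    using main[OF f g] one by simp
  also have "\<dots> = ((1 - p) * (A f * B ?one)) * ((1 - p) * (A ?one * B g))"
    by (simp add: algebra_simps)
  also have "\<dots> = (\<Sum>n. (1 - p) * p ^ n * E f ?one n) * (\<Sum>n. (1 - p) * p ^ n * E ?one g n)"
    using main[OF f, of ?one] main[OF _ _ g, of ?one] by simp
  finally show ?thesis
    using duality[OF g(1)] by (simp add: E_def)
qed

end

section \<open>Path segments of a Levy process\<close>

text \<open>
  The lowest and the final level over \<open>[a, b]\<close>, relative to the starting level: the only features of a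
  path segment that the two survival events see.
\<close>
definition block :: "(real \<Rightarrow> real) \<Rightarrow> real \<Rightarrow> real \<Rightarrow> real \<times> real" where
  "block x a b = ((INF q\<in>{a..b}. x q) - x a, x b - x a)"

lemma measurable_mesh_index [measurable]: "mesh_index m \<in> borel \<rightarrow>\<^sub>M count_space UNIV"
  unfolding mesh_index_def by measurable

text \<open>
  Evaluation at the next mesh point is a countable combination of measurable maps, and right
  continuity passes to the limit. The absolute value makes the statement total in the time argument.
  The space \<open>N\<close> is arbitrary so that the statement also applies to the sigma-algebra generated by the paths.
\<close>
lemma measurable_cadlag_process:
  fixes X :: "real \<Rightarrow> 'a \<Rightarrow> real"
  assumes X: "\<And>t. 0 \<le> t \<Longrightarrow> X t \<in> borel_measurable N"
    and cadlag: "\<And>\<omega>. \<omega> \<in> space N \<Longrightarrow> cadlag (\<lambda>t. X t \<omega>)"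
  shows "(\<lambda>z. X \<bar>snd z\<bar> (fst z)) \<in> borel_measurable (N \<Otimes>\<^sub>M borel)"
proof (rule borel_measurable_LIMSEQ_real)
  show "(\<lambda>m. X (real (mesh_index m \<bar>snd z\<bar>) / real (Suc m)) (fst z)) \<longlonglongrightarrow> X \<bar>snd z\<bar> (fst z)"
    if "z \<in> space (N \<Otimes>\<^sub>M borel)" for z
    using that by (intro mesh_tendsto_at_right cadlag) (auto simp: space_pair_measure)
  show "(\<lambda>z. X (real (mesh_index m \<bar>snd z\<bar>) / real (Suc m)) (fst z)) \<in> borel_measurable (N \<Otimes>\<^sub>M borel)" for m
  proof (rule measurable_compose_countable[where g = "\<lambda>z. mesh_index m \<bar>snd z\<bar>"])
    show "(\<lambda>z. X (real j / real (Suc m)) (fst z)) \<in> borel_measurable (N \<Otimes>\<^sub>M borel)" for j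
      by (rule measurable_compose[OF measurable_fst X]) auto
  qed measurable
qed

text \<open>
  The minima along subdivisions are measurable jointly in the end points and converge to the infimum.
  Absolute values make the statement total in \<open>a\<close> and \<open>s\<close>.
\<close>
lemma measurable_cadlag_INF:
  fixes X :: "real \<Rightarrow> 'a \<Rightarrow> real"
  assumes X: "\<And>t. 0 \<le> t \<Longrightarrow> X t \<in> borel_measurable N"
    and cadlag: "\<And>\<omega>. \<omega> \<in> space N \<Longrightarrow> cadlag (\<lambda>t. X t \<omega>)"
  shows "(\<lambda>(\<omega>, a, s). INF q\<in>{\<bar>a\<bar>..\<bar>a\<bar> + \<bar>s\<bar>}. X q \<omega>) \<in> borel_measurable (N \<Otimes>\<^sub>M borel \<Otimes>\<^sub>M borel)"
proof (rule borel_measurable_LIMSEQ_real)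
  note joint = measurable_cadlag_process[OF X cadlag]
  show "(\<lambda>m. (\<lambda>(\<omega>, a, s). Min ((\<lambda>j. X \<bar>\<bar>a\<bar> + real j * \<bar>s\<bar> / real (Suc m)\<bar> \<omega>) ` {..Suc m})) z)
      \<longlonglongrightarrow> (\<lambda>(\<omega>, a, s). INF q\<in>{\<bar>a\<bar>..\<bar>a\<bar> + \<bar>s\<bar>}. X q \<omega>) z"
    if z: "z \<in> space (N \<Otimes>\<^sub>M borel \<Otimes>\<^sub>M borel)" for z
  proof -
    obtain \<omega> a s where z_eq: "z = (\<omega>, a, s)" by (metis prod.exhaust)
    have "\<bar>\<bar>a\<bar> + real j * \<bar>s\<bar> / real (Suc m)\<bar> = \<bar>a\<bar> + real j * \<bar>s\<bar> / real (Suc m)" for j m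
      by (intro abs_of_nonneg add_nonneg_nonneg divide_nonneg_nonneg mult_nonneg_nonneg) auto
    then show ?thesis
      using z Min_subdivision_tendsto_INF[OF cadlag, of \<omega> "\<bar>a\<bar>" "\<bar>s\<bar>"]
      by (simp add: z_eq space_pair_measure del: of_nat_Suc)
  qed
  show "(\<lambda>(\<omega>, a, s). Min ((\<lambda>j. X \<bar>\<bar>a\<bar> + real j * \<bar>s\<bar> / real (Suc m)\<bar> \<omega>) ` {..Suc m}))
      \<in> borel_measurable (N \<Otimes>\<^sub>M borel \<Otimes>\<^sub>M borel)" for m
    unfolding split_beta
  proof (rule borel_measurable_Min)
    show "(\<lambda>z. X \<bar>\<bar>fst (snd z)\<bar> + real j * \<bar>snd (snd z)\<bar> / real (Suc m)\<bar> (fst z))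
        \<in> borel_measurable (N \<Otimes>\<^sub>M borel \<Otimes>\<^sub>M borel)" for j
      using measurable_compose[OF _ joint, of "\<lambda>z. (fst z, \<bar>fst (snd z)\<bar> + real j * \<bar>snd (snd z)\<bar> / real (Suc m))"]
      by simp
  qed auto
qed

lemma measurable_block:
  fixes X :: "real \<Rightarrow> 'a \<Rightarrow> real"
  assumes X: "\<And>t. 0 \<le> t \<Longrightarrow> X t \<in> borel_measurable N"
    and cadlag: "\<And>\<omega>. \<omega> \<in> space N \<Longrightarrow> cadlag (\<lambda>t. X t \<omega>)"
  shows "(\<lambda>(\<omega>, a, s). block (\<lambda>t. X t \<omega>) \<bar>a\<bar> (\<bar>a\<bar> + \<bar>s\<bar>))
    \<in> N \<Otimes>\<^sub>M borel \<Otimes>\<^sub>M borel \<rightarrow>\<^sub>M borel \<Otimes>\<^sub>M borel"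
proof -
  note joint = measurable_cadlag_process[OF X cadlag]
  have start: "(\<lambda>z. X \<bar>fst (snd z)\<bar> (fst z)) \<in> borel_measurable (N \<Otimes>\<^sub>M borel \<Otimes>\<^sub>M (borel :: real measure))"
  proof -
    have "(\<lambda>z. (fst z, fst (snd z))) \<in> N \<Otimes>\<^sub>M borel \<Otimes>\<^sub>M (borel :: real measure) \<rightarrow>\<^sub>M N \<Otimes>\<^sub>M borel"
      by measurable
    from measurable_compose[OF this joint] show ?thesis by simp
  qed
  have "(\<lambda>z. X \<bar>\<bar>fst (snd z)\<bar> + \<bar>snd (snd z)\<bar>\<bar> (fst z)) \<in> borel_measurable (N \<Otimes>\<^sub>M borel \<Otimes>\<^sub>M borel)"
    using measurable_compose[OF _ joint, of "\<lambda>z. (fst z, \<bar>fst (snd z)\<bar> + \<bar>snd (snd z)\<bar>)"] by simp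
  moreover have "\<bar>\<bar>a\<bar> + \<bar>b\<bar>\<bar> = \<bar>a\<bar> + \<bar>b\<bar>" for a b :: real by simp
  ultimately have finish: "(\<lambda>z. X (\<bar>fst (snd z)\<bar> + \<bar>snd (snd z)\<bar>) (fst z)) \<in> borel_measurable (N \<Otimes>\<^sub>M borel \<Otimes>\<^sub>M borel)"
    by simp
  show ?thesis
    using measurable_cadlag_INF[OF X cadlag] start finish
    unfolding split_beta block_def by (intro measurable_Pair borel_measurable_diff)
qed

lemma measurable_cadlag_SUP:
  fixes X :: "real \<Rightarrow> 'a \<Rightarrow> real"
  assumes X: "\<And>t. 0 \<le> t \<Longrightarrow> X t \<in> borel_measurable N"
    and cadlag: "\<And>\<omega>. \<omega> \<in> space N \<Longrightarrow> cadlag (\<lambda>t. X t \<omega>)"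
  shows "(\<lambda>(\<omega>, t). SUP q\<in>{0..\<bar>t\<bar>}. X q \<omega>) \<in> borel_measurable (N \<Otimes>\<^sub>M borel)"
proof -
  have "(\<lambda>(\<omega>, a, s). INF q\<in>{\<bar>a\<bar>..\<bar>a\<bar> + \<bar>s\<bar>}. - X q \<omega>) \<in> borel_measurable (N \<Otimes>\<^sub>M borel \<Otimes>\<^sub>M borel)"
    by (rule measurable_cadlag_INF) (auto intro: X cadlag cadlag_uminus)
  from measurable_compose[OF _ this, of "\<lambda>z. (fst z, 0, snd z)"]
  have "(\<lambda>z. INF q\<in>{0..\<bar>snd z\<bar>}. - X q (fst z)) \<in> borel_measurable (N \<Otimes>\<^sub>M borel)"
    by (simp add: split_beta)
  then show ?thesis
    unfolding split_beta SUP_eq_minus_INF by (rule borel_measurable_uminus)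
qed

context levy_process
begin

lemma measurable_block_fixed:
  assumes "0 \<le> a" "a \<le> b"
  shows "(\<lambda>\<omega>. block (\<lambda>t. X t \<omega>) a b) \<in> M \<rightarrow>\<^sub>M borel \<Otimes>\<^sub>M borel"
proof -
  have "(\<lambda>\<omega>. (\<omega>, a, b - a)) \<in> M \<rightarrow>\<^sub>M M \<Otimes>\<^sub>M borel \<Otimes>\<^sub>M borel" by measurable
  from measurable_compose[OF this measurable_block[OF measurable_process cadlag_paths]]
  show ?thesis using assms by simp
qed

text \<open>
  Along an equidistant subdivision both segments are the same function of vectors of independent
  increments with a common law; refining the subdivision gives the segments themselves.
\<close>
lemma block_stationary:
  assumes a: "0 \<le> a" and s: "0 \<le> s"
  shows "distr M (borel \<Otimes>\<^sub>M borel) (\<lambda>\<omega>. block (\<lambda>t. X t \<omega>) a (a + s)) =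
    distr M (borel \<Otimes>\<^sub>M borel) (\<lambda>\<omega>. block (\<lambda>t. X t \<omega>) 0 s)"
proof (cases "s = 0")
  case True
  then show ?thesis by (simp add: block_def)
next
  case False
  with s have s: "0 < s" by simp
  define incr where "incr m a i \<omega> = X (a + real (Suc i) * s / real (Suc m)) \<omega> - X (a + real i * s / real (Suc m)) \<omega>"
    for m a i \<omega>
  have law: "distr M (PiM {..<Suc m} (\<lambda>_. borel)) (\<lambda>\<omega>. \<lambda>i\<in>{..<Suc m}. incr m a i \<omega>)
      = PiM {..<Suc m} (\<lambda>_. distr M borel (X (s / real (Suc m))))" if a: "0 \<le> a" for a m
  proof -
    let ?t = "\<lambda>i. a + real i * s / real (Suc m)"
    have "0 \<le> ?t 0" "\<And>i. ?t i < ?t (Suc i)"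
      using a s by (auto intro!: divide_strict_right_mono mult_strict_right_mono)
    then have ind: "indep_vars (\<lambda>_. borel) (incr m a) {..<Suc m}"
      unfolding incr_def by (intro independent_increments)
    have "distr M borel (incr m a i) = distr M borel (X (s / real (Suc m)))" for i
    proof -
      have "a + real (Suc i) * s / real (Suc m) = (a + real i * s / real (Suc m)) + s / real (Suc m)"
        by (simp add: add_divide_distrib distrib_right)
      then show ?thesis
        unfolding incr_def using a s by (simp only:) (intro stationary_increments, auto)
    qed
    moreover have "random_variable borel (incr m a i)" if "i \<in> {..<Suc m}" for i
      using ind that by (auto simp: indep_vars_def)
    ultimately show ?thesis
      using ind by (subst (asm) indep_vars_iff_distr_eq_PiM') auto
  qed
  note [measurable] = measurable_process
  show ?thesis
  proof (rule measure_eqI_continuous_products)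
    fix f g :: "real \<Rightarrow> real"
    assume f: "continuous_on UNIV f" "\<And>x. 0 \<le> f x \<and> f x \<le> 1"
      and g: "continuous_on UNIV g" "\<And>x. 0 \<le> g x \<and> g x \<le> 1"
    have [measurable]: "f \<in> borel_measurable borel" "g \<in> borel_measurable borel"
      using f(1) g(1) by (auto intro: borel_measurable_continuous_onI)
    define \<Phi> where "\<Phi> m x = f (walk_min x (Suc m)) * g (\<Sum>i<Suc m. x i)" for m and x :: "nat \<Rightarrow> real"
    have \<Phi>_meas: "\<Phi> m \<in> borel_measurable (PiM {..<Suc m} (\<lambda>_. borel))" for m
      unfolding \<Phi>_def walk_min_def
      by (intro borel_measurable_times measurable_compose[OF _ \<open>f \<in> _\<close>] measurable_compose[OF _ \<open>g \<in> _\<close>]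
          borel_measurable_Min borel_measurable_sum measurable_component_singleton) auto
    have \<Phi>_restrict: "\<Phi> m (\<lambda>i\<in>{..<Suc m}. x i) = \<Phi> m x" for m x
    proof -
      have "walk_min (\<lambda>i\<in>{..<Suc m}. x i) (Suc m) = walk_min x (Suc m)"
        unfolding walk_min_def by (intro arg_cong[where f = Min] image_cong sum.cong) auto
      then show ?thesis by (simp add: \<Phi>_def)
    qed
    have incr_meas[measurable]: "random_variable borel (incr m a i)" if "0 \<le> a" for m a i
      unfolding incr_def using that s by (intro borel_measurable_diff measurable_process) auto
    have meas: "(\<lambda>\<omega>. \<lambda>i\<in>{..<Suc m}. incr m a i \<omega>) \<in> M \<rightarrow>\<^sub>M PiM {..<Suc m} (\<lambda>_. borel)" if "0 \<le> a" for m a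
      using that by (intro measurable_restrict incr_meas)
    have \<Phi>_incr_meas: "random_variable borel (\<lambda>\<omega>. \<Phi> m (\<lambda>i. incr m a i \<omega>))" if "0 \<le> a" for m a
      using measurable_compose[OF meas[OF that] \<Phi>_meas] unfolding \<Phi>_restrict .
    have \<Phi>_eq: "\<Phi> m (\<lambda>i. incr m a i \<omega>) =
        f (Min ((\<lambda>j. X (a + real j * s / real (Suc m)) \<omega>) ` {..Suc m}) - X a \<omega>) * g (X (a + s) \<omega> - X a \<omega>)"
      for m a \<omega>
      unfolding \<Phi>_def incr_def
      using walk_min_increments[of "\<lambda>j. X (a + real j * s / real (Suc m)) \<omega>" "Suc m"]
        sum_lessThan_telescope[of "\<lambda>j. X (a + real j * s / real (Suc m)) \<omega>" "Suc m"]
      by (simp del: of_nat_Suc sum.lessThan_Suc)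
    have limit: "(\<lambda>m. \<integral>\<omega>. \<Phi> m (\<lambda>i. incr m a i \<omega>) \<partial>M) \<longlonglongrightarrow>
        (\<integral>\<omega>. f (fst (block (\<lambda>t. X t \<omega>) a (a + s))) * g (snd (block (\<lambda>t. X t \<omega>) a (a + s))) \<partial>M)"
      if a: "0 \<le> a" for a
    proof (rule integral_dominated_convergence[where w = "\<lambda>_. 1"])
      show "AE \<omega> in M. (\<lambda>m. \<Phi> m (\<lambda>i. incr m a i \<omega>)) \<longlonglongrightarrow>
          f (fst (block (\<lambda>t. X t \<omega>) a (a + s))) * g (snd (block (\<lambda>t. X t \<omega>) a (a + s)))"
        unfolding \<Phi>_eq block_def fst_conv snd_conv
        using a s
        by (intro AE_I2 tendsto_mult tendsto_const tendsto_diff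
            continuous_on_tendsto_compose[OF f(1)] Min_subdivision_tendsto_INF cadlag_paths) auto
      show "AE \<omega> in M. norm (\<Phi> m (\<lambda>i. incr m a i \<omega>)) \<le> 1" for m
        using f(2) g(2) by (intro AE_I2) (auto simp: \<Phi>_def abs_mult intro!: mult_le_one)
      show "(\<lambda>\<omega>. f (fst (block (\<lambda>t. X t \<omega>) a (a + s))) * g (snd (block (\<lambda>t. X t \<omega>) a (a + s))))
          \<in> borel_measurable M"
      proof -
        have [measurable]: "(\<lambda>\<omega>. block (\<lambda>t. X t \<omega>) a (a + s)) \<in> M \<rightarrow>\<^sub>M borel \<Otimes>\<^sub>M borel"
          using a s by (intro measurable_block_fixed) auto
        show ?thesis by measurable
      qed
    qed (use \<Phi>_incr_meas[OF a] in auto)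
    have "(\<integral>\<omega>. \<Phi> m (\<lambda>i. incr m a i \<omega>) \<partial>M) =
        (\<integral>x. \<Phi> m x \<partial>PiM {..<Suc m} (\<lambda>_. distr M borel (X (s / real (Suc m)))))" if "0 \<le> a" for a m
      unfolding law[OF that, symmetric] integral_distr[OF meas[OF that] \<Phi>_meas] \<Phi>_restrict ..
    from this[OF a] this[of 0] have "(\<integral>\<omega>. \<Phi> m (\<lambda>i. incr m a i \<omega>) \<partial>M) = (\<integral>\<omega>. \<Phi> m (\<lambda>i. incr m 0 i \<omega>) \<partial>M)" for m
      by simp
    with limit[OF a] limit[of 0]
    have "(\<integral>\<omega>. f (fst (block (\<lambda>t. X t \<omega>) a (a + s))) * g (snd (block (\<lambda>t. X t \<omega>) a (a + s))) \<partial>M) =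
      (\<integral>\<omega>. f (fst (block (\<lambda>t. X t \<omega>) 0 s)) * g (snd (block (\<lambda>t. X t \<omega>) 0 s)) \<partial>M)"
      by (auto intro: LIMSEQ_unique)
    then show "(\<integral>z. f (fst z) * g (snd z) \<partial>distr M (borel \<Otimes>\<^sub>M borel) (\<lambda>\<omega>. block (\<lambda>t. X t \<omega>) a (a + s))) =
      (\<integral>z. f (fst z) * g (snd z) \<partial>distr M (borel \<Otimes>\<^sub>M borel) (\<lambda>\<omega>. block (\<lambda>t. X t \<omega>) 0 s))"
      using a s measurable_block_fixed[of a "a + s"] measurable_block_fixed[of 0 s]
      by (subst (1 2) integral_distr) auto
  qed (use a s in \<open>auto intro!: finite_measure_distr measurable_block_fixed\<close>)
qed

lemma block_stationary_expectation:
  fixes F :: "real \<times> real \<Rightarrow> real"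
  assumes F: "F \<in> borel_measurable (borel \<Otimes>\<^sub>M borel)" and "0 \<le> a" "a \<le> b"
  shows "(\<integral>\<omega>. F (block (\<lambda>t. X t \<omega>) a b) \<partial>M) = (\<integral>\<omega>. F (block (\<lambda>t. X t \<omega>) 0 (b - a)) \<partial>M)"
  using block_stationary[of a "b - a"] assms(2,3)
    integral_distr[OF measurable_block_fixed[of a b] F]
    integral_distr[OF measurable_block_fixed[of 0 "b - a"] F]
  by simp

lemma measurable_block_expectation:
  fixes F :: "real \<times> real \<Rightarrow> real"
  assumes F: "F \<in> borel_measurable (borel \<Otimes>\<^sub>M borel)"
  shows "(\<lambda>s. \<integral>\<omega>. F (block (\<lambda>t. X t \<omega>) 0 \<bar>s\<bar>) \<partial>M) \<in> borel_measurable borel"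
proof -
  have "(\<lambda>z. (snd z, 0, fst z)) \<in> borel \<Otimes>\<^sub>M M \<rightarrow>\<^sub>M M \<Otimes>\<^sub>M borel \<Otimes>\<^sub>M borel" by measurable
  from measurable_compose[OF measurable_compose[OF this
      measurable_block[OF measurable_process cadlag_paths]] F]
  show ?thesis
    by (intro borel_measurable_lebesgue_integral) (simp add: split_beta)
qed

lemma iid_mesh_increments:
  "iid_steps M (\<lambda>i \<omega>. X (real (Suc i) / real (Suc m)) \<omega> - X (real i / real (Suc m)) \<omega>)"
proof (unfold_locales)
  show "indep_vars (\<lambda>_. borel) (\<lambda>i \<omega>. X (real (Suc i) / real (Suc m)) \<omega> - X (real i / real (Suc m)) \<omega>) UNIV"
  proof (rule indep_vars_finite_subsets)
    show "random_variable borel (\<lambda>\<omega>. X (real (Suc i) / real (Suc m)) \<omega> - X (real i / real (Suc m)) \<omega>)" for i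
      by (intro borel_measurable_diff measurable_process) auto
    fix J :: "nat set" assume "finite J"
    then obtain n where n: "J \<subseteq> {..<n}" using finite_nat_iff_bounded by blast
    have "indep_vars (\<lambda>_. borel) (\<lambda>i \<omega>. X (real (Suc i) / real (Suc m)) \<omega> - X (real i / real (Suc m)) \<omega>) {..<n}"
      by (rule independent_increments) (auto intro!: divide_strict_right_mono)
    then show "indep_vars (\<lambda>_. borel) (\<lambda>i \<omega>. X (real (Suc i) / real (Suc m)) \<omega> - X (real i / real (Suc m)) \<omega>) J"
      using n by (rule indep_vars_subset)
  qed
  have law: "distr M borel (\<lambda>\<omega>. X (real (Suc i) / real (Suc m)) \<omega> - X (real i / real (Suc m)) \<omega>) =
      distr M borel (X (1 / real (Suc m)))" for i
  proof -
    have eq: "real (Suc i) / real (Suc m) = real i / real (Suc m) + 1 / real (Suc m)"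
      by (simp add: add_divide_distrib)
    show ?thesis unfolding eq by (rule stationary_increments) auto
  qed
  show "distr M borel (\<lambda>\<omega>. X (real (Suc i) / real (Suc m)) \<omega> - X (real i / real (Suc m)) \<omega>) =
      distr M borel (\<lambda>\<omega>. X (real (Suc 0) / real (Suc m)) \<omega> - X (real 0 / real (Suc m)) \<omega>)" for i
    unfolding law ..
qed

text \<open>
  On a common mesh the segments are functions of the increments in disjoint sets of cells; the mesh is
  then refined.
\<close>
lemma block_independent:
  assumes t: "0 \<le> t 0" "\<And>k. t k \<le> t (Suc k)"
  shows "indep_vars (\<lambda>_. borel \<Otimes>\<^sub>M borel) (\<lambda>k \<omega>. block (\<lambda>s. X s \<omega>) (t k) (t (Suc k))) UNIV"
proof -
  have nonneg: "0 \<le> t k" for k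
    using t by (induction k) (auto intro: order_trans)
  have mono: "mono t" using t(2) by (rule mono_iff_le_Suc[THEN iffD2, OF allI])
  define \<xi> where "\<xi> m i \<omega> = X (real (Suc i) / real (Suc m)) \<omega> - X (real i / real (Suc m)) \<omega>" for m i \<omega>
  define N where "N m k = mesh_index m (t k)" for m k
  have N: "N m k \<le> N m (Suc k)" for m k
    unfolding N_def using t(2) by (rule mesh_index_mono)
  define Z where "Z m k x = (Min ((\<lambda>j. \<Sum>i=N m k..<j. x i) ` {N m k..N m (Suc k)}), \<Sum>i=N m k..<N m (Suc k). x i)"
    for m k and x :: "nat \<Rightarrow> real"
  have Z_meas: "Z m k \<in> PiM {N m k..<N m (Suc k)} (\<lambda>_. borel) \<rightarrow>\<^sub>M borel \<Otimes>\<^sub>M borel" for m k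
    unfolding Z_def
    by (intro measurable_Pair borel_measurable_Min borel_measurable_sum measurable_component_singleton) auto
  have Z_restrict: "Z m k (\<lambda>i\<in>{N m k..<N m (Suc k)}. x i) = Z m k x" for m k x
    unfolding Z_def by (intro arg_cong2[where f = Pair] arg_cong[where f = Min] image_cong sum.cong) auto
  have Z_eq: "Z m k (\<lambda>i. \<xi> m i \<omega>) =
      (Min ((\<lambda>j. X (real j / real (Suc m)) \<omega>) ` {N m k..N m (Suc k)}) - X (real (N m k) / real (Suc m)) \<omega>,
       X (real (N m (Suc k)) / real (Suc m)) \<omega> - X (real (N m k) / real (Suc m)) \<omega>)" for m k \<omega>
  proof -
    have "(\<Sum>i=N m k..<j. \<xi> m i \<omega>) = X (real j / real (Suc m)) \<omega> - X (real (N m k) / real (Suc m)) \<omega>"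
      if "N m k \<le> j" for j
      unfolding \<xi>_def using sum_Suc_diff'[OF that, of "\<lambda>i. X (real i / real (Suc m)) \<omega>"] .
    then have "Z m k (\<lambda>i. \<xi> m i \<omega>) =
      (Min ((\<lambda>j. X (real j / real (Suc m)) \<omega> - X (real (N m k) / real (Suc m)) \<omega>) ` {N m k..N m (Suc k)}),
       X (real (N m (Suc k)) / real (Suc m)) \<omega> - X (real (N m k) / real (Suc m)) \<omega>)"
      unfolding Z_def using N by (intro arg_cong2[where f = Pair] arg_cong[where f = Min] image_cong) auto
    then show ?thesis using N by (simp add: Min_minus_const del: of_nat_Suc)
  qed
  have "indep_vars (\<lambda>_. borel) (\<lambda>k \<omega>. block (\<lambda>s. X s \<omega>) (t k) (t (Suc k))) UNIV"
  proof (rule indep_vars_tendsto)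
    fix m
    interpret iid_steps M "\<xi> m"
      unfolding \<xi>_def by (rule iid_mesh_increments)
    have "disjoint_family_on (\<lambda>k. {N m k..<N m (Suc k)}) UNIV"
    proof -
      have "N m i \<le> N m j" if "i \<le> j" for i j
        using that N by (rule lift_Suc_mono_le[rotated])
      then have "N m (Suc i) \<le> N m j" if "i < j" for i j
        using that by (simp add: Suc_leI)
      then have "{N m i..<N m (Suc i)} \<inter> {N m j..<N m (Suc j)} = {}" if "i \<noteq> j" for i j
        using that by (cases i j rule: linorder_cases) fastforce+
      then show ?thesis by (auto simp: disjoint_family_on_def)
    qed
    from indep_vars_restrict[OF indep _ this]
    have "indep_vars (\<lambda>k. PiM {N m k..<N m (Suc k)} (\<lambda>_. borel))
        (\<lambda>k \<omega>. \<lambda>i\<in>{N m k..<N m (Suc k)}. \<xi> m i \<omega>) UNIV" by simp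
    from indep_vars_compose2[OF this Z_meas]
    show "indep_vars (\<lambda>_. borel) (\<lambda>k \<omega>. Z m k (\<lambda>i. \<xi> m i \<omega>)) UNIV"
      unfolding Z_restrict borel_prod .
  next
    fix k \<omega> assume \<omega>: "\<omega> \<in> space M"
    show "(\<lambda>m. Z m k (\<lambda>i. \<xi> m i \<omega>)) \<longlonglongrightarrow> block (\<lambda>s. X s \<omega>) (t k) (t (Suc k))"
      unfolding Z_eq block_def N_def
      by (intro tendsto_Pair tendsto_diff mesh_tendsto_at_right[OF cadlag_paths[OF \<omega>]]
          Min_mesh_tendsto_INF[OF cadlag_paths[OF \<omega>]] nonneg t(2))
        (use mesh_index_bounds(1)[OF nonneg[of k]] in \<open>auto intro: less_imp_le simp del: of_nat_Suc\<close>)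
  qed
  then show ?thesis by (simp add: borel_prod)
qed

end

section \<open>Wiener-Hopf factorization at an exponential time\<close>

context prob_space
begin

lemma expectation_sums_countable:
  assumes N [measurable]: "N \<in> M \<rightarrow>\<^sub>M count_space (UNIV :: nat set)"
    and c: "\<And>n. \<bar>c n\<bar> \<le> (1::real)"
  shows "(\<lambda>n. prob {\<omega> \<in> space M. N \<omega> = n} * c n) sums (\<integral>\<omega>. c (N \<omega>) \<partial>M)"
proof -
  let ?f = "\<lambda>n \<omega>. indicator {\<omega> \<in> space M. N \<omega> = n} \<omega> * c n"
  have single: "(\<lambda>n. indicator {\<omega> \<in> space M. N \<omega> = n} \<omega> * d n) sums d (N \<omega>)"
    if "\<omega> \<in> space M" for \<omega> and d :: "nat \<Rightarrow> real"
  proof -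
    have "(\<lambda>n. indicator {\<omega> \<in> space M. N \<omega> = n} \<omega> * d n) = (\<lambda>n. if n = N \<omega> then d n else 0)"
      using that by (auto simp: indicator_def)
    then show ?thesis using sums_single[of "N \<omega>" d] by simp
  qed
  have norm: "norm (?f n \<omega>) = indicator {\<omega> \<in> space M. N \<omega> = n} \<omega> * \<bar>c n\<bar>" for n \<omega>
    by (simp add: abs_mult)
  have int: "integrable M (?f n)" for n
    by (intro integrable_mult_left integrable_real_indicator) (auto simp: emeasure_eq_measure)
  have "(\<lambda>n. \<integral>\<omega>. ?f n \<omega> \<partial>M) sums (\<integral>\<omega>. (\<Sum>n. ?f n \<omega>) \<partial>M)"
  proof (rule sums_integral[OF int])
    show "AE \<omega> in M. summable (\<lambda>n. norm (?f n \<omega>))"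
      unfolding norm using single[of _ "\<lambda>n. \<bar>c n\<bar>"] by (auto simp: sums_iff)
    have "(\<lambda>n. measure M {\<omega> \<in> space M. N \<omega> = n}) sums measure M (\<Union>n. {\<omega> \<in> space M. N \<omega> = n})"
      by (rule finite_measure_UNION) (auto simp: disjoint_family_on_def)
    then have "summable (\<lambda>n. prob {\<omega> \<in> space M. N \<omega> = n})" by (simp add: sums_iff)
    then show "summable (\<lambda>n. \<integral>\<omega>. norm (?f n \<omega>) \<partial>M)"
      unfolding norm
      by (rule summable_comparison_test'[where N = 0])
        (use c in \<open>auto simp: abs_mult intro!: mult_left_le\<close>)
  qed
  also have "(\<integral>\<omega>. (\<Sum>n. ?f n \<omega>) \<partial>M) = (\<integral>\<omega>. c (N \<omega>) \<partial>M)"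
    using single[of _ c] by (intro Bochner_Integration.integral_cong) (auto simp: sums_iff)
  finally show ?thesis by simp
qed

text \<open>
  The exponential law has no memory, so the number of complete cells before \<open>\<tau>\<close> is geometric. The
  probability in question is the difference of two exponential tails; closed and open tails agree
  because the law has a density.
\<close>
lemma exponential_mesh_index:
  assumes \<tau>: "distributed M lborel \<tau> (exponential_density l)" and l: "0 < l"
    and pos: "\<And>\<omega>. \<omega> \<in> space M \<Longrightarrow> 0 \<le> \<tau> \<omega>"
  shows "prob {\<omega> \<in> space M. mesh_index m (\<tau> \<omega>) = Suc n} =
    (1 - exp (- l / real (Suc m))) * exp (- l / real (Suc m)) ^ n"
proof -
  have [measurable]: "random_variable borel \<tau>"
    using distributed_measurable[OF \<tau>] by simp
  let ?h = "\<lambda>n. real n / real (Suc m)"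
  have atom: "AE \<omega> in M. \<tau> \<omega> \<noteq> a" for a
  proof -
    have "AE x in lborel. 0 < ennreal (exponential_density l x) \<longrightarrow> x \<noteq> a"
      using AE_lborel_singleton[of a] by eventually_elim auto
    then show ?thesis
      by (subst distributed_AE2[OF \<tau>]) auto
  qed
  have tail: "prob {\<omega> \<in> space M. ?h n \<le> \<tau> \<omega>} = exp (- l / real (Suc m)) ^ n" for n
  proof -
    have "prob {\<omega> \<in> space M. ?h n \<le> \<tau> \<omega>} = \<P>(\<omega> in M. ?h n < \<tau> \<omega>)"
      by (rule finite_measure_eq_AE) (use atom[of "?h n"] in \<open>auto elim!: eventually_mono\<close>)
    also have "\<dots> = exp (- ?h n * l)"
      by (rule exponential_distributedD_gt[OF \<tau> _ l]) simp
    also have "\<dots> = exp (- l / real (Suc m)) ^ n"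
      by (simp add: exp_of_nat_mult[symmetric] mult_ac)
    finally show ?thesis .
  qed
  have "{\<omega> \<in> space M. mesh_index m (\<tau> \<omega>) = Suc n} =
      {\<omega> \<in> space M. ?h n \<le> \<tau> \<omega>} - {\<omega> \<in> space M. ?h (Suc n) \<le> \<tau> \<omega>}"
  proof -
    have "mesh_index m t = Suc n \<longleftrightarrow> ?h n \<le> t \<and> \<not> ?h (Suc n) \<le> t" if "0 \<le> t" for t
    proof -
      have "mesh_index m t = Suc n \<longleftrightarrow> \<lfloor>t * real (Suc m)\<rfloor> = int n"
      proof -
        have "0 \<le> \<lfloor>t * real (Suc m)\<rfloor>" using that by simp
        then show ?thesis unfolding mesh_index_def by auto
      qed
      also have "\<dots> \<longleftrightarrow> real n \<le> t * real (Suc m) \<and> t * real (Suc m) < real (Suc n)"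
        by (simp add: floor_eq_iff del: of_nat_Suc) (simp add: add.commute)
      also have "\<dots> \<longleftrightarrow> ?h n \<le> t \<and> \<not> ?h (Suc n) \<le> t"
        by (simp add: divide_le_eq not_le del: of_nat_Suc)
      finally show ?thesis .
    qed
    then show ?thesis using pos by auto
  qed
  also have "prob \<dots> = prob {\<omega> \<in> space M. ?h n \<le> \<tau> \<omega>} - prob {\<omega> \<in> space M. ?h (Suc n) \<le> \<tau> \<omega>}"
  proof (rule finite_measure_Diff)
    show "{\<omega> \<in> space M. ?h (Suc n) \<le> \<tau> \<omega>} \<subseteq> {\<omega> \<in> space M. ?h n \<le> \<tau> \<omega>}"
      using divide_right_mono[of "real n" "real (Suc n)" "real (Suc m)"] by (auto intro: order_trans)
  qed measurable
  finally show ?thesis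
    unfolding tail by (simp add: algebra_simps)
qed

text \<open>
  The index \<open>mesh_index m (\<tau> \<omega>)\<close> is one plus a geometric variable. The geometric weights in the sum
  belong to the variable itself, which changes the expectation at \<open>\<tau>\<close> only by the factor \<open>p\<close> and by the
  term of index 0 with weight \<open>1 - p\<close>; both corrections vanish since \<open>p\<close> tends to 1. The double
  integral on the right is an expectation over a copy of \<open>\<tau>\<close> independent of the family \<open>\<Psi>\<close>.
\<close>
lemma geometric_mesh_limit:
  fixes \<Phi> :: "nat \<Rightarrow> nat \<Rightarrow> 'a \<Rightarrow> real"
  assumes \<tau>: "distributed M lborel \<tau> (exponential_density l)" and l: "0 < l"
    and pos: "\<And>\<omega>. \<omega> \<in> space M \<Longrightarrow> 0 \<le> \<tau> \<omega>"
    and meas [measurable]: "\<And>m n. random_variable borel (\<Phi> m n)"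
    and bounds: "\<And>m n \<omega>. 0 \<le> \<Phi> m n \<omega> \<and> \<Phi> m n \<omega> \<le> 1"
    and lim: "\<And>t \<omega>. 0 \<le> t \<Longrightarrow> \<omega> \<in> space M \<Longrightarrow> (\<lambda>m. \<Phi> m (mesh_index m t) \<omega>) \<longlonglongrightarrow> \<Psi> t \<omega>"
  shows "(\<lambda>m. \<Sum>n. (1 - exp (- l / real (Suc m))) * exp (- l / real (Suc m)) ^ n * (\<integral>\<omega>. \<Phi> m n \<omega> \<partial>M))
    \<longlonglongrightarrow> (\<integral>\<omega>'. \<integral>\<omega>. \<Psi> (\<tau> \<omega>') \<omega> \<partial>M \<partial>M)"
proof -
  define p where "p m = exp (- l / real (Suc m))" for m
  define c where "c m n = (\<integral>\<omega>. \<Phi> m n \<omega> \<partial>M)" for m n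
  have [measurable]: "random_variable borel \<tau>"
    using distributed_measurable[OF \<tau>] by simp
  have c: "\<bar>c m n\<bar> \<le> 1" for m n
  proof -
    have "integrable M (\<Phi> m n)"
      using bounds by (intro integrable_const_bound[where B = 1]) auto
    then have "c m n \<le> (\<integral>\<omega>. 1 \<partial>M)"
      unfolding c_def using bounds by (intro integral_mono) auto
    moreover have "0 \<le> c m n"
      unfolding c_def using bounds by (intro integral_nonneg_AE) auto
    ultimately show ?thesis by (simp add: prob_space)
  qed
  have sum: "(\<Sum>n. (1 - p m) * p m ^ n * c m n) =
      p m * (\<integral>\<omega>. c m (mesh_index m (\<tau> \<omega>)) \<partial>M) + (1 - p m) * c m 0" for m
  proof -
    have "(\<lambda>n. prob {\<omega> \<in> space M. mesh_index m (\<tau> \<omega>) = n} * c m n) sums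
        (\<integral>\<omega>. c m (mesh_index m (\<tau> \<omega>)) \<partial>M)"
      by (rule expectation_sums_countable) (use c in auto)
    moreover have "prob {\<omega> \<in> space M. mesh_index m (\<tau> \<omega>) = 0} = 0"
      by (simp add: mesh_index_def)
    ultimately have "(\<lambda>n. prob {\<omega> \<in> space M. mesh_index m (\<tau> \<omega>) = n} * c m n) sums
        ((\<integral>\<omega>. c m (mesh_index m (\<tau> \<omega>)) \<partial>M) + prob {\<omega> \<in> space M. mesh_index m (\<tau> \<omega>) = 0} * c m 0)"
      by (simp only: mult_zero_left add_0_right)
    then have "(\<lambda>n. prob {\<omega> \<in> space M. mesh_index m (\<tau> \<omega>) = Suc n} * c m (Suc n)) sums
        (\<integral>\<omega>. c m (mesh_index m (\<tau> \<omega>)) \<partial>M)"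
      by (rule iffD2[OF sums_Suc_iff])
    moreover have "prob {\<omega> \<in> space M. mesh_index m (\<tau> \<omega>) = Suc n} = (1 - p m) * p m ^ n" for n
      unfolding p_def by (rule exponential_mesh_index[OF \<tau> l]) (rule pos)
    ultimately have "(\<lambda>n. (1 - p m) * p m ^ n * c m (Suc n)) sums (\<integral>\<omega>. c m (mesh_index m (\<tau> \<omega>)) \<partial>M)"
      by simp
    from sums_mult[OF this, of "p m"]
    have "(\<lambda>n. (1 - p m) * p m ^ Suc n * c m (Suc n)) sums (p m * (\<integral>\<omega>. c m (mesh_index m (\<tau> \<omega>)) \<partial>M))"
      by (simp add: mult_ac)
    from sums_Suc[OF this] show ?thesis
      by (simp add: sums_iff)
  qed
  have inner: "(\<lambda>m. c m (mesh_index m t)) \<longlonglongrightarrow> (\<integral>\<omega>. \<Psi> t \<omega> \<partial>M)" if t: "0 \<le> t" for t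
    unfolding c_def
  proof (rule integral_dominated_convergence[where w = "\<lambda>_. 1"])
    show "\<Psi> t \<in> borel_measurable M"
      by (rule borel_measurable_LIMSEQ_real[OF lim[OF t]]) auto
  qed (use bounds lim[OF t] in auto)
  have cm: "(\<lambda>\<omega>'. c m (mesh_index m (\<tau> \<omega>'))) \<in> borel_measurable M" for m
    by measurable
  have outer: "(\<lambda>m. \<integral>\<omega>'. c m (mesh_index m (\<tau> \<omega>')) \<partial>M) \<longlonglongrightarrow> (\<integral>\<omega>'. \<integral>\<omega>. \<Psi> (\<tau> \<omega>') \<omega> \<partial>M \<partial>M)"
  proof (rule integral_dominated_convergence[where w = "\<lambda>_. 1"])
    show "(\<lambda>\<omega>'. \<integral>\<omega>. \<Psi> (\<tau> \<omega>') \<omega> \<partial>M) \<in> borel_measurable M"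
      by (rule borel_measurable_LIMSEQ_real[OF inner[OF pos] cm])
  qed (use c inner[OF pos] cm in auto)
  have p: "p \<longlonglongrightarrow> 1"
  proof -
    have "(\<lambda>m. exp (- l / real (Suc m))) \<longlonglongrightarrow> exp 0"
      by (intro tendsto_exp mesh_tendsto_0)
    then show ?thesis by (simp add: p_def[abs_def])
  qed
  have "(\<lambda>m. (1 - p m) * c m 0) \<longlonglongrightarrow> 0"
  proof (rule Lim_null_comparison)
    show "\<forall>\<^sub>F m in sequentially. norm ((1 - p m) * c m 0) \<le> \<bar>1 - p m\<bar>"
      using c by (intro always_eventually allI) (auto simp: abs_mult intro!: mult_left_le)
    show "(\<lambda>m. \<bar>1 - p m\<bar>) \<longlonglongrightarrow> 0"
      using tendsto_rabs[OF tendsto_diff[OF tendsto_const p, of 1]] by simp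
  qed
  from tendsto_add[OF tendsto_mult[OF p outer] this] show ?thesis
    unfolding sum[symmetric] unfolding p_def c_def by simp
qed

end

context levy_process
begin

text \<open>
  The continuous-time form of \<open>geometric_factorization\<close>, as the limit along refining meshes. The
  double integrals express that the time is independent of the process.
\<close>
theorem exponential_wiener_hopf:
  fixes f g :: "real \<Rightarrow> real"
  assumes \<tau>: "distributed M lborel \<tau> (exponential_density l)" and l: "0 < l"
    and pos: "\<And>\<omega>. \<omega> \<in> space M \<Longrightarrow> 0 \<le> \<tau> \<omega>"
    and f: "continuous_on UNIV f" "\<And>x. 0 \<le> f x \<and> f x \<le> 1"
    and g: "continuous_on UNIV g" "\<And>x. 0 \<le> g x \<and> g x \<le> 1"
  shows "(\<integral>\<omega>'. \<integral>\<omega>. f (fst (block (\<lambda>t. X t \<omega>) 0 (\<tau> \<omega>'))) *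
        g (snd (block (\<lambda>t. X t \<omega>) 0 (\<tau> \<omega>')) - fst (block (\<lambda>t. X t \<omega>) 0 (\<tau> \<omega>'))) \<partial>M \<partial>M) =
    (\<integral>\<omega>'. \<integral>\<omega>. f (fst (block (\<lambda>t. X t \<omega>) 0 (\<tau> \<omega>'))) \<partial>M \<partial>M) *
    (\<integral>\<omega>'. \<integral>\<omega>. g ((SUP q\<in>{0..\<tau> \<omega>'}. X q \<omega>) - X 0 \<omega>) \<partial>M \<partial>M)"
proof -
  define \<xi> where "\<xi> m i \<omega> = X (real (Suc i) / real (Suc m)) \<omega> - X (real i / real (Suc m)) \<omega>" for m i \<omega>
  define p where "p m = exp (- l / real (Suc m))" for m
  have p: "0 \<le> p m" "p m < 1" for m using l by (auto simp: p_def)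
  have [measurable]: "f \<in> borel_measurable borel" "g \<in> borel_measurable borel"
    using f(1) g(1) by (auto intro: borel_measurable_continuous_onI)
  have [measurable]: "random_variable borel (\<xi> m i)" for m i
    unfolding \<xi>_def by (intro borel_measurable_diff measurable_process) auto
  have [measurable]: "random_variable borel (\<lambda>\<omega>. walk_min (\<lambda>i. \<xi> m i \<omega>) n)"
    "random_variable borel (\<lambda>\<omega>. walk_max (\<lambda>i. \<xi> m i \<omega>) n)" for m n
    unfolding walk_min_def walk_max_def by measurable
  have sum_\<xi>: "(\<Sum>i<n. \<xi> m i \<omega>) = X (real n / real (Suc m)) \<omega> - X 0 \<omega>" for m n \<omega>
    unfolding \<xi>_def using sum_lessThan_telescope[of "\<lambda>j. X (real j / real (Suc m)) \<omega>" n] by simp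
  have min_\<xi>: "walk_min (\<lambda>i. \<xi> m i \<omega>) n = Min ((\<lambda>j. X (real j / real (Suc m)) \<omega>) ` {0..n}) - X 0 \<omega>" for m n \<omega>
    unfolding \<xi>_def using walk_min_increments[of "\<lambda>j. X (real j / real (Suc m)) \<omega>" n]
    by (simp add: atLeast0AtMost)
  have max_\<xi>: "walk_max (\<lambda>i. \<xi> m i \<omega>) n = - Min ((\<lambda>j. - X (real j / real (Suc m)) \<omega>) ` {0..n}) - X 0 \<omega>" for m n \<omega>
    unfolding \<xi>_def using walk_max_increments[of "\<lambda>j. X (real j / real (Suc m)) \<omega>" n]
    by (simp add: atLeast0AtMost)
  have sum_lim: "(\<lambda>m. \<Sum>i<mesh_index m t. \<xi> m i \<omega>) \<longlonglongrightarrow> snd (block (\<lambda>t. X t \<omega>) 0 t)"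
    if "0 \<le> t" "\<omega> \<in> space M" for t \<omega>
    unfolding sum_\<xi> block_def snd_conv
    using that by (intro tendsto_diff tendsto_const mesh_tendsto_at_right cadlag_paths)
  have min_lim: "(\<lambda>m. walk_min (\<lambda>i. \<xi> m i \<omega>) (mesh_index m t)) \<longlonglongrightarrow> fst (block (\<lambda>t. X t \<omega>) 0 t)"
    if "0 \<le> t" "\<omega> \<in> space M" for t \<omega>
    unfolding min_\<xi> block_def fst_conv
    using that by (intro tendsto_diff tendsto_const Min_mesh_tendsto_INF cadlag_paths) auto
  have max_lim: "(\<lambda>m. walk_max (\<lambda>i. \<xi> m i \<omega>) (mesh_index m t)) \<longlonglongrightarrow> (SUP q\<in>{0..t}. X q \<omega>) - X 0 \<omega>"
    if "0 \<le> t" "\<omega> \<in> space M" for t \<omega>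
    unfolding max_\<xi> SUP_eq_minus_INF
    using that by (intro tendsto_diff tendsto_minus tendsto_const Min_mesh_tendsto_INF cadlag_uminus cadlag_paths) auto
  note continuous_tendsto = continuous_on_tendsto_compose[OF f(1)] continuous_on_tendsto_compose[OF g(1)]
  have joint: "(\<lambda>m. \<Sum>n. (1 - p m) * p m ^ n *
      (\<integral>\<omega>. f (walk_min (\<lambda>i. \<xi> m i \<omega>) n) * g ((\<Sum>i<n. \<xi> m i \<omega>) - walk_min (\<lambda>i. \<xi> m i \<omega>) n) \<partial>M))
    \<longlonglongrightarrow> (\<integral>\<omega>'. \<integral>\<omega>. f (fst (block (\<lambda>t. X t \<omega>) 0 (\<tau> \<omega>'))) *
        g (snd (block (\<lambda>t. X t \<omega>) 0 (\<tau> \<omega>')) - fst (block (\<lambda>t. X t \<omega>) 0 (\<tau> \<omega>'))) \<partial>M \<partial>M)"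
    unfolding p_def using f(2) g(2)
    by (intro geometric_mesh_limit[OF \<tau> l pos] tendsto_mult continuous_tendsto tendsto_diff min_lim sum_lim)
      (auto intro: mult_le_one)
  have min: "(\<lambda>m. \<Sum>n. (1 - p m) * p m ^ n * (\<integral>\<omega>. f (walk_min (\<lambda>i. \<xi> m i \<omega>) n) \<partial>M))
    \<longlonglongrightarrow> (\<integral>\<omega>'. \<integral>\<omega>. f (fst (block (\<lambda>t. X t \<omega>) 0 (\<tau> \<omega>'))) \<partial>M \<partial>M)"
    unfolding p_def using f(2)
    by (intro geometric_mesh_limit[OF \<tau> l pos] continuous_tendsto min_lim) auto
  have max: "(\<lambda>m. \<Sum>n. (1 - p m) * p m ^ n * (\<integral>\<omega>. g (walk_max (\<lambda>i. \<xi> m i \<omega>) n) \<partial>M))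
    \<longlonglongrightarrow> (\<integral>\<omega>'. \<integral>\<omega>. g ((SUP q\<in>{0..\<tau> \<omega>'}. X q \<omega>) - X 0 \<omega>) \<partial>M \<partial>M)"
    unfolding p_def using g(2)
    by (intro geometric_mesh_limit[OF \<tau> l pos] continuous_tendsto max_lim) auto
  have product: "(\<Sum>n. (1 - p m) * p m ^ n *
      (\<integral>\<omega>. f (walk_min (\<lambda>i. \<xi> m i \<omega>) n) * g ((\<Sum>i<n. \<xi> m i \<omega>) - walk_min (\<lambda>i. \<xi> m i \<omega>) n) \<partial>M)) =
    (\<Sum>n. (1 - p m) * p m ^ n * (\<integral>\<omega>. f (walk_min (\<lambda>i. \<xi> m i \<omega>) n) \<partial>M)) *
    (\<Sum>n. (1 - p m) * p m ^ n * (\<integral>\<omega>. g (walk_max (\<lambda>i. \<xi> m i \<omega>) n) \<partial>M))" for m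
  proof -
    interpret iid_steps M "\<xi> m"
      unfolding \<xi>_def by (rule iid_mesh_increments)
    show ?thesis
      by (rule geometric_factorization) (use f(2) g(2) p in auto)
  qed
  show ?thesis
    by (rule LIMSEQ_unique[OF joint[unfolded product] tendsto_mult[OF min max]])
qed

end

section \<open>Path segments between Poisson epochs\<close>

locale observed_levy_process = levy_process M X + poisson_epochs M l T
  for M :: "'a measure" and X l T +
  assumes independent: "indep_set (sigma_process M X) (sigma_epochs M T)"
begin

text \<open>
  The sample space itself, with the sigma-algebra of the path, serves as the space of paths, because
  the cadlag functions do not form a measurable subset of the full product space.
\<close>
definition path_algebra :: "'a measure" where
  "path_algebra = vimage_algebra (space M) (\<lambda>\<omega>. \<lambda>t\<in>{0..}. X t \<omega>) (PiM {0..} (\<lambda>_. borel))"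

definition epoch_block :: "nat \<Rightarrow> 'a \<Rightarrow> real \<times> real" where
  "epoch_block k \<omega> = block (\<lambda>t. X t \<omega>) (T k \<omega>) (T (Suc k) \<omega>)"

lemmas [measurable] = measurable_epoch

lemma space_path_algebra [simp]: "space path_algebra = space M"
  by (simp add: path_algebra_def)

lemma path_algebra_measurable:
  assumes t: "0 \<le> t"
  shows "X t \<in> borel_measurable path_algebra"
proof -
  have "(\<lambda>\<omega>. \<lambda>t\<in>{0..}. X t \<omega>) \<in> path_algebra \<rightarrow>\<^sub>M PiM {0..} (\<lambda>_. borel)"
    unfolding path_algebra_def by (rule measurable_vimage_algebra1) (auto simp: space_PiM)
  from measurable_compose[OF this measurable_component_singleton[of t]] show ?thesis
    using t by simp
qed

lemma path_algebra_cadlag: "\<omega> \<in> space path_algebra \<Longrightarrow> cadlag (\<lambda>t. X t \<omega>)"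
  by (simp add: cadlag_paths)

lemma epochs_nonneg: "\<omega> \<in> space M \<Longrightarrow> 0 \<le> T k \<omega>"
proof (induction k)
  case (Suc k)
  then show ?case using epochs_increasing[of \<omega> k] by linarith
qed (simp add: epoch_0)

text \<open>
  Conditioning on the epochs: by independence they can be replaced by a copy living on a second
  coordinate of the sample space.
\<close>
lemma expectation_at_epochs:
  fixes H :: "'a \<times> (nat \<Rightarrow> real) \<Rightarrow> real"
  assumes H: "H \<in> borel_measurable (path_algebra \<Otimes>\<^sub>M PiM UNIV (\<lambda>_. borel))" and bound: "\<And>z. \<bar>H z\<bar> \<le> B"
  shows "(\<integral>\<omega>. H (\<omega>, \<lambda>n. T n \<omega>) \<partial>M) = (\<integral>\<omega>'. \<integral>\<omega>. H (\<omega>, \<lambda>n. T n \<omega>') \<partial>M \<partial>M)"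
proof (rule independent_expectation(2)[OF _ _ _ H bound])
  have path: "sigma_process M X = sets path_algebra"
    by (simp add: sigma_process_def generated_def path_algebra_def)
  have indep: "prob (A \<inter> C) = prob A * prob C" if "A \<in> sets path_algebra" "C \<in> sigma_epochs M T" for A C
    using independent that unfolding path by (simp add: indep_sets2_eq)
  have sub: "sets path_algebra \<subseteq> events"
    using independent unfolding path by (simp add: indep_sets2_eq)
  have ident: "(\<lambda>\<omega>. \<omega>) -` A \<inter> space M = A" if "A \<in> sets path_algebra" for A
    using sets.sets_into_space[OF that] by auto
  show "(\<lambda>\<omega>. \<omega>) \<in> M \<rightarrow>\<^sub>M path_algebra"
    using sub by (intro measurableI) (auto simp: ident)
  show "(\<lambda>\<omega> n. T n \<omega>) \<in> M \<rightarrow>\<^sub>M PiM UNIV (\<lambda>_. borel)"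
    by (rule measurable_abs_UNIV) measurable
  show "prob (((\<lambda>\<omega>. \<omega>) -` A \<inter> space M) \<inter> ((\<lambda>\<omega> n. T n \<omega>) -` C \<inter> space M)) =
      prob ((\<lambda>\<omega>. \<omega>) -` A \<inter> space M) * prob ((\<lambda>\<omega> n. T n \<omega>) -` C \<inter> space M)"
    if A: "A \<in> sets path_algebra" and C: "C \<in> sets (PiM UNIV (\<lambda>_. borel))" for A C
  proof -
    have "(\<lambda>\<omega> n. T n \<omega>) -` C \<inter> space M \<in> sigma_epochs M T"
      unfolding sigma_epochs_def generated_def by (rule in_vimage_algebra[OF C])
    from indep[OF A this] show ?thesis unfolding ident[OF A] .
  qed
qed

lemma interarrival_expectation:
  assumes [measurable]: "F \<in> borel_measurable borel"
  shows "(\<integral>\<omega>. F (T (Suc k) \<omega> - T k \<omega>) \<partial>M) = (\<integral>\<omega>. F (T (Suc 0) \<omega> - T 0 \<omega>) \<partial>M :: real)"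
proof -
  have "(\<integral>\<omega>. F (T (Suc k) \<omega> - T k \<omega>) \<partial>M) = (\<integral>t. F t \<partial>density lborel (exponential_density l))" for k
    unfolding distributed_distr_eq_density[OF interarrival_exponential[of k], symmetric]
    by (rule integral_distr[symmetric]) measurable
  then show ?thesis by simp
qed

lemma measurable_epoch_block [measurable]: "epoch_block k \<in> M \<rightarrow>\<^sub>M borel \<Otimes>\<^sub>M borel"
proof -
  have "(\<lambda>\<omega>. (\<omega>, T k \<omega>, T (Suc k) \<omega> - T k \<omega>)) \<in> M \<rightarrow>\<^sub>M M \<Otimes>\<^sub>M borel \<Otimes>\<^sub>M borel" by measurable
  from measurable_compose[OF this measurable_block[OF measurable_process cadlag_paths]]
  have "(\<lambda>\<omega>. block (\<lambda>t. X t \<omega>) \<bar>T k \<omega>\<bar> (\<bar>T k \<omega>\<bar> + \<bar>T (Suc k) \<omega> - T k \<omega>\<bar>)) \<in> M \<rightarrow>\<^sub>M borel \<Otimes>\<^sub>M borel"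
    by simp
  moreover have "block (\<lambda>t. X t \<omega>) \<bar>T k \<omega>\<bar> (\<bar>T k \<omega>\<bar> + \<bar>T (Suc k) \<omega> - T k \<omega>\<bar>) = epoch_block k \<omega>"
    if "\<omega> \<in> space M" for \<omega>
    using epochs_nonneg[OF that, of k] epochs_increasing[OF that, of k] by (simp add: epoch_block_def)
  ultimately show ?thesis by (simp cong: measurable_cong)
qed

lemma measurable_block_at:
  assumes [measurable]: "a \<in> borel_measurable (PiM UNIV (\<lambda>_::nat. borel :: real measure))"
    "s \<in> borel_measurable (PiM UNIV (\<lambda>_::nat. borel :: real measure))"
  shows "(\<lambda>z. block (\<lambda>t. X t (fst z)) \<bar>a (snd z)\<bar> (\<bar>a (snd z)\<bar> + \<bar>s (snd z)\<bar>))
    \<in> path_algebra \<Otimes>\<^sub>M PiM UNIV (\<lambda>_. borel) \<rightarrow>\<^sub>M borel \<Otimes>\<^sub>M borel"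
proof -
  have "(\<lambda>z. (fst z, a (snd z), s (snd z)))
      \<in> path_algebra \<Otimes>\<^sub>M PiM UNIV (\<lambda>_. borel) \<rightarrow>\<^sub>M path_algebra \<Otimes>\<^sub>M borel \<Otimes>\<^sub>M borel"
    by measurable
  from measurable_compose[OF this measurable_block[OF path_algebra_measurable path_algebra_cadlag]]
  show ?thesis by simp
qed

text \<open>
  Given the epochs, the segments are independent and their laws depend on the inter-arrival times
  only (\<open>block_independent\<close>, \<open>block_stationary\<close>). Integrating over the independent, identically distributed
  inter-arrival times gives a product of equal-law factors.
\<close>
lemma epoch_blocks_joint:
  assumes J: "finite J" and C: "\<And>j. j \<in> J \<Longrightarrow> C j \<in> sets (borel \<Otimes>\<^sub>M borel)"
  shows "(\<integral>\<omega>. (\<Prod>j\<in>J. indicator (C j) (epoch_block j \<omega>)) \<partial>M) =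
    (\<Prod>j\<in>J. \<integral>\<omega>'. \<integral>\<omega>. indicator (C j) (block (\<lambda>t. X t \<omega>) 0 \<bar>T (Suc 0) \<omega>' - T 0 \<omega>'\<bar>) \<partial>M \<partial>M :: real)"
proof -
  have ind [measurable]: "(indicator (C j) :: _ \<Rightarrow> real) \<in> borel_measurable (borel \<Otimes>\<^sub>M borel)" if "j \<in> J" for j
    using C[OF that] by simp
  define K where "K j s = (\<integral>\<omega>. indicator (C j) (block (\<lambda>t. X t \<omega>) 0 \<bar>s\<bar>) \<partial>M :: real)" for j and s :: real
  have K_meas [measurable]: "K j \<in> borel_measurable borel" if "j \<in> J" for j
    unfolding K_def by (rule measurable_block_expectation[OF ind[OF that]])
  have K_bound: "\<bar>K j s\<bar> \<le> 1" for j s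
  proof -
    have "\<bar>K j s\<bar> \<le> (\<integral>\<omega>. \<bar>indicator (C j) (block (\<lambda>t. X t \<omega>) 0 \<bar>s\<bar>)\<bar> \<partial>M)"
      unfolding K_def by (rule integral_abs_bound)
    also have "\<dots> \<le> (\<integral>\<omega>. 1 \<partial>M)"
      by (rule Bochner_Integration.integral_mono') (auto simp: indicator_def)
    finally show ?thesis by (simp add: prob_space)
  qed
  define H where "H z = (\<Prod>j\<in>J. indicator (C j)
      (block (\<lambda>t. X t (fst z)) \<bar>snd z j\<bar> (\<bar>snd z j\<bar> + \<bar>snd z (Suc j) - snd z j\<bar>)) :: real)"
    for z :: "'a \<times> (nat \<Rightarrow> real)"
  have H_meas: "H \<in> borel_measurable (path_algebra \<Otimes>\<^sub>M PiM UNIV (\<lambda>_. borel))"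
    unfolding H_def
    by (intro borel_measurable_prod measurable_compose[OF _ ind]
        measurable_block_at[where a = "\<lambda>x. x _" and s = "\<lambda>x. x _ - x _"]) measurable
  have H_bound: "\<bar>H z\<bar> \<le> 1" for z
    unfolding H_def by (auto simp: abs_prod intro!: prod_le_1)
  have H_eq: "H (\<omega>, \<lambda>n. T n \<omega>') =
      (\<Prod>j\<in>J. indicator (C j) (block (\<lambda>t. X t \<omega>) (T j \<omega>') (T (Suc j) \<omega>')))"
    if "\<omega>' \<in> space M" for \<omega> \<omega>'
    unfolding H_def fst_conv snd_conv using epochs_nonneg[OF that] epochs_increasing[OF that]
    by (intro prod.cong refl) (simp add: less_imp_le)
  have inner: "(\<integral>\<omega>. H (\<omega>, \<lambda>n. T n \<omega>') \<partial>M) = (\<Prod>j\<in>J. K j (T (Suc j) \<omega>' - T j \<omega>'))"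
    if \<omega>': "\<omega>' \<in> space M" for \<omega>'
  proof -
    have le: "T j \<omega>' \<le> T (Suc j) \<omega>'" for j
      using epochs_increasing[OF \<omega>'] by (rule less_imp_le)
    have blocks: "indep_vars (\<lambda>_. borel \<Otimes>\<^sub>M borel) (\<lambda>j \<omega>. block (\<lambda>t. X t \<omega>) (T j \<omega>') (T (Suc j) \<omega>')) J"
      using indep_vars_subset[OF block_independent[of "\<lambda>j. T j \<omega>'"] subset_UNIV[of J]]
        epochs_nonneg[OF \<omega>'] le by simp
    have "(\<integral>\<omega>. (\<Prod>j\<in>J. indicator (C j) (block (\<lambda>t. X t \<omega>) (T j \<omega>') (T (Suc j) \<omega>'))) \<partial>M) =
        (\<Prod>j\<in>J. \<integral>\<omega>. indicator (C j) (block (\<lambda>t. X t \<omega>) (T j \<omega>') (T (Suc j) \<omega>')) \<partial>M :: real)"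
    proof (rule indep_vars_lebesgue_integral[OF J])
      show "indep_vars (\<lambda>_. borel) (\<lambda>j \<omega>. indicator (C j) (block (\<lambda>t. X t \<omega>) (T j \<omega>') (T (Suc j) \<omega>')) :: real) J"
        by (rule indep_vars_compose2[OF blocks ind])
      show "integrable M (\<lambda>\<omega>. indicator (C j) (block (\<lambda>t. X t \<omega>) (T j \<omega>') (T (Suc j) \<omega>')) :: real)"
        if "j \<in> J" for j
        using measurable_compose[OF measurable_block_fixed[OF epochs_nonneg[OF \<omega>'] le] ind[OF that]]
        by (intro integrable_const_bound[where B = 1]) auto
    qed
    also have "\<dots> = (\<Prod>j\<in>J. K j (T (Suc j) \<omega>' - T j \<omega>'))"
      unfolding K_def using le
      by (intro prod.cong refl) (simp add: block_stationary_expectation[OF ind epochs_nonneg[OF \<omega>'] le])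
    finally show ?thesis by (simp add: H_eq[OF \<omega>'])
  qed
  have "(\<integral>\<omega>. (\<Prod>j\<in>J. indicator (C j) (epoch_block j \<omega>)) \<partial>M) = (\<integral>\<omega>. H (\<omega>, \<lambda>n. T n \<omega>) \<partial>M)"
    by (intro Bochner_Integration.integral_cong refl) (simp add: H_eq epoch_block_def)
  also have "\<dots> = (\<integral>\<omega>'. \<integral>\<omega>. H (\<omega>, \<lambda>n. T n \<omega>') \<partial>M \<partial>M)"
    by (rule expectation_at_epochs[OF H_meas H_bound])
  also have "\<dots> = (\<integral>\<omega>'. (\<Prod>j\<in>J. K j (T (Suc j) \<omega>' - T j \<omega>')) \<partial>M)"
    by (intro Bochner_Integration.integral_cong refl inner)
  also have "\<dots> = (\<Prod>j\<in>J. \<integral>\<omega>'. K j (T (Suc j) \<omega>' - T j \<omega>') \<partial>M)"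
  proof (rule indep_vars_lebesgue_integral[OF J])
    show "indep_vars (\<lambda>_. borel) (\<lambda>j \<omega>'. K j (T (Suc j) \<omega>' - T j \<omega>')) J"
      by (rule indep_vars_compose2[OF indep_vars_subset[OF interarrival_indep subset_UNIV] K_meas])
    show "integrable M (\<lambda>\<omega>'. K j (T (Suc j) \<omega>' - T j \<omega>'))" if "j \<in> J" for j
      using K_bound that by (intro integrable_const_bound[where B = 1]) auto
  qed
  also have "\<dots> = (\<Prod>j\<in>J. \<integral>\<omega>'. K j (T (Suc 0) \<omega>' - T 0 \<omega>') \<partial>M)"
    by (intro prod.cong refl interarrival_expectation K_meas)
  finally show ?thesis unfolding K_def .
qed

lemma epoch_block_expectation_indicator:
  assumes "C \<in> sets (borel \<Otimes>\<^sub>M borel)"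
  shows "(\<integral>\<omega>. indicator C (epoch_block k \<omega>) \<partial>M) =
    (\<integral>\<omega>'. \<integral>\<omega>. indicator C (block (\<lambda>t. X t \<omega>) 0 \<bar>T (Suc 0) \<omega>' - T 0 \<omega>'\<bar>) \<partial>M \<partial>M :: real)"
  using epoch_blocks_joint[of "{k}" "\<lambda>_. C"] assms by simp

lemma epoch_blocks_independent: "indep_vars (\<lambda>_. borel \<Otimes>\<^sub>M borel) epoch_block UNIV"
  unfolding indep_vars_def2
proof (intro conjI ballI measurable_epoch_block indep_setsI)
  fix i show "{epoch_block i -` A \<inter> space M |A. A \<in> sets (borel \<Otimes>\<^sub>M borel)} \<subseteq> events"
    by auto
next
  fix A J assume J: "J \<noteq> {}" "finite J"
    and "\<forall>j\<in>J. A j \<in> {epoch_block j -` A \<inter> space M |A. A \<in> sets (borel \<Otimes>\<^sub>M borel)}"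
  then have "\<forall>j\<in>J. \<exists>C. C \<in> sets (borel \<Otimes>\<^sub>M borel) \<and> A j = epoch_block j -` C \<inter> space M"
    by blast
  then obtain C where C: "\<And>j. j \<in> J \<Longrightarrow> C j \<in> sets (borel \<Otimes>\<^sub>M borel)"
    "\<And>j. j \<in> J \<Longrightarrow> A j = epoch_block j -` C j \<inter> space M"
    by (metis (no_types) bchoice)
  have sub: "(\<Inter>j\<in>J. A j) \<subseteq> space M" using J C(2) by blast
  have "prob (\<Inter>j\<in>J. A j) = (\<integral>\<omega>. indicator (\<Inter>j\<in>J. A j) \<omega> \<partial>M)"
    using sub by (simp add: Int_absorb2)
  also have "\<dots> = (\<integral>\<omega>. (\<Prod>j\<in>J. indicator (C j) (epoch_block j \<omega>)) \<partial>M)"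
    using J C(2) by (intro Bochner_Integration.integral_cong refl) (auto simp: indicator_def)
  also have "\<dots> = (\<Prod>j\<in>J. \<integral>\<omega>. indicator (C j) (epoch_block j \<omega>) \<partial>M)"
    by (subst epoch_blocks_joint[OF J(2)], rule C(1), assumption, intro prod.cong refl)
      (simp add: epoch_block_expectation_indicator[OF C(1)])
  also have "\<dots> = (\<Prod>j\<in>J. prob (A j))"
    by (intro prod.cong refl)
      (simp add: C prob_eq_expectation_indicator[OF measurable_epoch_block])
  finally show "prob (\<Inter>j\<in>J. A j) = (\<Prod>j\<in>J. prob (A j))" .
qed

lemma epoch_block_law:
  "distr M (borel \<Otimes>\<^sub>M borel) (epoch_block k) = distr M (borel \<Otimes>\<^sub>M borel) (epoch_block 0)"
proof (rule measure_eqI)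
  fix C assume "C \<in> sets (distr M (borel \<Otimes>\<^sub>M borel) (epoch_block k))"
  then have C: "C \<in> sets (borel \<Otimes>\<^sub>M borel)" by simp
  show "emeasure (distr M (borel \<Otimes>\<^sub>M borel) (epoch_block k)) C =
      emeasure (distr M (borel \<Otimes>\<^sub>M borel) (epoch_block 0)) C"
    using C by (simp add: emeasure_distr emeasure_eq_measure epoch_block_expectation_indicator[of C]
        prob_eq_expectation_indicator[OF measurable_epoch_block])
qed simp

lemma first_block_expectation:
  fixes F :: "real \<times> real \<Rightarrow> real"
  assumes F: "F \<in> borel_measurable (borel \<Otimes>\<^sub>M borel)" and bound: "\<And>z. \<bar>F z\<bar> \<le> B"
  shows "(\<integral>\<omega>. F (epoch_block 0 \<omega>) \<partial>M) = (\<integral>\<omega>'. \<integral>\<omega>. F (block (\<lambda>t. X t \<omega>) 0 (T (Suc 0) \<omega>')) \<partial>M \<partial>M)"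
proof -
  let ?H = "\<lambda>z. F (block (\<lambda>t. X t (fst z)) \<bar>0\<bar> (\<bar>0\<bar> + \<bar>snd z (Suc 0)\<bar>))"
  have H: "?H \<in> borel_measurable (path_algebra \<Otimes>\<^sub>M PiM UNIV (\<lambda>_. borel))"
    by (intro measurable_compose[OF _ F] measurable_block_at[where a = "\<lambda>_. 0" and s = "\<lambda>x. x (Suc 0)"])
      measurable
  have "(\<integral>\<omega>. F (epoch_block 0 \<omega>) \<partial>M) = (\<integral>\<omega>. ?H (\<omega>, \<lambda>n. T n \<omega>) \<partial>M)"
    by (intro Bochner_Integration.integral_cong refl) (simp add: epoch_block_def epoch_0 epochs_nonneg)
  also have "\<dots> = (\<integral>\<omega>'. \<integral>\<omega>. ?H (\<omega>, \<lambda>n. T n \<omega>') \<partial>M \<partial>M)"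
    by (rule expectation_at_epochs[OF H bound])
  also have "\<dots> = (\<integral>\<omega>'. \<integral>\<omega>. F (block (\<lambda>t. X t \<omega>) 0 (T (Suc 0) \<omega>')) \<partial>M \<partial>M)"
    by (intro Bochner_Integration.integral_cong refl) (simp add: epochs_nonneg)
  finally show ?thesis .
qed

text \<open>
  Measured from the starting level, which is only almost surely 0.
\<close>
definition first_supremum :: "'a \<Rightarrow> real" where
  "first_supremum \<omega> = (SUP q\<in>{0..T (Suc 0) \<omega>}. X q \<omega>) - X 0 \<omega>"

lemma measurable_first_supremum [measurable]: "random_variable borel first_supremum"
proof -
  have "(\<lambda>\<omega>. (\<omega>, T (Suc 0) \<omega>)) \<in> M \<rightarrow>\<^sub>M M \<Otimes>\<^sub>M borel" by measurable
  from measurable_compose[OF this measurable_cadlag_SUP[OF measurable_process cadlag_paths]]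
  have "(\<lambda>\<omega>. (SUP q\<in>{0..\<bar>T (Suc 0) \<omega>\<bar>}. X q \<omega>) - X 0 \<omega>) \<in> borel_measurable M"
    by (intro borel_measurable_diff measurable_process) simp_all
  moreover have "(SUP q\<in>{0..\<bar>T (Suc 0) \<omega>\<bar>}. X q \<omega>) - X 0 \<omega> = first_supremum \<omega>" if "\<omega> \<in> space M" for \<omega>
    by (simp add: first_supremum_def epochs_nonneg[OF that])
  ultimately show ?thesis by (simp cong: measurable_cong)
qed

lemma first_supremum_expectation:
  fixes g :: "real \<Rightarrow> real"
  assumes g: "g \<in> borel_measurable borel" and bound: "\<And>z. \<bar>g z\<bar> \<le> B"
  shows "(\<integral>\<omega>. g (first_supremum \<omega>) \<partial>M) =
    (\<integral>\<omega>'. \<integral>\<omega>. g ((SUP q\<in>{0..T (Suc 0) \<omega>'}. X q \<omega>) - X 0 \<omega>) \<partial>M \<partial>M)"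
proof -
  let ?H = "\<lambda>z. g ((SUP q\<in>{0..\<bar>snd z (Suc 0)\<bar>}. X q (fst z)) - X 0 (fst z))"
  have "(\<lambda>z. (fst z, snd z (Suc 0))) \<in> path_algebra \<Otimes>\<^sub>M PiM UNIV (\<lambda>_::nat. borel :: real measure)
      \<rightarrow>\<^sub>M path_algebra \<Otimes>\<^sub>M borel" by measurable
  from measurable_compose[OF this measurable_cadlag_SUP[OF path_algebra_measurable path_algebra_cadlag]]
  have H: "?H \<in> borel_measurable (path_algebra \<Otimes>\<^sub>M PiM UNIV (\<lambda>_. borel))"
    by (intro measurable_compose[OF _ g] borel_measurable_diff
        measurable_compose[OF measurable_fst path_algebra_measurable]) simp_all
  have "(\<integral>\<omega>. g (first_supremum \<omega>) \<partial>M) = (\<integral>\<omega>. ?H (\<omega>, \<lambda>n. T n \<omega>) \<partial>M)"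
    by (intro Bochner_Integration.integral_cong refl) (simp add: first_supremum_def epochs_nonneg)
  also have "\<dots> = (\<integral>\<omega>'. \<integral>\<omega>. ?H (\<omega>, \<lambda>n. T n \<omega>') \<partial>M \<partial>M)"
    by (rule expectation_at_epochs[OF H bound])
  also have "\<dots> = (\<integral>\<omega>'. \<integral>\<omega>. g ((SUP q\<in>{0..T (Suc 0) \<omega>'}. X q \<omega>) - X 0 \<omega>) \<partial>M \<partial>M)"
    by (intro Bochner_Integration.integral_cong refl) (simp add: epochs_nonneg)
  finally show ?thesis .
qed

text \<open>
  The first epoch is exponential and independent of the path, so conditioning on it turns the double
  integrals of \<open>exponential_wiener_hopf\<close> into expectations at that epoch.
\<close>
theorem first_block_factorization:
  "distr M (borel \<Otimes>\<^sub>M borel) (\<lambda>\<omega>. (fst (epoch_block 0 \<omega>), snd (epoch_block 0 \<omega>) - fst (epoch_block 0 \<omega>))) =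
    distr M borel (\<lambda>\<omega>. fst (epoch_block 0 \<omega>)) \<Otimes>\<^sub>M distr M borel first_supremum"
proof (rule measure_eqI_continuous_products)
  have [measurable]: "(\<lambda>\<omega>. fst (epoch_block 0 \<omega>)) \<in> borel_measurable M" by measurable
  interpret LD: prob_space "distr M borel (\<lambda>\<omega>. fst (epoch_block 0 \<omega>))" by (rule prob_space_distr) measurable
  interpret LU: prob_space "distr M borel first_supremum" by (rule prob_space_distr) measurable
  interpret P: pair_prob_space "distr M borel (\<lambda>\<omega>. fst (epoch_block 0 \<omega>))" "distr M borel first_supremum" ..
  show "finite_measure (distr M borel (\<lambda>\<omega>. fst (epoch_block 0 \<omega>)) \<Otimes>\<^sub>M distr M borel first_supremum)"
    by unfold_locales
  fix f g :: "real \<Rightarrow> real"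
  assume f: "continuous_on UNIV f" "\<And>x. 0 \<le> f x \<and> f x \<le> 1"
    and g: "continuous_on UNIV g" "\<And>x. 0 \<le> g x \<and> g x \<le> 1"
  have [measurable]: "f \<in> borel_measurable borel" "g \<in> borel_measurable borel"
    using f(1) g(1) by (auto intro: borel_measurable_continuous_onI)
  have bounds: "\<bar>f x\<bar> \<le> 1" "\<bar>g x\<bar> \<le> 1" "\<bar>f x * g y\<bar> \<le> 1" for x y
    using f(2)[of x] g(2)[of x] g(2)[of y] by (auto simp: abs_mult intro: mult_le_one)
  have epoch: "distributed M lborel (T (Suc 0)) (exponential_density l)"
  proof -
    have "T (Suc 0) \<omega> = T (Suc 0) \<omega> - T 0 \<omega>" if "\<omega> \<in> space M" for \<omega>
      using epoch_0[OF that] by simp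
    then have "distr M lborel (T (Suc 0)) = distr M lborel (\<lambda>\<omega>. T (Suc 0) \<omega> - T 0 \<omega>)"
      by (intro distr_cong) auto
    then show ?thesis
      using interarrival_exponential[of 0] by (simp add: distributed_def)
  qed
  have "(\<integral>z. f (fst z) * g (snd z) \<partial>distr M (borel \<Otimes>\<^sub>M borel)
      (\<lambda>\<omega>. (fst (epoch_block 0 \<omega>), snd (epoch_block 0 \<omega>) - fst (epoch_block 0 \<omega>))))
    = (\<integral>\<omega>. f (fst (epoch_block 0 \<omega>)) * g (snd (epoch_block 0 \<omega>) - fst (epoch_block 0 \<omega>)) \<partial>M)"
    by (subst integral_distr) auto
  also have "\<dots> = (\<integral>\<omega>. f (fst (epoch_block 0 \<omega>)) \<partial>M) * (\<integral>\<omega>. g (first_supremum \<omega>) \<partial>M)"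
    using exponential_wiener_hopf[OF epoch intensity_pos epochs_nonneg f g]
      first_block_expectation[of "\<lambda>z. f (fst z) * g (snd z - fst z)" 1]
      first_block_expectation[of "\<lambda>z. f (fst z)" 1] first_supremum_expectation[of g 1] bounds
    by simp
  also have "\<dots> = (\<integral>x. f x \<partial>distr M borel (\<lambda>\<omega>. fst (epoch_block 0 \<omega>))) * (\<integral>y. g y \<partial>distr M borel first_supremum)"
    by (subst (1 2) integral_distr) auto
  also have "\<dots> = (\<integral>x. \<integral>y. f x * g y \<partial>distr M borel first_supremum \<partial>distr M borel (\<lambda>\<omega>. fst (epoch_block 0 \<omega>)))"
    by simp
  also have "\<dots> = (\<integral>z. f (fst z) * g (snd z) \<partial>(distr M borel (\<lambda>\<omega>. fst (epoch_block 0 \<omega>)) \<Otimes>\<^sub>M distr M borel first_supremum))"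
  proof -
    have "integrable (distr M borel (\<lambda>\<omega>. fst (epoch_block 0 \<omega>)) \<Otimes>\<^sub>M distr M borel first_supremum)
        (\<lambda>z. f (fst z) * g (snd z))"
      using bounds by (intro P.integrable_const_bound[where B = 1]) auto
    from P.integral_fst'[OF this] show ?thesis by simp
  qed
  finally show "(\<integral>z. f (fst z) * g (snd z) \<partial>distr M (borel \<Otimes>\<^sub>M borel)
      (\<lambda>\<omega>. (fst (epoch_block 0 \<omega>), snd (epoch_block 0 \<omega>) - fst (epoch_block 0 \<omega>)))) =
    (\<integral>z. f (fst z) * g (snd z) \<partial>(distr M borel (\<lambda>\<omega>. fst (epoch_block 0 \<omega>)) \<Otimes>\<^sub>M distr M borel first_supremum))" .
next
  show "finite_measure (distr M (borel \<Otimes>\<^sub>M borel)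
      (\<lambda>\<omega>. (fst (epoch_block 0 \<omega>), snd (epoch_block 0 \<omega>) - fst (epoch_block 0 \<omega>))))"
    by (rule finite_measure_distr) measurable
  show "sets (distr M borel (\<lambda>\<omega>. fst (epoch_block 0 \<omega>)) \<Otimes>\<^sub>M distr M borel first_supremum) = sets (borel \<Otimes>\<^sub>M borel)"
    by (intro sets_pair_measure_cong) auto
qed simp

end

section \<open>Killed random walks\<close>

context prob_space
begin

text \<open>
  Feynman-Kac formula for the walk with steps \<open>y (B j)\<close> and multiplicative weights \<open>w\<close>. Conditioning on
  all but the last pair replaces \<open>f\<close> by \<open>Q f\<close>, so the induction has to generalize over \<open>f\<close>.
\<close>
lemma iid_walk_expectation:
  fixes B :: "nat \<Rightarrow> 'a \<Rightarrow> 'b" and y :: "'b \<Rightarrow> real" and w :: "real \<times> 'b \<Rightarrow> real" and f :: "real \<Rightarrow> real"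
  assumes B: "indep_vars (\<lambda>_. N) B UNIV" and law: "\<And>k. distr M N (B k) = \<kappa>"
    and y [measurable]: "y \<in> borel_measurable N"
    and w [measurable]: "w \<in> borel_measurable (borel \<Otimes>\<^sub>M N)" and w_bounds: "\<And>z. 0 \<le> w z \<and> w z \<le> 1"
    and f: "f \<in> borel_measurable borel" "\<And>v. 0 \<le> f v \<and> f v \<le> 1"
    and Q: "\<And>g v. Q g v = (\<integral>b. w (v, b) * g (v + y b) \<partial>\<kappa>)"
  shows "(\<integral>\<omega>. (\<Prod>k<n. w (v + (\<Sum>j<k. y (B j \<omega>)), B k \<omega>)) * f (v + (\<Sum>j<n. y (B j \<omega>))) \<partial>M) = (Q ^^ n) f v"
  using f
proof (induction n arbitrary: f)
  case 0
  then show ?case by (simp add: prob_space)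
next
  case (Suc n)
  note [measurable] = Suc.prems(1)
  have B_meas [measurable]: "B k \<in> M \<rightarrow>\<^sub>M N" for k
    using B by (auto simp: indep_vars_def)
  interpret K: prob_space \<kappa>
    unfolding law[of 0, symmetric] by (rule prob_space_distr) measurable
  have sets_K [measurable_cong]: "sets \<kappa> = sets N"
    unfolding law[of 0, symmetric] by simp
  have Q_meas: "Q f \<in> borel_measurable borel"
    unfolding Q by measurable
  have Q_bounds: "0 \<le> Q f v \<and> Q f v \<le> 1" for v
  proof -
    have bd: "0 \<le> w (v, b) * f (v + y b) \<and> w (v, b) * f (v + y b) \<le> 1" for b
      using w_bounds[of "(v, b)"] Suc.prems(2)[of "v + y b"] by (simp add: mult_le_one)
    then have "integrable \<kappa> (\<lambda>b. w (v, b) * f (v + y b))"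
      by (intro K.integrable_const_bound[where B = 1]) auto
    then have "Q f v \<le> (\<integral>b. 1 \<partial>\<kappa>)"
      unfolding Q using bd by (intro integral_mono) auto
    moreover have "0 \<le> Q f v"
      unfolding Q using bd by (intro integral_nonneg_AE) auto
    ultimately show ?thesis by (simp add: K.prob_space)
  qed
  let ?P = "PiM {..<n} (\<lambda>_. N)"
  define V where "V k x = v + (\<Sum>j<k. y (x j))" for k and x :: "nat \<Rightarrow> 'b"
  define H where "H = (\<lambda>z. (\<Prod>k<n. w (V k (fst z), fst z k)) *
      (w (V n (fst z), snd z) * f (V n (fst z) + y (snd z))))"
  have "(\<lambda>x. y (x j)) \<in> borel_measurable ?P" if "j < n" for j
    using measurable_compose[OF measurable_component_singleton[of j "{..<n}" "\<lambda>_. N"] y] that by simp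
  then have V_meas: "V k \<in> borel_measurable ?P" if "k \<le> n" for k
    unfolding V_def using that
    by (intro borel_measurable_add borel_measurable_const borel_measurable_sum) auto
  have [measurable]: "V n \<in> borel_measurable ?P" by (rule V_meas) simp
  have "(\<lambda>x. \<Prod>k<n. w (V k x, x k)) \<in> borel_measurable ?P"
    by (intro borel_measurable_prod measurable_compose[OF _ w] measurable_Pair V_meas
        measurable_component_singleton) auto
  then have "(\<lambda>z. \<Prod>k<n. w (V k (fst z), fst z k)) \<in> borel_measurable (?P \<Otimes>\<^sub>M N)"
    by (rule measurable_compose[OF measurable_fst])
  moreover have "(\<lambda>z. w (V n (fst z), snd z) * f (V n (fst z) + y (snd z))) \<in> borel_measurable (?P \<Otimes>\<^sub>M N)"
    by measurable
  ultimately have H_meas: "H \<in> borel_measurable (?P \<Otimes>\<^sub>M N)"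
    unfolding H_def by (rule borel_measurable_times)
  have H_bounds: "\<bar>H z\<bar> \<le> 1" for z
  proof -
    have "0 \<le> (\<Prod>k<n. w (V k (fst z), fst z k)) \<and> (\<Prod>k<n. w (V k (fst z), fst z k)) \<le> 1"
      using w_bounds by (auto intro!: prod_nonneg prod_le_1)
    moreover have "0 \<le> w (V n (fst z), snd z) * f (V n (fst z) + y (snd z)) \<and>
        w (V n (fst z), snd z) * f (V n (fst z) + y (snd z)) \<le> 1"
      using w_bounds[of "(V n (fst z), snd z)"] Suc.prems(2)[of "V n (fst z) + y (snd z)"]
      by (auto intro: mult_le_one)
    ultimately show ?thesis unfolding H_def by (auto simp: abs_mult intro: mult_le_one)
  qed
  have past_meas: "(\<lambda>\<omega>. \<lambda>i\<in>{..<n}. B i \<omega>) \<in> M \<rightarrow>\<^sub>M ?P"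
    by (intro measurable_restrict B_meas)
  have past: "V k (\<lambda>i\<in>{..<n}. B i \<omega>) = v + (\<Sum>j<k. y (B j \<omega>))" if "k \<le> n" for k \<omega>
    using that by (auto simp: V_def intro!: sum.cong)
  have "indep_var ?P (\<lambda>\<omega>. \<lambda>i\<in>{..<n}. B i \<omega>) (PiM {n} (\<lambda>_. N)) (\<lambda>\<omega>. \<lambda>i\<in>{n}. B i \<omega>)"
    by (rule indep_var_restrict[OF B]) auto
  note past_present = indep_varD[OF this]
  have indep: "prob (((\<lambda>\<omega>. \<lambda>i\<in>{..<n}. B i \<omega>) -` A \<inter> space M) \<inter> (B n -` C \<inter> space M)) =
      prob ((\<lambda>\<omega>. \<lambda>i\<in>{..<n}. B i \<omega>) -` A \<inter> space M) * prob (B n -` C \<inter> space M)"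
    if "A \<in> sets ?P" "C \<in> sets N" for A C
  proof -
    let ?C = "(\<lambda>x. x n) -` C \<inter> space (PiM {n} (\<lambda>_. N))"
    have C: "?C \<in> sets (PiM {n} (\<lambda>_. N))"
      using that(2) by (intro measurable_sets[OF measurable_component_singleton]) auto
    have "(\<lambda>\<omega>. \<lambda>i\<in>{n}. B i \<omega>) -` ?C \<inter> space M = B n -` C \<inter> space M"
      using measurable_space[OF B_meas] by (auto simp: space_PiM)
    moreover have "(\<lambda>\<omega>. (\<lambda>i\<in>{..<n}. B i \<omega>, \<lambda>i\<in>{n}. B i \<omega>)) -` (A \<times> ?C) \<inter> space M =
        ((\<lambda>\<omega>. \<lambda>i\<in>{..<n}. B i \<omega>) -` A \<inter> space M) \<inter> ((\<lambda>\<omega>. \<lambda>i\<in>{n}. B i \<omega>) -` ?C \<inter> space M)"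
      by auto
    ultimately show ?thesis using past_present[OF that(1) C] by simp
  qed
  have "(\<integral>\<omega>. (\<Prod>k<Suc n. w (v + (\<Sum>j<k. y (B j \<omega>)), B k \<omega>)) * f (v + (\<Sum>j<Suc n. y (B j \<omega>))) \<partial>M)
      = (\<integral>\<omega>. H (\<lambda>i\<in>{..<n}. B i \<omega>, B n \<omega>) \<partial>M)"
    by (intro Bochner_Integration.integral_cong refl) (simp add: H_def past add.assoc)
  also have "\<dots> = (\<integral>\<omega>. \<integral>b. H (\<lambda>i\<in>{..<n}. B i \<omega>, b) \<partial>\<kappa> \<partial>M)"
    unfolding law[of n, symmetric]
    by (rule independent_expectation(1)[OF past_meas B_meas[of n] indep H_meas H_bounds])
  also have "\<dots> = (\<integral>\<omega>. (\<Prod>k<n. w (v + (\<Sum>j<k. y (B j \<omega>)), B k \<omega>)) * Q f (v + (\<Sum>j<n. y (B j \<omega>))) \<partial>M)"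
    by (intro Bochner_Integration.integral_cong refl) (simp add: H_def past Q)
  also have "\<dots> = (Q ^^ n) (Q f) v"
    by (rule Suc.IH[OF Q_meas Q_bounds])
  also have "\<dots> = (Q ^^ Suc n) f v"
    by (simp add: funpow_swap1)
  finally show ?case .
qed

end

text \<open>
  A class of test functions that is stable under all operators below and makes every integral exist.
\<close>
definition unit_valued :: "(real \<Rightarrow> real) \<Rightarrow> bool" where
  "unit_valued f \<longleftrightarrow> f \<in> borel_measurable borel \<and> (\<forall>v. 0 \<le> f v \<and> f v \<le> 1)"

definition killed :: "(real \<Rightarrow> real) \<Rightarrow> real \<Rightarrow> real" where
  "killed f v = of_bool (0 \<le> v) * f v"

definition shifted_mean :: "real measure \<Rightarrow> (real \<Rightarrow> real) \<Rightarrow> real \<Rightarrow> real" where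
  "shifted_mean L f v = (\<integral>x. f (v + x) \<partial>L)"

lemma unit_valued_killed: "unit_valued f \<Longrightarrow> unit_valued (killed f)"
  unfolding unit_valued_def killed_def[abs_def] of_bool_def by auto

lemma unit_valued_shifted_mean:
  assumes L: "prob_space L" "sets L = sets borel" and f: "unit_valued f"
  shows "unit_valued (shifted_mean L f)"
proof -
  interpret prob_space L by fact
  note L(2) [measurable_cong]
  have [measurable]: "f \<in> borel_measurable borel" and f01: "0 \<le> f v" "f v \<le> 1" for v
    using f by (auto simp: unit_valued_def)
  have "shifted_mean L f \<in> borel_measurable borel"
    unfolding shifted_mean_def[abs_def] by measurable
  moreover have "0 \<le> shifted_mean L f v" for v
    unfolding shifted_mean_def using f01 by (intro integral_nonneg_AE) auto
  moreover have "shifted_mean L f v \<le> 1" for v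
  proof -
    have "integrable L (\<lambda>x. f (v + x))"
      using f01 by (intro integrable_const_bound[where B = 1]) auto
    then have "shifted_mean L f v \<le> (\<integral>x. 1 \<partial>L)"
      unfolding shifted_mean_def using f01 by (intro integral_mono) auto
    then show ?thesis by (simp add: prob_space)
  qed
  ultimately show ?thesis by (simp add: unit_valued_def)
qed

lemma shifted_mean_tendsto:
  assumes L: "prob_space L" "sets L = sets borel" and f: "\<And>n. unit_valued (f n)"
    and lim: "\<And>v. (\<lambda>n. f n v) \<longlonglongrightarrow> h v"
  shows "(\<lambda>n. shifted_mean L (f n) v) \<longlonglongrightarrow> shifted_mean L h v"
proof -
  interpret prob_space L by fact
  note L(2) [measurable_cong]
  have f_meas [measurable]: "f n \<in> borel_measurable borel" and f01: "0 \<le> f n v" "f n v \<le> 1" for n v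
    using f[of n] by (auto simp: unit_valued_def)
  have [measurable]: "h \<in> borel_measurable borel"
    by (rule borel_measurable_LIMSEQ_real[OF lim f_meas])
  show ?thesis
    unfolding shifted_mean_def
    by (rule integral_dominated_convergence[where w = "\<lambda>_. 1"]) (use lim f01 in auto)
qed

section \<open>Survival under continuous and Poisson observation\<close>

lemma passage_time_infinite: "passage_time x = \<infinity> \<longleftrightarrow> (\<forall>t\<ge>0. 0 \<le> x t)"
proof -
  have "passage_time x = \<infinity> \<longleftrightarrow> (\<forall>t. 0 \<le> t \<longrightarrow> \<not> x t < 0)"
    unfolding passage_time_def top_ereal_def[symmetric] Inf_top_conv by (auto simp: top_ereal_def)
  then show ?thesis by (simp add: not_less)
qed

lemma passage_time_obs_infinite: "passage_time_obs \<tau> x = \<infinity> \<longleftrightarrow> (\<forall>i. 0 \<le> x (\<tau> i))"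
proof -
  have "passage_time_obs \<tau> x = \<infinity> \<longleftrightarrow> (\<forall>i. \<not> x (\<tau> i) < 0)"
    unfolding passage_time_obs_def top_ereal_def[symmetric] Inf_top_conv by (auto simp: top_ereal_def)
  then show ?thesis by (simp add: not_less)
qed

context observed_levy_process
begin

definition inf_law :: "real measure" where
  "inf_law = distr M borel (\<lambda>\<omega>. fst (epoch_block 0 \<omega>))"

definition sup_law :: "real measure" where
  "sup_law = distr M borel first_supremum"

definition block_law :: "(real \<times> real) measure" where
  "block_law = distr M (borel \<Otimes>\<^sub>M borel) (epoch_block 0)"

text \<open>
  The one-period operator of continuous observation: the walk is killed if the path becomes negative
  anywhere in the period.
\<close>
definition survive_block :: "(real \<Rightarrow> real) \<Rightarrow> real \<Rightarrow> real" where
  "survive_block f v = (\<integral>b. of_bool (0 \<le> v + fst b) * f (v + snd b) \<partial>block_law)"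

text \<open>
  The one-period operator of Poisson observation: the walk is killed if it is negative at the end of
  the period.
\<close>
definition survive_epoch :: "(real \<Rightarrow> real) \<Rightarrow> real \<Rightarrow> real" where
  "survive_epoch f v = (\<integral>b. of_bool (0 \<le> v + snd b) * f (v + snd b) \<partial>block_law)"

lemma prob_space_inf_law: "prob_space inf_law" and sets_inf_law [measurable_cong]: "sets inf_law = sets borel"
  unfolding inf_law_def by (rule prob_space_distr) simp_all

lemma prob_space_sup_law: "prob_space sup_law" and sets_sup_law [measurable_cong]: "sets sup_law = sets borel"
  unfolding sup_law_def by (rule prob_space_distr) simp_all

text \<open>
  The two orders of integration correspond to making the upward move last or making it first.
\<close>
lemma block_law_integral:
  fixes F :: "real \<times> real \<Rightarrow> real"
  assumes F [measurable]: "F \<in> borel_measurable (borel \<Otimes>\<^sub>M borel)" and bound: "\<And>z. \<bar>F z\<bar> \<le> 1"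
  shows "(\<integral>b. F b \<partial>block_law) = (\<integral>d. \<integral>x. F (d, d + x) \<partial>sup_law \<partial>inf_law)"
    and "(\<integral>b. F b \<partial>block_law) = (\<integral>x. \<integral>d. F (d, d + x) \<partial>inf_law \<partial>sup_law)"
proof -
  interpret LD: prob_space inf_law by (rule prob_space_inf_law)
  interpret LU: prob_space sup_law by (rule prob_space_sup_law)
  interpret P: pair_prob_space inf_law sup_law ..
  have int: "integrable (inf_law \<Otimes>\<^sub>M sup_law) (\<lambda>z. F (fst z, fst z + snd z))"
    using bound by (intro P.integrable_const_bound[where B = 1]) auto
  have "(\<integral>b. F b \<partial>block_law) = (\<integral>\<omega>. F (epoch_block 0 \<omega>) \<partial>M)"
    unfolding block_law_def by (rule integral_distr) measurable
  also have "\<dots> = (\<integral>z. F (fst z, fst z + snd z) \<partial>distr M (borel \<Otimes>\<^sub>M borel)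
      (\<lambda>\<omega>. (fst (epoch_block 0 \<omega>), snd (epoch_block 0 \<omega>) - fst (epoch_block 0 \<omega>))))"
    by (subst integral_distr) auto
  also have "\<dots> = (\<integral>z. F (fst z, fst z + snd z) \<partial>(inf_law \<Otimes>\<^sub>M sup_law))"
    unfolding first_block_factorization inf_law_def sup_law_def ..
  finally have eq: "(\<integral>b. F b \<partial>block_law) = (\<integral>z. F (fst z, fst z + snd z) \<partial>(inf_law \<Otimes>\<^sub>M sup_law))" .
  show "(\<integral>b. F b \<partial>block_law) = (\<integral>d. \<integral>x. F (d, d + x) \<partial>sup_law \<partial>inf_law)"
    unfolding eq using P.integral_fst'[OF int] by simp
  show "(\<integral>b. F b \<partial>block_law) = (\<integral>x. \<integral>d. F (d, d + x) \<partial>inf_law \<partial>sup_law)"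
    unfolding eq using P.integral_snd[of "\<lambda>d x. F (d, d + x)"] int by (simp add: case_prod_beta')
qed

text \<open>
  By the factorization of the block law the infimum is reached first, where killing happens, and the
  independent rise follows.
\<close>
lemma survive_block_eq:
  assumes f: "unit_valued f"
  shows "survive_block f = shifted_mean inf_law (killed (shifted_mean sup_law f))"
proof
  fix v
  have [measurable]: "f \<in> borel_measurable borel" and f01: "0 \<le> f v" "f v \<le> 1" for v
    using f by (auto simp: unit_valued_def)
  have "survive_block f v = (\<integral>d. \<integral>x. of_bool (0 \<le> v + d) * f (v + (d + x)) \<partial>sup_law \<partial>inf_law)"
    unfolding survive_block_def using f01
    by (subst block_law_integral(1)) (auto simp: of_bool_def)
  then show "survive_block f v = shifted_mean inf_law (killed (shifted_mean sup_law f)) v"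
    by (simp add: shifted_mean_def killed_def add.assoc)
qed

text \<open>
  Here killing happens after both moves, whose order is therefore immaterial by Fubini.
\<close>
lemma survive_epoch_eq:
  assumes f: "unit_valued f"
  shows "survive_epoch f = shifted_mean sup_law (shifted_mean inf_law (killed f))"
proof
  fix v
  have [measurable]: "f \<in> borel_measurable borel" and f01: "0 \<le> f v" "f v \<le> 1" for v
    using f by (auto simp: unit_valued_def)
  have "survive_epoch f v = (\<integral>x. \<integral>d. of_bool (0 \<le> v + (d + x)) * f (v + (d + x)) \<partial>inf_law \<partial>sup_law)"
    unfolding survive_epoch_def using f01
    by (subst block_law_integral(2)) (auto simp: of_bool_def)
  then show "survive_epoch f v = shifted_mean sup_law (shifted_mean inf_law (killed f)) v"
    by (simp add: shifted_mean_def killed_def ac_simps)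
qed

lemma unit_valued_survive_block: "unit_valued f \<Longrightarrow> unit_valued (survive_block f)"
  by (simp add: survive_block_eq unit_valued_shifted_mean unit_valued_killed
      prob_space_inf_law prob_space_sup_law sets_inf_law sets_sup_law)

lemma unit_valued_survive_epoch: "unit_valued f \<Longrightarrow> unit_valued (survive_epoch f)"
  by (simp add: survive_epoch_eq unit_valued_shifted_mean unit_valued_killed
      prob_space_inf_law prob_space_sup_law sets_inf_law sets_sup_law)

lemma unit_valued_survive_epoch_power: "unit_valued f \<Longrightarrow> unit_valued ((survive_epoch ^^ n) f)"
  by (induction n) (auto intro: unit_valued_survive_epoch)

lemma unit_valued_survive_block_power: "unit_valued f \<Longrightarrow> unit_valued ((survive_block ^^ n) f)"
  by (induction n) (auto intro: unit_valued_survive_block)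

text \<open>
  With \<open>survive_block = P K R\<close> and \<open>survive_epoch = R P K\<close> this is \<open>R (P K R) = (R P K) R\<close>, iterated.
\<close>
lemma sup_mean_intertwines:
  assumes f: "unit_valued f"
  shows "shifted_mean sup_law ((survive_block ^^ n) f) = (survive_epoch ^^ n) (shifted_mean sup_law f)"
proof (induction n)
  case (Suc n)
  let ?g = "(survive_block ^^ n) f"
  have g: "unit_valued ?g" by (rule unit_valued_survive_block_power[OF f])
  have "shifted_mean sup_law (survive_block ?g) = survive_epoch (shifted_mean sup_law ?g)"
    using g by (simp add: survive_block_eq survive_epoch_eq unit_valued_shifted_mean
        prob_space_sup_law sets_sup_law)
  then show ?case using Suc by simp
qed simp

text \<open>
  If all epochs are at most \<open>c\<close>, then so are all inter-arrival times. For the first \<open>n\<close> of them this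
  has probability \<open>(1 - exp (- c l)) ^ n\<close>.
\<close>
lemma AE_epochs_unbounded: "AE \<omega> in M. \<forall>c. \<exists>n. c < T n \<omega>"
proof -
  have "AE \<omega> in M. \<exists>n. real c < T n \<omega>" for c :: nat
  proof (rule AE_I)
    let ?N = "{\<omega> \<in> space M. \<forall>n. T n \<omega> \<le> real c}"
    show "{\<omega> \<in> space M. \<not> (\<exists>n. real c < T n \<omega>)} \<subseteq> ?N" by (auto simp: not_less)
    show N: "?N \<in> events" by measurable
    let ?r = "1 - exp (- real c * l)"
    have r: "0 \<le> ?r" "?r < 1" using intensity_pos by auto
    have "prob ?N \<le> ?r ^ n" for n
    proof (cases "n = 0")
      case False
      let ?A = "\<lambda>k. (\<lambda>\<omega>. T (Suc k) \<omega> - T k \<omega>) -` {..real c} \<inter> space M"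
      have "?N \<subseteq> (\<Inter>k\<in>{..<n}. ?A k)"
      proof
        fix \<omega> assume \<omega>: "\<omega> \<in> ?N"
        have "T (Suc k) \<omega> - T k \<omega> \<le> real c" for k
        proof -
          have "T (Suc k) \<omega> \<le> real c" "0 \<le> T k \<omega>" using \<omega> epochs_nonneg by auto
          then show ?thesis by linarith
        qed
        then show "\<omega> \<in> (\<Inter>k\<in>{..<n}. ?A k)" using \<omega> by auto
      qed
      moreover have "(\<Inter>k\<in>{..<n}. ?A k) \<in> events"
        using False by (intro sets.finite_INT) auto
      ultimately have "prob ?N \<le> prob (\<Inter>k\<in>{..<n}. ?A k)"
        by (rule finite_measure_mono)
      also have "\<dots> = (\<Prod>k\<in>{..<n}. prob (?A k))"
        using False by (intro indep_varsD[OF interarrival_indep]) auto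
      also have "\<dots> = (\<Prod>k\<in>{..<n}. ?r)"
      proof (rule prod.cong[OF refl])
        fix k
        have "?A k = {\<omega> \<in> space M. T (Suc k) \<omega> - T k \<omega> \<le> real c}" by auto
        then show "prob (?A k) = ?r"
          using exponential_distributedD_le[OF interarrival_exponential[of k] _ intensity_pos, of "real c"] by simp
      qed
      finally show ?thesis by simp
    qed simp
    moreover have "(\<lambda>n. ?r ^ n) \<longlonglongrightarrow> 0" using r by (intro LIMSEQ_realpow_zero)
    ultimately have "prob ?N \<le> 0" by (intro LIMSEQ_le_const) auto
    then show "emeasure M ?N = 0"
      by (simp add: emeasure_eq_measure measure_le_0_iff)
  qed
  then have "AE \<omega> in M. \<forall>c::nat. \<exists>n. real c < T n \<omega>" by (simp add: AE_all_countable)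
  then show ?thesis
  proof eventually_elim
    case (elim \<omega>)
    show ?case
    proof
      fix c :: real
      obtain m :: nat where "c \<le> real m" using real_arch_simple by blast
      with elim show "\<exists>n. c < T n \<omega>" by (meson le_less_trans)
    qed
  qed
qed

lemma sum_block_increments: "(\<Sum>j<k. snd (epoch_block j \<omega>)) = X (T k \<omega>) \<omega> - X (T 0 \<omega>) \<omega>"
  unfolding epoch_block_def block_def snd_conv
  using sum_lessThan_telescope[of "\<lambda>j. X (T j \<omega>) \<omega>" k] by simp

text \<open>
  The function \<open>h\<close> selects the level that is checked in each period: the lowest one or the final one.
\<close>
lemma walk_survival_probability:
  assumes [measurable]: "h \<in> borel_measurable (borel \<Otimes>\<^sub>M borel)"
    and S: "\<And>g v. S g v = (\<integral>b. of_bool (0 \<le> v + h b) * g (v + snd b) \<partial>block_law)"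
  shows "prob {\<omega> \<in> space M. \<forall>k\<in>{..<n}. 0 \<le> v + (\<Sum>j<k. snd (epoch_block j \<omega>)) + h (epoch_block k \<omega>)} =
    (S ^^ n) (\<lambda>_. 1) v" (is "prob (?A) = _")
    and "(\<lambda>n. (S ^^ n) (\<lambda>_. 1) v) \<longlonglongrightarrow>
      prob {\<omega> \<in> space M. \<forall>k. 0 \<le> v + (\<Sum>j<k. snd (epoch_block j \<omega>)) + h (epoch_block k \<omega>)}"
    (is "_ \<longlonglongrightarrow> prob ?B")
proof -
  let ?w = "\<lambda>z. of_bool (0 \<le> fst z + h (snd z)) :: real"
  let ?A = "\<lambda>n. {\<omega> \<in> space M. \<forall>k\<in>{..<n}. 0 \<le> v + (\<Sum>j<k. snd (epoch_block j \<omega>)) + h (epoch_block k \<omega>)}"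
  have A [measurable]: "?A n \<in> events" for n
    by (intro pred_intros_finite predE) measurable
  have eq: "prob (?A n) = (S ^^ n) (\<lambda>_. 1) v" for n
  proof -
    have w: "?w \<in> borel_measurable (borel \<Otimes>\<^sub>M (borel \<Otimes>\<^sub>M borel))"
      unfolding of_bool_def by measurable
    have "(\<integral>\<omega>. (\<Prod>k<n. ?w (v + (\<Sum>j<k. snd (epoch_block j \<omega>)), epoch_block k \<omega>)) * 1 \<partial>M) = (S ^^ n) (\<lambda>_. 1) v"
      by (rule iid_walk_expectation[OF epoch_blocks_independent epoch_block_law _ w])
        (auto simp: S block_law_def)
    moreover have "(\<integral>\<omega>. (\<Prod>k<n. ?w (v + (\<Sum>j<k. snd (epoch_block j \<omega>)), epoch_block k \<omega>)) * 1 \<partial>M) =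
        (\<integral>\<omega>. indicator (?A n) \<omega> \<partial>M)"
    proof (rule Bochner_Integration.integral_cong[OF refl])
      fix \<omega> assume \<omega>: "\<omega> \<in> space M"
      show "(\<Prod>k<n. ?w (v + (\<Sum>j<k. snd (epoch_block j \<omega>)), epoch_block k \<omega>)) * 1 = indicator (?A n) \<omega>"
      proof (cases "\<omega> \<in> ?A n")
        case True
        then show ?thesis by (auto intro!: prod.neutral)
      next
        case False
        with \<omega> obtain k where "k < n" "\<not> 0 \<le> v + (\<Sum>j<k. snd (epoch_block j \<omega>)) + h (epoch_block k \<omega>)" by auto
        then have "(\<Prod>k<n. ?w (v + (\<Sum>j<k. snd (epoch_block j \<omega>)), epoch_block k \<omega>)) = 0"
          by (intro prod_zero) auto
        then show ?thesis using False by simp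
      qed
    qed
    moreover have "?A n \<inter> space M = ?A n" by auto
    ultimately show ?thesis by simp
  qed
  then show "prob (?A n) = (S ^^ n) (\<lambda>_. 1) v" .
  have "(\<lambda>n. prob (?A n)) \<longlonglongrightarrow> prob (\<Inter>n. ?A n)"
    by (rule finite_Lim_measure_decseq) (auto simp: decseq_def)
  moreover have "(\<Inter>n. ?A n) = ?B" by auto
  ultimately show "(\<lambda>n. (S ^^ n) (\<lambda>_. 1) v) \<longlonglongrightarrow> prob ?B"
    by (simp add: eq)
qed

text \<open>
  Surviving all inter-epoch periods means surviving forever, since the epochs are almost surely unbounded.
\<close>
lemma survival_limit: "(\<lambda>n. (survive_block ^^ n) (\<lambda>_. 1) v) \<longlonglongrightarrow> survival M X v"
proof -
  let ?B = "{\<omega> \<in> space M. \<forall>k. 0 \<le> v + (\<Sum>j<k. snd (epoch_block j \<omega>)) + fst (epoch_block k \<omega>)}"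
  let ?S = "{\<omega> \<in> space M. passage_time (\<lambda>t. v + X t \<omega>) = \<infinity>}"
  have INF_nonneg: "0 \<le> v + (INF q\<in>{a..b}. X q \<omega>) \<longleftrightarrow> (\<forall>q\<in>{a..b}. 0 \<le> v + X q \<omega>)"
    if "\<omega> \<in> space M" "0 \<le> a" "a \<le> b" for \<omega> a b
  proof -
    have "- v \<le> (INF q\<in>{a..b}. X q \<omega>) \<longleftrightarrow> (\<forall>q\<in>{a..b}. - v \<le> X q \<omega>)"
      using that by (intro le_cINF_iff cadlag_bdd(1)[OF cadlag_paths]) auto
    then show ?thesis by (auto simp: neg_le_iff_le le_diff_eq algebra_simps)
  qed
  have "?S = {\<omega> \<in> space M. \<forall>n::nat. 0 \<le> v + (INF q\<in>{\<bar>0\<bar>..\<bar>0\<bar> + \<bar>real n\<bar>}. X q \<omega>)}"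
  proof -
    have "(\<forall>t\<ge>0. 0 \<le> v + X t \<omega>) \<longleftrightarrow> (\<forall>n::nat. \<forall>q\<in>{0..real n}. 0 \<le> v + X q \<omega>)" for \<omega>
      using real_arch_simple by fastforce
    then show ?thesis
      by (auto simp: passage_time_infinite INF_nonneg)
  qed
  also have "\<dots> \<in> events"
  proof -
    have "(\<lambda>\<omega>. INF q\<in>{\<bar>0\<bar>..\<bar>0\<bar> + \<bar>real n\<bar>}. X q \<omega>) \<in> borel_measurable M" for n
      using measurable_compose[OF _ measurable_cadlag_INF[OF measurable_process cadlag_paths],
          of "\<lambda>\<omega>. (\<omega>, 0, real n)" M] by simp
    note [measurable] = this
    show ?thesis by measurable
  qed
  finally have S: "?S \<in> events" .
  have B: "?B \<in> events" by measurable
  have "prob ?B = prob ?S"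
  proof (rule finite_measure_eq_AE[OF _ B S])
    show "AE \<omega> in M. \<omega> \<in> ?B \<longleftrightarrow> \<omega> \<in> ?S"
      using starts_at_0 AE_epochs_unbounded AE_space
    proof eventually_elim
      case (elim \<omega>)
      have mono: "T k \<omega> \<le> T (Suc k) \<omega>" for k
        using epochs_increasing[OF elim(3)] by (rule less_imp_le)
      have level: "v + (\<Sum>j<k. snd (epoch_block j \<omega>)) + fst (epoch_block k \<omega>) =
          v + (INF q\<in>{T k \<omega>..T (Suc k) \<omega>}. X q \<omega>)" for k
        unfolding sum_block_increments using elim(1) epoch_0[OF elim(3)]
        by (simp add: epoch_block_def block_def)
      have "\<omega> \<in> ?B \<longleftrightarrow> (\<forall>k. \<forall>q\<in>{T k \<omega>..T (Suc k) \<omega>}. 0 \<le> v + X q \<omega>)"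
        unfolding mem_Collect_eq level INF_nonneg[OF elim(3) epochs_nonneg[OF elim(3)] mono]
        using elim(3) by simp
      also have "\<dots> \<longleftrightarrow> (\<forall>t\<ge>0. 0 \<le> v + X t \<omega>)"
      proof safe
        fix t :: real assume *: "\<forall>k. \<forall>q\<in>{T k \<omega>..T (Suc k) \<omega>}. 0 \<le> v + X q \<omega>" and t: "0 \<le> t"
        define n where "n = (LEAST n. t < T n \<omega>)"
        have n: "t < T n \<omega>"
          unfolding n_def using elim(2) by (meson LeastI_ex)
        then obtain k where k: "n = Suc k"
          using t epoch_0[OF elim(3)] by (cases n) auto
        then have "\<not> t < T k \<omega>"
          using not_less_Least[of k "\<lambda>n. t < T n \<omega>"] by (simp add: n_def)
        with n k have "t \<in> {T k \<omega>..T (Suc k) \<omega>}" by simp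
        with * show "0 \<le> v + X t \<omega>" by blast
      next
        fix k q assume "\<forall>t\<ge>0. 0 \<le> v + X t \<omega>" "q \<in> {T k \<omega>..T (Suc k) \<omega>}"
        then show "0 \<le> v + X q \<omega>" using epochs_nonneg[OF elim(3), of k] by auto
      qed
      finally show ?case using elim(3) by (simp add: passage_time_infinite)
    qed
  qed
  then show ?thesis
    using walk_survival_probability(2)[of fst survive_block v] by (simp add: survive_block_def survival_def)
qed

text \<open>
  The operator does not check the epoch 0; this is the reason for the indicator of a nonnegative
  starting level.
\<close>
lemma survival_obs_limit: "(\<lambda>n. killed ((survive_epoch ^^ n) (\<lambda>_. 1)) v) \<longlonglongrightarrow> survival_obs M T X v"
proof -
  let ?B = "{\<omega> \<in> space M. \<forall>k. 0 \<le> v + (\<Sum>j<k. snd (epoch_block j \<omega>)) + snd (epoch_block k \<omega>)}"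
  let ?S = "{\<omega> \<in> space M. passage_time_obs (\<lambda>n. T n \<omega>) (\<lambda>t. v + X t \<omega>) = \<infinity>}"
  have at_epoch [measurable]: "(\<lambda>\<omega>. X (T n \<omega>) \<omega>) \<in> borel_measurable M" for n
  proof -
    have "(\<lambda>\<omega>. X 0 \<omega> + (\<Sum>j<n. snd (epoch_block j \<omega>))) \<in> borel_measurable M"
      by (intro borel_measurable_add measurable_process borel_measurable_sum) auto
    moreover have "X 0 \<omega> + (\<Sum>j<n. snd (epoch_block j \<omega>)) = X (T n \<omega>) \<omega>" if "\<omega> \<in> space M" for \<omega>
      using epoch_0[OF that] by (simp add: sum_block_increments)
    ultimately show ?thesis by (simp cong: measurable_cong)
  qed
  have S: "?S \<in> events" unfolding passage_time_obs_infinite by measurable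
  have B: "?B \<in> events" by measurable
  have AE: "AE \<omega> in M. \<omega> \<in> ?S \<longleftrightarrow> 0 \<le> v \<and> \<omega> \<in> ?B"
    using starts_at_0 AE_space
  proof eventually_elim
    case (elim \<omega>)
    have "\<omega> \<in> ?B \<longleftrightarrow> (\<forall>k. 0 \<le> v + X (T (Suc k) \<omega>) \<omega>)"
    proof -
      have level: "v + (\<Sum>j<k. snd (epoch_block j \<omega>)) + snd (epoch_block k \<omega>) = v + X (T (Suc k) \<omega>) \<omega>" for k
        unfolding sum_block_increments using elim epoch_0[OF elim(2)] by (simp add: epoch_block_def block_def)
      show ?thesis unfolding mem_Collect_eq level using elim(2) by simp
    qed
    moreover have "(\<forall>i. 0 \<le> v + X (T i \<omega>) \<omega>) \<longleftrightarrow> 0 \<le> v \<and> (\<forall>k. 0 \<le> v + X (T (Suc k) \<omega>) \<omega>)"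
      using elim(1) epoch_0[OF elim(2)] by (metis add.right_neutral old.nat.exhaust)
    ultimately show ?case using elim(2) by (simp add: passage_time_obs_infinite)
  qed
  have "prob ?S = of_bool (0 \<le> v) * prob ?B"
  proof (cases "0 \<le> v")
    case True
    then have "prob ?S = prob ?B"
      using AE by (intro finite_measure_eq_AE[OF _ S B]) simp
    with True show ?thesis by simp
  next
    case False
    then have "prob ?S = prob {}"
      using AE by (intro finite_measure_eq_AE[OF _ S]) auto
    with False show ?thesis by simp
  qed
  moreover have "(\<lambda>n. (survive_epoch ^^ n) (\<lambda>_. 1) v) \<longlonglongrightarrow> prob ?B"
    by (rule walk_survival_probability(2)) (simp_all add: survive_epoch_def)
  ultimately show ?thesis
    unfolding killed_def survival_obs_def by (auto intro: tendsto_mult)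
qed

lemma measurable_survival: "survival M X \<in> borel_measurable borel"
  by (rule borel_measurable_LIMSEQ_real[OF survival_limit])
    (use unit_valued_survive_block_power[of "\<lambda>_. 1"] in \<open>auto simp: unit_valued_def\<close>)

lemma measurable_survival_obs: "survival_obs M T X \<in> borel_measurable borel"
  by (rule borel_measurable_LIMSEQ_real[OF survival_obs_limit])
    (use unit_valued_killed[OF unit_valued_survive_epoch_power[of "\<lambda>_. 1"]] in
      \<open>auto simp: unit_valued_def\<close>)

lemma running_inf_law: "distr M borel (\<lambda>\<omega>. running_inf X (T 1 \<omega>) \<omega>) = inf_law"
proof -
  have eq: "running_inf X (T 1 \<omega>) \<omega> = fst (epoch_block 0 \<omega>) + X 0 \<omega>" if "\<omega> \<in> space M" for \<omega>
    using epoch_0[OF that] by (simp add: running_inf_def epoch_block_def block_def)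
  have [measurable]: "X 0 \<in> borel_measurable M" by (rule measurable_process) simp
  have "distr M borel (\<lambda>\<omega>. running_inf X (T 1 \<omega>) \<omega>) = distr M borel (\<lambda>\<omega>. fst (epoch_block 0 \<omega>) + X 0 \<omega>)"
    by (intro distr_cong eq refl)
  also have "\<dots> = inf_law"
    unfolding inf_law_def by (rule distr_cong_AE) (use starts_at_0 in auto)
  finally show ?thesis .
qed

lemma running_sup_law: "distr M borel (\<lambda>\<omega>. running_sup X (T 1 \<omega>) \<omega>) = sup_law"
proof -
  have eq: "running_sup X (T 1 \<omega>) \<omega> = first_supremum \<omega> + X 0 \<omega>" for \<omega>
    by (simp add: running_sup_def first_supremum_def)
  have [measurable]: "X 0 \<in> borel_measurable M" by (rule measurable_process) simp
  show ?thesis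
    unfolding eq sup_law_def by (rule distr_cong_AE) (use starts_at_0 in auto)
qed

text \<open>
  The limits of \<open>R (P K R)^n 1 = (R P K)^n 1\<close> and of \<open>(P K R)^(n + 1) 1 = P K (R P K)^n 1\<close>. The outer
  indicator at the epoch 0 is part of the second identity but is absent from the first, which therefore
  needs \<open>0 \<le> u\<close>.
\<close>
theorem survival_identities:
  shows "0 \<le> u \<Longrightarrow> survival_obs M T X u = shifted_mean sup_law (survival M X) u"
    and "survival M X u = shifted_mean inf_law (survival_obs M T X) u"
proof -
  let ?one = "\<lambda>_::real. 1::real"
  have one: "unit_valued ?one" by (simp add: unit_valued_def)
  have mean_one: "shifted_mean sup_law ?one = ?one"
    by (simp add: shifted_mean_def[abs_def] prob_space.prob_space[OF prob_space_sup_law])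
  have unit: "unit_valued ((survive_block ^^ n) ?one)" for n
    by (rule unit_valued_survive_block_power[OF one])
  have epoch: "shifted_mean sup_law ((survive_block ^^ n) ?one) = (survive_epoch ^^ n) ?one" for n
    using sup_mean_intertwines[OF one] mean_one by simp
  have unit_epoch: "unit_valued ((survive_epoch ^^ n) ?one)" for n
    by (rule unit_valued_survive_epoch_power[OF one])
  show "survival_obs M T X u = shifted_mean sup_law (survival M X) u" if u: "0 \<le> u"
  proof (rule LIMSEQ_unique)
    show "(\<lambda>n. (survive_epoch ^^ n) ?one u) \<longlonglongrightarrow> survival_obs M T X u"
      using survival_obs_limit[of u] u by (simp add: killed_def)
    show "(\<lambda>n. (survive_epoch ^^ n) ?one u) \<longlonglongrightarrow> shifted_mean sup_law (survival M X) u"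
      using shifted_mean_tendsto[OF prob_space_sup_law sets_sup_law unit survival_limit]
      unfolding epoch .
  qed
  show "survival M X u = shifted_mean inf_law (survival_obs M T X) u"
  proof (rule LIMSEQ_unique)
    show "(\<lambda>n. (survive_block ^^ Suc n) ?one u) \<longlonglongrightarrow> survival M X u"
      by (rule LIMSEQ_Suc[OF survival_limit])
    have "(survive_block ^^ Suc n) ?one = shifted_mean inf_law (killed ((survive_epoch ^^ n) ?one))" for n
      using survive_block_eq[OF unit] epoch by simp
    then show "(\<lambda>n. (survive_block ^^ Suc n) ?one u) \<longlonglongrightarrow> shifted_mean inf_law (survival_obs M T X) u"
      using shifted_mean_tendsto[OF prob_space_inf_law sets_inf_law
          unit_valued_killed[OF unit_epoch] survival_obs_limit]
      by simp
  qed
qed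

end

lemma generated_measurable:
  assumes "generated M N f \<subseteq> sets M" "f \<in> space M \<rightarrow> space N"
  shows "f \<in> M \<rightarrow>\<^sub>M N"
proof (rule measurableI)
  show "f x \<in> space N" if "x \<in> space M" for x
    using assms(2) that by blast
  show "f -` A \<inter> space M \<in> sets M" if "A \<in> sets N" for A
    using assms(1) in_vimage_algebra[OF that, of f "space M"] unfolding generated_def by blast
qed

theorem proposition1:
  fixes M :: "'a measure"
    and X :: "real \<Rightarrow> 'a \<Rightarrow> real"
    and T :: "nat \<Rightarrow> 'a \<Rightarrow> real"
    and D U :: "'a \<Rightarrow> real"
    and l u :: real
  assumes levy: "levy_process M X"
    and epochs: "poisson_epochs M l T"
    and independence: "prob_space.indep_sets M
          (\<lambda>i. [sigma_process M X, sigma_epochs M T, generated M borel D, generated M borel U] ! i)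
          {..<4}"
    and law_D: "distr M borel D = distr M borel (\<lambda>\<omega>. running_inf X (T 1 \<omega>) \<omega>)"
    and law_U: "distr M borel U = distr M borel (\<lambda>\<omega>. running_sup X (T 1 \<omega>) \<omega>)"
    and u: "0 \<le> u"
  shows "survival_obs M T X u = (\<integral>\<omega>. survival M X (u + U \<omega>) \<partial>M) \<and>
         survival M X u = (\<integral>\<omega>. survival_obs M T X (u + D \<omega>) \<partial>M)"
proof -
  interpret levy_process M X by (rule levy)
  interpret poisson_epochs M l T by (rule epochs)
  have events: "[sigma_process M X, sigma_epochs M T, generated M borel D, generated M borel U] ! i \<subseteq> events"
    if "i < 4" for i
    using independence that by (simp add: indep_sets_def)
  have path: "sigma_process M X \<subseteq> events" and epoch: "sigma_epochs M T \<subseteq> events"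
    and D: "generated M borel D \<subseteq> events" and U: "generated M borel U \<subseteq> events"
    using events[of 0] events[of 1] events[of 2] events[of 3] by (simp_all add: numeral_2_eq_2 numeral_3_eq_3)
  have [measurable]: "D \<in> borel_measurable M" "U \<in> borel_measurable M"
    using D U by (auto intro: generated_measurable)
  have "prob (A \<inter> B) = prob A * prob B" if "A \<in> sigma_process M X" "B \<in> sigma_epochs M T" for A B
    using indep_setsD[OF independence, of "{0, 1}" "\<lambda>i. if i = 0 then A else B"] that by (simp add: Int_commute)
  then have "indep_set (sigma_process M X) (sigma_epochs M T)"
    using path epoch by (simp add: indep_sets2_eq)
  then interpret observed_levy_process M X l T
    by unfold_locales
  note [measurable] = measurable_survival measurable_survival_obs
  have "0 \<le> u \<Longrightarrow> survival_obs M T X u = shifted_mean (distr M borel U) (survival M X) u"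
    "survival M X u = shifted_mean (distr M borel D) (survival_obs M T X) u"
    using survival_identities[of u] unfolding law_D law_U running_inf_law running_sup_law by auto
  then show ?thesis
    using u unfolding shifted_mean_def by (subst (asm) (1 2) integral_distr) auto
qed

end
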